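(* Consider the nonassociative simple Moufang loops in the form of Paige loops $M(F)$, where $F$ is a Galois extension of a prime field $\Delta$ in its algebraic closure, ordered by inclusion $\subseteq$. 1. The minimal nonassociative finite simple Moufang loops are exactly the Paige loops $M(GF(p))$, $p$ prime. The minimal nonassociative infinite simple Moufang loops are exactly the Paige loops $M(\mathbb{Q})$, where $\mathbb{Q}$ is the field of rational numbers. 2. Among the nonassociative simple Moufang loops, exactly the loops $M(\Delta)$, where $\Delta$ is a prime field, do not contain proper nonassociative subloops. 3. The loop $M(GF(q^m))$ is contained in the loop $M(GF(p^n))$ (with $p,q$ primes) if and only if $q=p$ and $n$ is divisible by $m$. 4. The maximal nonassociative simple Moufang loops are exactly the Paige loops $M(P)$, where $P$ is an algebraic closure of some prime field $\Delta$. For different prime fields $\Delta$ the corresponding loops $M(P)$ are isomorphic.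
   Context: A prime field is the field of rational numbers or $GF(p)$ with $p$ prime. A Galois extension is an algebraic, separable and normal field extension (not necessarily finite). For a field $F$, the matrix Cayley-Dickson algebra $C(F)$ consists of the matrices $\left(\begin{array}{ll}\alpha_1&\alpha_{12}\\ \alpha_{21}&\alpha_2\end{array}\right)$ with $\alpha_1,\alpha_2\in F$, $\alpha_{12},\alpha_{21}\in F^3$, with the usual entrywise addition and scalar multiplication, and with product $$\left(\begin{array}{ll}\alpha_1&\alpha_{12}\\ \alpha_{21}&\alpha_2\end{array}\right)\left(\begin{array}{ll}\beta_1&\beta_{12}\\ \beta_{21}&\beta_2\end{array}\right)=\left(\begin{array}{ll}\alpha_1\beta_1+(\alpha_{12},\beta_{21})&\alpha_1\beta_{12}+\beta_2\alpha_{12}-\alpha_{21}\times\beta_{21}\\ \beta_1\alpha_{21}+\alpha_2\beta_{21}+\alpha_{12}\times\beta_{12}&\alpha_2\beta_2+(\alpha_{21},\beta_{12})\end{array}\right),$$ where $(\cdot,\cdot)$ is the standard scalar product and $\times$ the vector product on $F^3$. The norm is $n(a)=\alpha_1\alpha_2-(\alpha_{12},\alpha_{21})$. $M^{\star}(F)$ is the Moufang loop of all elements of $C(F)$ of norm $1$, and $M(F)=M^{\star}(F)/\{\pm1\}$ is the Paige loop over $F$. For subfields $F\subseteq F'$ of an algebraic closure of $\Delta$, $M(F)$ is regarded as a subloop of $M(F')$.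
   Formalization: In 2, "subloops" means Paige loops M(F) of the class, since other proper nonassociative subloops exist, e.g. the integral classes in M(Q). In 4, "isomorphic" is corrected to "not isomorphic". In 1, "minimal infinite" means minimal in the whole ordered set and infinite. *)

theory Defs
  imports
    "HOL-Algebra.Algebraic_Closure_Type"
    "HOL-Number_Theory.Residues"
begin

section \<open>Moufang loops\<close>

locale loop =
  fixes G (structure)
  assumes one_closed: "\<one> \<in> carrier G"
    and m_closed: "\<lbrakk>x \<in> carrier G; y \<in> carrier G\<rbrakk> \<Longrightarrow> x \<otimes> y \<in> carrier G"
    and l_one: "x \<in> carrier G \<Longrightarrow> \<one> \<otimes> x = x"
    and r_one: "x \<in> carrier G \<Longrightarrow> x \<otimes> \<one> = x"
    and l_div: "\<lbrakk>a \<in> carrier G; b \<in> carrier G\<rbrakk> \<Longrightarrow> \<exists>!x. x \<in> carrier G \<and> a \<otimes> x = b"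
    and r_div: "\<lbrakk>a \<in> carrier G; b \<in> carrier G\<rbrakk> \<Longrightarrow> \<exists>!y. y \<in> carrier G \<and> y \<otimes> a = b"

locale moufang_loop = loop +
  assumes moufang:
    "\<lbrakk>x \<in> carrier G; y \<in> carrier G; z \<in> carrier G\<rbrakk>
      \<Longrightarrow> x \<otimes> (y \<otimes> (x \<otimes> z)) = ((x \<otimes> y) \<otimes> x) \<otimes> z"

definition nonassociative :: "('a, 'm) monoid_scheme \<Rightarrow> bool" where
  "nonassociative G \<longleftrightarrow>
     (\<exists>x\<in>carrier G. \<exists>y\<in>carrier G. \<exists>z\<in>carrier G.
        (x \<otimes>\<^bsub>G\<^esub> y) \<otimes>\<^bsub>G\<^esub> z \<noteq> x \<otimes>\<^bsub>G\<^esub> (y \<otimes>\<^bsub>G\<^esub> z))"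

definition subloop :: "'a set \<Rightarrow> ('a, 'm) monoid_scheme \<Rightarrow> bool" where
  "subloop H G \<longleftrightarrow> H \<subseteq> carrier G \<and> loop (G\<lparr>carrier := H\<rparr>)"

definition normal_subloop :: "'a set \<Rightarrow> ('a, 'm) monoid_scheme \<Rightarrow> bool" where
  "normal_subloop N G \<longleftrightarrow> subloop N G \<and>
     (\<forall>x\<in>carrier G. x <#\<^bsub>G\<^esub> N = N #>\<^bsub>G\<^esub> x) \<and>
     (\<forall>x\<in>carrier G. \<forall>y\<in>carrier G. x <#\<^bsub>G\<^esub> (y <#\<^bsub>G\<^esub> N) = (x \<otimes>\<^bsub>G\<^esub> y) <#\<^bsub>G\<^esub> N) \<and>
     (\<forall>x\<in>carrier G. \<forall>y\<in>carrier G. (N #>\<^bsub>G\<^esub> x) #>\<^bsub>G\<^esub> y = N #>\<^bsub>G\<^esub> (x \<otimes>\<^bsub>G\<^esub> y))"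

definition simple_loop :: "('a, 'm) monoid_scheme \<Rightarrow> bool" where
  "simple_loop G \<longleftrightarrow> loop G \<and> carrier G \<noteq> {\<one>\<^bsub>G\<^esub>} \<and>
     (\<forall>N. normal_subloop N G \<longrightarrow> N = {\<one>\<^bsub>G\<^esub>} \<or> N = carrier G)"

text \<open>The operation of the smaller loop is only compared on its carrier: loops over different
  fields are different records even when one loop is literally part of the other.\<close>

definition loop_le :: "('a, 'm) monoid_scheme \<Rightarrow> ('a, 'n) monoid_scheme \<Rightarrow> bool" where
  "loop_le K L \<longleftrightarrow> subloop (carrier K) L \<and>
     (\<forall>x\<in>carrier K. \<forall>y\<in>carrier K. x \<otimes>\<^bsub>K\<^esub> y = x \<otimes>\<^bsub>L\<^esub> y)"

definition loop_less :: "('a, 'm) monoid_scheme \<Rightarrow> ('a, 'n) monoid_scheme \<Rightarrow> bool" where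
  "loop_less K L \<longleftrightarrow> loop_le K L \<and> carrier K \<noteq> carrier L"

definition minimal_loop_in :: "'a monoid set \<Rightarrow> 'a monoid \<Rightarrow> bool" where
  "minimal_loop_in \<M> L \<longleftrightarrow> L \<in> \<M> \<and> (\<forall>K\<in>\<M>. \<not> loop_less K L)"

definition maximal_loop_in :: "'a monoid set \<Rightarrow> 'a monoid \<Rightarrow> bool" where
  "maximal_loop_in \<M> L \<longleftrightarrow> L \<in> \<M> \<and> (\<forall>K\<in>\<M>. \<not> loop_less L K)"


section \<open>Matrix Cayley-Dickson algebras and Paige loops\<close>

type_synonym 'a vec3 = "'a \<times> 'a \<times> 'a"

fun vadd :: "('a, 'm) ring_scheme \<Rightarrow> 'a vec3 \<Rightarrow> 'a vec3 \<Rightarrow> 'a vec3" where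
  "vadd R (a1, a2, a3) (b1, b2, b3) = (a1 \<oplus>\<^bsub>R\<^esub> b1, a2 \<oplus>\<^bsub>R\<^esub> b2, a3 \<oplus>\<^bsub>R\<^esub> b3)"

fun vsub :: "('a, 'm) ring_scheme \<Rightarrow> 'a vec3 \<Rightarrow> 'a vec3 \<Rightarrow> 'a vec3" where
  "vsub R (a1, a2, a3) (b1, b2, b3) = (a1 \<ominus>\<^bsub>R\<^esub> b1, a2 \<ominus>\<^bsub>R\<^esub> b2, a3 \<ominus>\<^bsub>R\<^esub> b3)"

fun vscale :: "('a, 'm) ring_scheme \<Rightarrow> 'a \<Rightarrow> 'a vec3 \<Rightarrow> 'a vec3" where
  "vscale R c (a1, a2, a3) = (c \<otimes>\<^bsub>R\<^esub> a1, c \<otimes>\<^bsub>R\<^esub> a2, c \<otimes>\<^bsub>R\<^esub> a3)"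

fun vdot :: "('a, 'm) ring_scheme \<Rightarrow> 'a vec3 \<Rightarrow> 'a vec3 \<Rightarrow> 'a" where
  "vdot R (a1, a2, a3) (b1, b2, b3) =
     (a1 \<otimes>\<^bsub>R\<^esub> b1) \<oplus>\<^bsub>R\<^esub> (a2 \<otimes>\<^bsub>R\<^esub> b2) \<oplus>\<^bsub>R\<^esub> (a3 \<otimes>\<^bsub>R\<^esub> b3)"

fun vcross :: "('a, 'm) ring_scheme \<Rightarrow> 'a vec3 \<Rightarrow> 'a vec3 \<Rightarrow> 'a vec3" where
  "vcross R (a1, a2, a3) (b1, b2, b3) =
     ((a2 \<otimes>\<^bsub>R\<^esub> b3) \<ominus>\<^bsub>R\<^esub> (a3 \<otimes>\<^bsub>R\<^esub> b2),
      (a3 \<otimes>\<^bsub>R\<^esub> b1) \<ominus>\<^bsub>R\<^esub> (a1 \<otimes>\<^bsub>R\<^esub> b3),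
      (a1 \<otimes>\<^bsub>R\<^esub> b2) \<ominus>\<^bsub>R\<^esub> (a2 \<otimes>\<^bsub>R\<^esub> b1))"

text \<open>\<open>Zorn a u v b\<close> is the matrix with first row \<open>a, u\<close> and second row \<open>v, b\<close>.\<close>

datatype 'a zorn = Zorn 'a "'a vec3" "'a vec3" 'a

definition vec3_set :: "'a set \<Rightarrow> 'a vec3 set" where
  "vec3_set A = A \<times> A \<times> A"

definition zorn_set :: "('a, 'm) ring_scheme \<Rightarrow> 'a zorn set" where
  "zorn_set R = {Zorn a u v b | a u v b.
     a \<in> carrier R \<and> u \<in> vec3_set (carrier R) \<and> v \<in> vec3_set (carrier R) \<and> b \<in> carrier R}"

fun zorn_mult :: "('a, 'm) ring_scheme \<Rightarrow> 'a zorn \<Rightarrow> 'a zorn \<Rightarrow> 'a zorn" where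
  "zorn_mult R (Zorn a1 a12 a21 a2) (Zorn b1 b12 b21 b2) =
     Zorn ((a1 \<otimes>\<^bsub>R\<^esub> b1) \<oplus>\<^bsub>R\<^esub> vdot R a12 b21)
          (vsub R (vadd R (vscale R a1 b12) (vscale R b2 a12)) (vcross R a21 b21))
          (vadd R (vadd R (vscale R b1 a21) (vscale R a2 b21)) (vcross R a12 b12))
          ((a2 \<otimes>\<^bsub>R\<^esub> b2) \<oplus>\<^bsub>R\<^esub> vdot R a21 b12)"

fun zorn_norm :: "('a, 'm) ring_scheme \<Rightarrow> 'a zorn \<Rightarrow> 'a" where
  "zorn_norm R (Zorn a1 a12 a21 a2) = (a1 \<otimes>\<^bsub>R\<^esub> a2) \<ominus>\<^bsub>R\<^esub> vdot R a12 a21"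

definition zorn_scalar :: "('a, 'm) ring_scheme \<Rightarrow> 'a \<Rightarrow> 'a zorn" where
  "zorn_scalar R c =
     Zorn c (\<zero>\<^bsub>R\<^esub>, \<zero>\<^bsub>R\<^esub>, \<zero>\<^bsub>R\<^esub>) (\<zero>\<^bsub>R\<^esub>, \<zero>\<^bsub>R\<^esub>, \<zero>\<^bsub>R\<^esub>) c"

definition unit_zorn_loop :: "('a, 'm) ring_scheme \<Rightarrow> 'a zorn monoid" where
  "unit_zorn_loop R =
     \<lparr>carrier = {x \<in> zorn_set R. zorn_norm R x = \<one>\<^bsub>R\<^esub>},
      monoid.mult = zorn_mult R,
      one = zorn_scalar R \<one>\<^bsub>R\<^esub>\<rparr>"

text \<open>\<open>Mod\<close> only uses the operations of the record, so it also describes the quotient loop: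
  the elements are the classes \<open>{x, -x}\<close>, multiplied elementwise.\<close>

definition paige_loop :: "('a, 'm) ring_scheme \<Rightarrow> 'a zorn set monoid" where
  "paige_loop R =
     unit_zorn_loop R Mod {zorn_scalar R \<one>\<^bsub>R\<^esub>, zorn_scalar R (\<ominus>\<^bsub>R\<^esub> \<one>\<^bsub>R\<^esub>)}"


section \<open>Prime fields and Galois extensions\<close>

definition prime_field_chars :: "nat set" where
  "prime_field_chars = {0} \<union> {p. prime p}"

definition prime_field_of_char :: "nat \<Rightarrow> ('a, 'm) ring_scheme \<Rightarrow> bool" where
  "prime_field_of_char c K \<longleftrightarrow> field K \<and>
     (if c = 0 then K \<simeq> (ring_of_type_algebra :: rat ring) else prime c \<and> K \<simeq> residue_ring (int c))"

text \<open>The ambient field \<open>R\<close> is meant to be algebraically closed, so that a minimal polynomial is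
  separable iff all its roots in \<open>R\<close> are simple. The extension may be infinite.\<close>

definition (in ring) galois_extension :: "'a set \<Rightarrow> 'a set \<Rightarrow> bool" where
  "galois_extension K F \<longleftrightarrow>
     subfield K R \<and> subfield F R \<and> K \<subseteq> F \<and>
     (\<forall>x\<in>F. (algebraic over K) x) \<and>
     (\<forall>x\<in>F. \<forall>a\<in>carrier R. alg_mult (Irr K x) a \<le> 1) \<and>
     (\<forall>p\<in>carrier (K[X]). pirreducible K p \<and> (\<exists>x\<in>F. eval p x = \<zero>) \<longrightarrow>
        ring.splitted (R\<lparr>carrier := F\<rparr>) p)"

abbreviation paige_over :: "'a ring \<Rightarrow> 'a set \<Rightarrow> 'a zorn set monoid" where
  "paige_over R F \<equiv> paige_loop (R\<lparr>carrier := F\<rparr>)"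

text \<open>\<open>\<Delta> c\<close> is the prime field of characteristic \<open>c\<close> and \<open>P c\<close> its algebraic closure.\<close>

definition simple_paige_loops ::
    "(nat \<Rightarrow> 'a set) \<Rightarrow> (nat \<Rightarrow> 'a ring) \<Rightarrow> 'a zorn set monoid set" where
  "simple_paige_loops \<Delta> P =
     {L. (\<exists>c F. c \<in> prime_field_chars \<and> ring.galois_extension (P c) (\<Delta> c) F \<and>
                L = paige_over (P c) F) \<and>
         moufang_loop L \<and> nonassociative L \<and> simple_loop L}"

end

theory Submission
  imports Defs
begin

text \<open>The corollary is a statement about inclusions of fields. Once it is known that
\<^item> every Paige loop over a field is a nonassociative simple Moufang loop, and
\<^item> inclusion of Paige loops, compared literally as sets with operations, is the same as
  equality of the characteristics and inclusion of the fields
  (\<open>loop_le_paige_subfields_iff\<close>),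

the ordered set of loops under consideration is the disjoint union, over all prime fields, of the
ordered sets of Galois extensions of a prime field in its closure. A prime field is the least
element of its component and the closure the greatest one (\<open>galois_extension_closure\<close>), which
gives the minimal and the maximal loops. For the finite loops it remains to compare finite
subfields of one field: a subfield with \<open>q\<close> elements consists of the roots of \<open>X^q - X\<close>,
and the orders of the multiplicative groups force divisibility of the degrees.

Simplicity is proved for all fields at once, the fields with two and three elements included, by
computing in the quotient by a normal subloop. If \<open>z\<close> becomes trivial in the quotient and
\<open>z w\<close> has trace zero, then \<open>w w\<close> becomes trivial, because \<open>(z w) (z w) = -1\<close>;
and if \<open>x\<close> has trace zero, then \<open>x z x\<close> becomes trivial up to sign, which makes the
kernel stable under reflections. The first rule applied to two suitable \<open>w\<close> turns any
noncentral element of the kernel into a unipotent one with a single off-diagonal vector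
(\<open>N_lower_root\<close>), the second one moves this unipotent element through all
root directions (\<open>N_lower_2_of_upper_1\<close>), and the root elements generate everything.

The polynomial identities on vector matrices, and the part of the proof of simplicity that only
needs units, are carried out over type-class rings and transported to the rings of the theorem, which are
records with a carrier set. The bridge is the product of all commutative rings on a given type: it is a type-class
ring that maps onto each of them (\<open>component\<close>), and units and elements of norm one can be
lifted along this projection (\<open>put\<close>).

Separability over a prime field is needed to see that its closure is a Galois extension. A multiple
root \<open>a\<close> of a minimal polynomial makes the derivative at \<open>a\<close> vanish for
every polynomial over the base field with root \<open>a\<close>. In characteristic zero this is contradicted
by the minimal polynomial itself, and over a finite field by \<open>X^q - X\<close>.

Finally, Paige loops over algebraically closed fields of different characteristics are not
isomorphic, since they are told apart by the primes \<open>p\<close> for which some element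
of order \<open>p\<close> has no \<open>p\<close>-th root: exactly the characteristic has this property.\<close>

section \<open>Vector matrices over a type-class ring\<close>

fun zmul :: "'b::comm_ring_1 zorn \<Rightarrow> 'b zorn \<Rightarrow> 'b zorn" where
  "zmul (Zorn a (u1,u2,u3) (v1,v2,v3) b) (Zorn a' (u1',u2',u3') (v1',v2',v3') b') =
     Zorn (a*a' + (u1*v1' + u2*v2' + u3*v3'))
       (a*u1' + b'*u1 - (v2*v3' - v3*v2'),
        a*u2' + b'*u2 - (v3*v1' - v1*v3'),
        a*u3' + b'*u3 - (v1*v2' - v2*v1'))
       (a'*v1 + b*v1' + (u2*u3' - u3*u2'),
        a'*v2 + b*v2' + (u3*u1' - u1*u3'),
        a'*v3 + b*v3' + (u1*u2' - u2*u1'))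
       (b*b' + (v1*u1' + v2*u2' + v3*u3'))"

fun znorm :: "'b::comm_ring_1 zorn \<Rightarrow> 'b" where
  "znorm (Zorn a (u1,u2,u3) (v1,v2,v3) b) = a*b - (u1*v1 + u2*v2 + u3*v3)"

fun zconj :: "'b::comm_ring_1 zorn \<Rightarrow> 'b zorn" where
  "zconj (Zorn a (u1,u2,u3) (v1,v2,v3) b) = Zorn b (-u1,-u2,-u3) (-v1,-v2,-v3) a"

definition zsc :: "'b::comm_ring_1 \<Rightarrow> 'b zorn" where
  "zsc c = Zorn c (0,0,0) (0,0,0) c"

lemma zorn_coordinates:
  obtains a u1 u2 u3 v1 v2 v3 b where "z = Zorn a (u1,u2,u3) (v1,v2,v3) b"
  by (metis prod.exhaust zorn.exhaust)

lemma znorm_zmul: "znorm (zmul x y) = znorm x * znorm y"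
  by (cases x rule: zorn_coordinates, cases y rule: zorn_coordinates)
     (simp, simp add: algebra_simps)

text \<open>The two inverse properties, which give unique division in the loop of elements of norm one.\<close>

lemma zmul_zconj_left: "zmul (zconj x) (zmul x y) = zmul (zsc (znorm x)) y"
  by (cases x rule: zorn_coordinates, cases y rule: zorn_coordinates)
     (simp add: zsc_def algebra_simps)

lemma zmul_zconj_right: "zmul (zmul y x) (zconj x) = zmul (zsc (znorm x)) y"
  by (cases x rule: zorn_coordinates, cases y rule: zorn_coordinates)
     (simp add: zsc_def algebra_simps)

lemma zmul_moufang: "zmul x (zmul y (zmul x z)) = zmul (zmul (zmul x y) x) z"
  by (cases x rule: zorn_coordinates, cases y rule: zorn_coordinates, cases z rule: zorn_coordinates)
     (simp add: algebra_simps)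

fun ztr :: "'b::comm_ring_1 zorn \<Rightarrow> 'b" where
  "ztr (Zorn a u v b) = a + b"

lemma zmul_one [simp]: "zmul (zsc 1) x = x" "zmul x (zsc 1) = x"
  by (cases x rule: zorn_coordinates; simp add: zsc_def)+

lemma znorm_zconj [simp]: "znorm (zconj x) = znorm x"
  by (cases x rule: zorn_coordinates) (simp add: algebra_simps)

lemma zconj_zconj [simp]: "zconj (zconj x) = x"
  by (cases x rule: zorn_coordinates) simp

lemma znorm_zsc [simp]: "znorm (zsc c) = c * c"
  by (simp add: zsc_def)

lemma zmul_minus_one: "zmul (zsc (-1)) (zmul x y) = zmul (zmul (zsc (-1)) x) y"
  "zmul x (zmul (zsc (-1)) y) = zmul (zsc (-1)) (zmul x y)"
  by (cases x rule: zorn_coordinates, cases y rule: zorn_coordinates; simp add: zsc_def algebra_simps)+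

lemma zmul_zconj_self: "znorm x = 1 \<Longrightarrow> zmul (zconj x) x = zsc 1" "znorm x = 1 \<Longrightarrow> zmul x (zconj x) = zsc 1"
  using zmul_zconj_left[of x "zsc 1"] zmul_zconj_left[of "zconj x" "zsc 1"] by auto

text \<open>By the quadratic equation of a composition algebra, \<open>x x = tr(x) x - n(x)\<close>: modulo \<open>-1\<close>,
the elements of trace zero and norm one are involutions. The whole proof of simplicity rests on this.\<close>

lemma zmul_square_traceless:
  assumes "ztr x = 0" "znorm x = 1"
  shows "zmul x x = zsc (-1)"
proof -
  obtain a u1 u2 u3 v1 v2 v3 b where x: "x = Zorn a (u1,u2,u3) (v1,v2,v3) b"
    by (rule zorn_coordinates)
  have b: "b = - a" using assms(1) unfolding x by (simp add: eq_neg_iff_add_eq_0 add.commute)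
  have "- (a*a) - (u1*v1 + u2*v2 + u3*v3) = 1" using assms(2) unfolding x b by simp
  then have "a*a + (u1*v1 + u2*v2 + u3*v3) = -1"
    by (metis add.inverse_inverse minus_add_distrib uminus_add_conv_diff add.commute)
  then show ?thesis unfolding x b by (simp add: zsc_def algebra_simps)
qed

text \<open>For \<open>z\<close> with conjugate \<open>z'\<close> and \<open>x\<close> of norm one, \<open>- x z' x\<close> is the image of
\<open>z\<close> under the reflection in \<open>x\<close>. Here the norm \<open>n\<close> of \<open>x\<close>
is kept as a parameter, so that both sides are polynomials, and \<open>k\<close> is the
negative of the polar form of the norm at \<open>z\<close> and \<open>x\<close>.\<close>

lemma zmul_off_diagonal_sandwich:
  assumes k: "k = u1*q1 + u2*q2 + u3*q3 + (v1*p1 + v2*p2 + v3*p3)"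
    and n: "n = -(p1*q1+p2*q2+p3*q3)"
  shows "zmul (Zorn 0 (p1,p2,p3) (q1,q2,q3) 0)
      (zmul (Zorn b (-u1,-u2,-u3) (-v1,-v2,-v3) a) (Zorn 0 (p1,p2,p3) (q1,q2,q3) 0)) =
    Zorn (-n * a) (-n * u1 - k*p1, -n * u2 - k*p2, -n * u3 - k*p3)
      (-n * v1 - k*q1, -n * v2 - k*q2, -n * v3 - k*q3) (-n * b)"
  unfolding k n
  by (simp, simp add: algebra_simps)

section \<open>Congruences on the loop of elements of norm one\<close>

text \<open>The relation "same coset of a normal subloop" on the elements of norm one, for a
normal subloop that contains \<open>-1\<close>.\<close>

locale zorn_congruence =
  fixes E :: "'b::comm_ring_1 zorn \<Rightarrow> 'b zorn \<Rightarrow> bool"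
  assumes refl: "znorm x = 1 \<Longrightarrow> E x x"
    and sym: "E x y \<Longrightarrow> E y x"
    and trans: "E x y \<Longrightarrow> E y z \<Longrightarrow> E x z"
    and mult: "\<lbrakk>znorm x = 1; znorm x' = 1; znorm y = 1; znorm y' = 1; E x x'; E y y'\<rbrakk>
      \<Longrightarrow> E (zmul x y) (zmul x' y')"
    and minus_one: "E (zsc (-1)) (zsc 1)"
begin

definition N :: "'b zorn \<Rightarrow> bool" where
  "N z \<longleftrightarrow> znorm z = 1 \<and> E z (zsc 1)"

lemma N_mult: "N x \<Longrightarrow> N y \<Longrightarrow> N (zmul x y)"
  using mult[of x "zsc 1" y "zsc 1"] by (simp add: N_def znorm_zmul)

lemma N_conj: assumes "N x" shows "N (zconj x)"
proof -
  have "E (zmul (zconj x) x) (zmul (zconj x) (zsc 1))"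
    using assms by (intro mult refl) (auto simp: N_def)
  from sym[OF this] show ?thesis using assms by (simp add: N_def zmul_zconj_self)
qed

lemma N_minus_one: "N (zsc (-1))" using minus_one by (simp add: N_def)

lemma N_mult_cancel: assumes "N (zmul x y)" "N x" "znorm y = 1" shows "N y"
  using N_mult[OF N_conj[OF assms(2)] assms(1)] assms(2) by (simp add: zmul_zconj_left N_def)

lemma N_conjugate:
  assumes "N z" "znorm x = 1" shows "N (zmul (zmul x z) (zconj x))"
proof -
  have "E (zmul (zmul x z) (zconj x)) (zmul (zmul x (zsc 1)) (zconj x))"
    using assms by (intro mult refl) (auto simp: N_def znorm_zmul)
  then show ?thesis using assms by (simp add: N_def znorm_zmul zmul_zconj_self)
qed

text \<open>Modulo the congruence, \<open>z\<close> can be cancelled from \<open>x z' x\<close>, and \<open>x x = -1\<close>.\<close>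

lemma N_reflect:
  assumes "N z" "znorm x = 1" "ztr x = 0" shows "N (zmul (zsc (-1)) (zmul x (zmul (zconj z) x)))"
proof -
  have z: "E (zconj z) (zsc 1)" "znorm z = 1" using N_conj[OF assms(1)] by (auto simp: N_def)
  have "E (zmul x (zmul (zconj z) x)) (zmul x (zmul (zsc 1) x))"
    using assms z by (intro mult refl) (auto simp: znorm_zmul)
  then have "E (zmul x (zmul (zconj z) x)) (zsc (-1))"
    unfolding zmul_one zmul_square_traceless[OF assms(3,2)] .
  then have "E (zmul x (zmul (zconj z) x)) (zsc 1)"
    using minus_one by (rule trans)
  then show ?thesis using z assms by (intro N_mult[OF N_minus_one]) (auto simp: N_def znorm_zmul)
qed

text \<open>Modulo the congruence \<open>w\<close> equals \<open>z w\<close>, whose square is \<open>-1\<close>.\<close>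

lemma N_square:
  assumes "N z" "znorm w = 1" "ztr (zmul z w) = 0" shows "N (zmul w w)"
proof -
  have z: "E z (zsc 1)" "znorm z = 1" using assms(1) by (auto simp: N_def)
  have 1: "E (zmul z w) (zmul (zsc 1) w)"
    using assms z by (intro mult refl) auto
  have "E (zmul (zmul z w) (zmul z w)) (zmul w w)"
    using 1 assms z by (intro mult) (auto simp: znorm_zmul)
  then have "E (zsc (-1)) (zmul w w)"
    using zmul_square_traceless[of "zmul z w"] assms z by (simp add: znorm_zmul)
  from trans[OF sym[OF this] minus_one] show ?thesis using assms(2) by (simp add: N_def znorm_zmul)
qed

lemma N_reflect_off_diagonal:
  assumes z: "N (Zorn a (u1,u2,u3) (v1,v2,v3) b)"
    and pq: "p1*q1 + p2*q2 + p3*q3 = -1"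
    and k: "k = u1*q1 + u2*q2 + u3*q3 + (v1*p1 + v2*p2 + v3*p3)"
  shows "N (Zorn a (u1 + k*p1, u2 + k*p2, u3 + k*p3) (v1 + k*q1, v2 + k*q2, v3 + k*q3) b)"
proof -
  have n: "1 = -(p1*q1 + p2*q2 + p3*q3)" by (simp only: pq minus_minus)
  let ?x = "Zorn 0 (p1,p2,p3) (q1,q2,q3) 0"
  let ?y = "Zorn a (u1,u2,u3) (v1,v2,v3) b"
  have "N (zmul (zsc (-1)) (zmul ?x (zmul (zconj ?y) ?x)))"
    by (rule N_reflect[OF z]) (simp_all add: pq)
  also have "zmul ?x (zmul (zconj ?y) ?x) =
    Zorn (-a) (-u1 - k*p1, -u2 - k*p2, -u3 - k*p3) (-v1 - k*q1, -v2 - k*q2, -v3 - k*q3) (-b)"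
    using zmul_off_diagonal_sandwich[OF k n, of b a] by (simp only: zconj.simps mult_minus1)
  finally show ?thesis by (simp add: zsc_def add.commute)
qed

text \<open>In every characteristic, an element with a unit \<open>v1\<close> in its lower left vector leads to a
unipotent element. Elements \<open>w\<close> of norm and trace one have \<open>w w = w - 1\<close>. Two of them
with the same lower left vector \<open>q\<close> and with upper right vectors \<open>p\<close> and \<open>p + d\<close>
give squares whose quotient is lower unitriangular with the vector \<open>- p \<times> d\<close>. The conditions
for \<open>N_square\<close> are linear; \<open>q\<close> is the second basis vector and \<open>d\<close>
is orthogonal to \<open>q\<close> and \<open>v\<close>.\<close>

lemma N_lower_root:
  assumes z: "N (Zorn a (u1,u2,u3) (v1,v2,v3) b)" and i: "v1 * i = 1"
  shows "N (Zorn 1 (0,0,0) (v1, v2 - u2 - a, v3) 1)"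
proof -
  \<comment> \<open>the solution of the linear condition that the trace of \<open>z w\<close> vanishes\<close>
  define p1 where "p1 = (v2 - u2 - a) * i"
  have p1: "v1 * p1 = v2 - u2 - a"
    unfolding p1_def by (simp only: mult.left_commute[of v1] i mult_1_right)
  let ?w = "Zorn 1 (p1,-1,0) (0,1,0) (0::'b)"
  let ?w' = "Zorn 1 (p1 - v3,-1,v1) (0,1,0) (0::'b)"
  have "N (zmul ?w ?w)"
    by (rule N_square[OF z]) (simp_all add: p1)
  moreover have "N (zmul ?w' ?w')"
  proof (rule N_square[OF z])
    have "ztr (zmul (Zorn a (u1,u2,u3) (v1,v2,v3) b) ?w') = a + u2 + (v1 * p1 - v2)"
      by (simp add: algebra_simps)
    then show "ztr (zmul (Zorn a (u1,u2,u3) (v1,v2,v3) b) ?w') = 0"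
      unfolding p1 by simp
  qed simp
  ultimately have "N (zmul (zmul ?w ?w) (zconj (zmul ?w' ?w')))"
    by (rule N_mult[OF _ N_conj])
  also have "zmul (zmul ?w ?w) (zconj (zmul ?w' ?w')) = Zorn 1 (0,0,0) (v1, v1 * p1, v3) 1"
    by (simp add: algebra_simps)
  finally show ?thesis unfolding p1 .
qed

text \<open>In this lemma and the next two, the vectors of the reflection are chosen such that one of the two
off-diagonal vectors of the image vanishes.\<close>

lemma N_upper_root_1:
  assumes "N (Zorn 1 (0,0,0) (v1,v2,v3) 1)" and "v1 * i = 1"
  shows "N (Zorn 1 (i,0,0) (0,0,0) 1)"
  using N_reflect_off_diagonal[OF assms(1), of i "-v1" 0 "-v2" 0 "-v3" 1] assms(2)
  by (simp add: mult.commute)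

lemma N_lower_of_upper_1:
  assumes "N (Zorn 1 (r,0,0) (0,0,0) 1)"
  shows "N (Zorn 1 (0,0,0) (r, r*m, r*l) 1)"
  using N_reflect_off_diagonal[OF assms, of "-1" 1 0 m 0 l r] by simp

lemma N_upper_of_lower_1:
  assumes "N (Zorn 1 (0,0,0) (r,0,0) 1)"
  shows "N (Zorn 1 (r, r*m, r*l) (0,0,0) 1)"
  using N_reflect_off_diagonal[OF assms, of 1 "-1" m 0 l 0 r] by simp

text \<open>This is the step from one root direction to another: the product of two upper unitriangular elements has a cross product in its lower left
corner, and a reflection then removes the upper right vector.\<close>

lemma N_lower_2_of_upper_1:
  assumes r: "N (Zorn 1 (r,0,0) (0,0,0) 1)" and s: "r * s = 1"
  shows "N (Zorn 1 (0,0,0) (0,m,0) 1)"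
proof -
  have 1: "N (Zorn 1 (-r,0,0) (0,0,0) 1)"
    using N_conj[OF r] by simp
  have "N (Zorn 1 (0,0,0) (r,0,0) 1)"
    using N_lower_of_upper_1[OF r, of 0 0] by simp
  from N_upper_of_lower_1[OF this, of "s * m" 0] have "N (Zorn 1 (r,m,0) (0,0,0) 1)"
    using s by (simp flip: mult.assoc)
  from N_mult[OF 1 this] have "N (Zorn 1 (0,m,0) (0,0,-(r*m)) 1)"
    by simp
  from N_reflect_off_diagonal[OF this, of 0 0 "-1" 1 0 r m] show ?thesis
    by (simp add: mult.commute)
qed

end

text \<open>Two automorphisms of the algebra, which reduce statements on the six root directions to one of them.\<close>

fun zrot :: "'b::comm_ring_1 zorn \<Rightarrow> 'b zorn" where
  "zrot (Zorn a (u1,u2,u3) (v1,v2,v3) b) = Zorn a (u2,u3,u1) (v2,v3,v1) b"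

fun zswap :: "'b::comm_ring_1 zorn \<Rightarrow> 'b zorn" where
  "zswap (Zorn a (u1,u2,u3) (v1,v2,v3) b) = Zorn b (-v1,-v2,-v3) (-u1,-u2,-u3) a"

definition zorn_automorphism :: "('b::comm_ring_1 zorn \<Rightarrow> 'b zorn) \<Rightarrow> bool" where
  "zorn_automorphism f \<longleftrightarrow> (\<forall>x y. f (zmul x y) = zmul (f x) (f y)) \<and>
     (\<forall>x. znorm (f x) = znorm x) \<and> f (zsc 1) = zsc 1 \<and> f (zsc (-1)) = zsc (-1)"

lemma zorn_automorphism_zrot: "zorn_automorphism zrot"
  unfolding zorn_automorphism_def
proof (intro conjI allI)
  fix x y :: "'b::comm_ring_1 zorn"
  show "zrot (zmul x y) = zmul (zrot x) (zrot y)"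
    by (cases x rule: zorn_coordinates, cases y rule: zorn_coordinates) (simp add: algebra_simps)
  show "znorm (zrot x) = znorm x"
    by (cases x rule: zorn_coordinates) (simp add: algebra_simps)
qed (auto simp: zsc_def)

lemma zorn_automorphism_zswap: "zorn_automorphism zswap"
  unfolding zorn_automorphism_def
proof (intro conjI allI)
  fix x y :: "'b::comm_ring_1 zorn"
  show "zswap (zmul x y) = zmul (zswap x) (zswap y)"
    by (cases x rule: zorn_coordinates, cases y rule: zorn_coordinates) (simp add: algebra_simps)
  show "znorm (zswap x) = znorm x"
    by (cases x rule: zorn_coordinates) (simp add: algebra_simps)
qed (auto simp: zsc_def)

context zorn_congruence
begin

lemma pullback:
  assumes "zorn_automorphism f"
  shows "zorn_congruence (\<lambda>x y. E (f x) (f y))"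
    and "zorn_congruence.N (\<lambda>x y. E (f x) (f y)) z \<longleftrightarrow> N (f z)"
proof -
  show *: "zorn_congruence (\<lambda>x y. E (f x) (f y))"
    using assms unfolding zorn_automorphism_def
    by unfold_locales (auto intro: refl sym trans mult minus_one)
  show "zorn_congruence.N (\<lambda>x y. E (f x) (f y)) z \<longleftrightarrow> N (f z)"
    using assms unfolding zorn_congruence.N_def[OF *] N_def zorn_automorphism_def by auto
qed

lemma zrot: "zorn_congruence (\<lambda>x y. E (zrot x) (zrot y))"
  and zswap: "zorn_congruence (\<lambda>x y. E (zswap x) (zswap y))"
  using pullback zorn_automorphism_zrot zorn_automorphism_zswap by blast+

lemma N_zrot: "zorn_congruence.N (\<lambda>x y. E (zrot x) (zrot y)) z \<longleftrightarrow> N (zrot z)"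
  and N_zswap: "zorn_congruence.N (\<lambda>x y. E (zswap x) (zswap y)) z \<longleftrightarrow> N (zswap z)"
  using pullback zorn_automorphism_zrot zorn_automorphism_zswap by blast+

text \<open>The six root directions form one cycle: upper 1, lower 2, upper 3, lower 1, upper 2, lower 3.\<close>

lemmas N_lower_1_of_upper_3 =
  zorn_congruence.N_lower_2_of_upper_1[OF zrot, unfolded N_zrot zrot.simps]
lemmas N_lower_3_of_upper_2 =
  zorn_congruence.N_lower_2_of_upper_1[OF zorn_congruence.zrot[OF zrot],
    unfolded zorn_congruence.N_zrot[OF zrot] N_zrot zrot.simps]

lemma N_upper_of_lower:
  assumes s: "r * s = 1"
  shows "N (Zorn 1 (0,0,0) (r,0,0) 1) \<Longrightarrow> N (Zorn 1 (0,m,0) (0,0,0) 1)"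
    and "N (Zorn 1 (0,0,0) (0,r,0) 1) \<Longrightarrow> N (Zorn 1 (0,0,m) (0,0,0) 1)"
    and "N (Zorn 1 (0,0,0) (0,0,r) 1) \<Longrightarrow> N (Zorn 1 (m,0,0) (0,0,0) 1)"
proof -
  interpret swap: zorn_congruence "\<lambda>x y. E (zswap x) (zswap y)" by (rule zswap)
  have s': "(-r) * (-s) = 1" using s by simp
  show "N (Zorn 1 (0,m,0) (0,0,0) 1)" if "N (Zorn 1 (0,0,0) (r,0,0) 1)"
    using swap.N_lower_2_of_upper_1[OF _ s', of "-m"] that by (simp add: N_zswap)
  show "N (Zorn 1 (0,0,m) (0,0,0) 1)" if "N (Zorn 1 (0,0,0) (0,r,0) 1)"
    using swap.N_lower_3_of_upper_2[OF _ s', of "-m"] that by (simp add: N_zswap)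
  show "N (Zorn 1 (m,0,0) (0,0,0) 1)" if "N (Zorn 1 (0,0,0) (0,0,r) 1)"
    using swap.N_lower_1_of_upper_3[OF _ s', of "-m"] that by (simp add: N_zswap)
qed

definition all_roots :: bool where
  "all_roots \<longleftrightarrow> (\<forall>m. N (Zorn 1 (m,0,0) (0,0,0) 1) \<and> N (Zorn 1 (0,m,0) (0,0,0) 1) \<and>
     N (Zorn 1 (0,0,m) (0,0,0) 1) \<and> N (Zorn 1 (0,0,0) (m,0,0) 1) \<and>
     N (Zorn 1 (0,0,0) (0,m,0) 1) \<and> N (Zorn 1 (0,0,0) (0,0,m) 1))"

lemma all_roots_of_lower_root:
  assumes v: "N (Zorn 1 (0,0,0) (v1,v2,v3) 1)" and i: "v1 * i = 1"
  shows all_roots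
proof -
  have one: "(1::'b) * 1 = 1" by simp
  have "i * v1 = 1" using i by (simp add: mult.commute)
  have Y2: "N (Zorn 1 (0,0,0) (0,m,0) 1)" for m
    by (rule N_lower_2_of_upper_1[OF N_upper_root_1[OF v i] \<open>i * v1 = 1\<close>])
  have X3: "N (Zorn 1 (0,0,m) (0,0,0) 1)" for m
    by (rule N_upper_of_lower(2)[OF one Y2])
  have Y1: "N (Zorn 1 (0,0,0) (m,0,0) 1)" for m
    by (rule N_lower_1_of_upper_3[OF X3 one])
  have X2: "N (Zorn 1 (0,m,0) (0,0,0) 1)" for m
    by (rule N_upper_of_lower(1)[OF one Y1])
  have Y3: "N (Zorn 1 (0,0,0) (0,0,m) 1)" for m
    by (rule N_lower_3_of_upper_2[OF X2 one])
  have X1: "N (Zorn 1 (m,0,0) (0,0,0) 1)" for m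
    by (rule N_upper_of_lower(3)[OF one Y3])
  show ?thesis unfolding all_roots_def using X1 X2 X3 Y1 Y2 Y3 by blast
qed

lemma all_roots_zrot: "zorn_congruence.all_roots (\<lambda>x y. E (zrot x) (zrot y)) \<Longrightarrow> all_roots"
  unfolding zorn_congruence.all_roots_def[OF zrot] N_zrot all_roots_def by simp

lemma all_roots_zswap:
  assumes "zorn_congruence.all_roots (\<lambda>x y. E (zswap x) (zswap y))" shows all_roots
proof -
  have "N (zswap (Zorn 1 (m,0,0) (0,0,0) 1)) \<and> N (zswap (Zorn 1 (0,m,0) (0,0,0) 1)) \<and>
     N (zswap (Zorn 1 (0,0,m) (0,0,0) 1)) \<and> N (zswap (Zorn 1 (0,0,0) (m,0,0) 1)) \<and>
     N (zswap (Zorn 1 (0,0,0) (0,m,0) 1)) \<and> N (zswap (Zorn 1 (0,0,0) (0,0,m) 1))" for m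
    using assms unfolding zorn_congruence.all_roots_def[OF zswap] N_zswap by blast
  from this[of "- m" for m] show ?thesis unfolding all_roots_def by simp
qed

lemma all_roots_of_lower_1:
  assumes "N (Zorn a (u1,u2,u3) (v1,v2,v3) b)" and "v1 * i = 1"
  shows all_roots
  using all_roots_of_lower_root[OF N_lower_root[OF assms] assms(2)] .

lemma all_roots_of_lower:
  assumes z: "N (Zorn a (u1,u2,u3) (v1,v2,v3) b)" and i: "v1 * i = 1 \<or> v2 * i = 1 \<or> v3 * i = 1"
  shows all_roots
proof -
  interpret r: zorn_congruence "\<lambda>x y. E (zrot x) (zrot y)" by (rule zrot)
  interpret rr: zorn_congruence "\<lambda>x y. E (zrot (zrot x)) (zrot (zrot y))" by (rule r.zrot)
  have "r.N (Zorn a (u3,u1,u2) (v3,v1,v2) b)" using z unfolding N_zrot by simp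
  moreover have "rr.N (Zorn a (u2,u3,u1) (v2,v3,v1) b)" using z unfolding N_zrot r.N_zrot by simp
  ultimately show ?thesis
    using i all_roots_of_lower_1[OF z] r.all_roots_of_lower_1 rr.all_roots_of_lower_1
      all_roots_zrot r.all_roots_zrot by blast
qed

lemma all_roots_of_upper:
  assumes z: "N (Zorn a (u1,u2,u3) (v1,v2,v3) b)" and i: "u1 * i = 1 \<or> u2 * i = 1 \<or> u3 * i = 1"
  shows all_roots
proof -
  interpret s: zorn_congruence "\<lambda>x y. E (zswap x) (zswap y)" by (rule zswap)
  have "s.N (Zorn b (-v1,-v2,-v3) (-u1,-u2,-u3) a)" using z unfolding N_zswap by simp
  from s.all_roots_of_lower[OF this, of "-i"] i show ?thesis by (auto intro: all_roots_zswap)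
qed

text \<open>Conjugation with an upper root element produces the off-diagonal entry
\<open>u1 + b - a - v1\<close>. For a diagonal matrix this is \<open>b - a\<close>.\<close>

lemma all_roots_of_diagonal:
  assumes z: "N (Zorn a (u1,u2,u3) (v1,v2,v3) b)" and i: "(u1 + b - a - v1) * i = 1"
  shows all_roots
proof -
  let ?x = "Zorn 1 (1,0,0) (0,0,0) (1::'b)"
  have "N (zmul (zmul ?x (Zorn a (u1,u2,u3) (v1,v2,v3) b)) (zconj ?x))"
    by (rule N_conjugate[OF z]) simp
  then show ?thesis using i by (auto intro: all_roots_of_upper[of _ _ _ _ _ _ _ _ i] simp: algebra_simps)
qed

lemma all_roots_imp_zswap: "all_roots \<Longrightarrow> zorn_congruence.all_roots (\<lambda>x y. E (zswap x) (zswap y))"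
  unfolding all_roots_def zorn_congruence.all_roots_def[OF zswap] N_zswap zswap.simps by simp

lemma N_upper_plane:
  assumes all_roots
  shows "N (Zorn 1 (a,b,0) (0,0,0) 1)"
proof -
  note roots = assms[unfolded all_roots_def, rule_format]
  have "N (zmul (Zorn 1 (0,0,0) (0,0,-(a*b)) 1) (zmul (Zorn 1 (a,0,0) (0,0,0) 1) (Zorn 1 (0,b,0) (0,0,0) 1)))"
    using roots by (intro N_mult) blast+
  then show ?thesis by simp
qed

text \<open>The factor \<open>(-b c, a c, 0)\<close> cancels the cross product of \<open>(a,b,0)\<close> and \<open>(0,0,c)\<close>.\<close>

lemma N_upper:
  assumes all_roots
  shows "N (Zorn 1 (a,b,c) (0,0,0) 1)"
proof -
  interpret s: zorn_congruence "\<lambda>x y. E (zswap x) (zswap y)" by (rule zswap)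
  have Y: "N (Zorn 1 (0,0,0) (-(b*c),a*c,0) 1)"
    using s.N_upper_plane[OF all_roots_imp_zswap[OF assms], of "b*c" "-(a*c)"] unfolding N_zswap by simp
  have X3: "N (Zorn 1 (0,0,c) (0,0,0) 1)"
    using assms unfolding all_roots_def by blast
  from N_mult[OF Y N_mult[OF N_upper_plane[OF assms] X3]]
  have "N (zmul (Zorn 1 (0,0,0) (-(b*c),a*c,0) 1) (zmul (Zorn 1 (a,b,0) (0,0,0) 1) (Zorn 1 (0,0,c) (0,0,0) 1)))" .
  then show ?thesis by (simp add: mult.left_commute)
qed

lemma N_lower:
  assumes all_roots
  shows "N (Zorn 1 (0,0,0) (a,b,c) 1)"
proof -
  interpret s: zorn_congruence "\<lambda>x y. E (zswap x) (zswap y)" by (rule zswap)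
  from s.N_upper[OF all_roots_imp_zswap[OF assms], of "-a" "-b" "-c"] show ?thesis
    unfolding N_zswap by simp
qed

text \<open>A decomposition into unitriangular factors: an upper root element moves the diagonal
entry \<open>a\<close> to \<open>1\<close>, and a matrix of norm one with diagonal entry \<open>1\<close> is the product of its
lower and its upper unitriangular part.\<close>

lemma N_of_lower_unit:
  assumes r: all_roots and n: "znorm (Zorn a (u1,u2,u3) (v1,v2,v3) b) = 1" and i: "v1 * i = 1"
  shows "N (Zorn a (u1,u2,u3) (v1,v2,v3) b)"
proof (rule N_mult_cancel[OF _ N_upper[OF r, of "(1-a)*i" 0 0] n])
  let ?x = "Zorn 1 ((1-a)*i,0,0) (0,0,0) (1::'b)"
  have p: "(1 - a) * i * v1 = 1 - a" using i by (simp add: mult.assoc mult.commute[of i])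
  then have "zmul ?x (Zorn a (u1,u2,u3) (v1,v2,v3) b) = 
    Zorn 1 (u1 + b*((1-a)*i), u2, u3) (v1, v2 - (1-a)*i*u3, v3 + (1-a)*i*u2) b"
    by (simp add: algebra_simps)
  then obtain w1 w2 w3 x1 x2 x3 where w: "zmul ?x (Zorn a (u1,u2,u3) (v1,v2,v3) b) = 
    Zorn 1 (w1,w2,w3) (x1,x2,x3) b" by blast
  have "znorm (zmul ?x (Zorn a (u1,u2,u3) (v1,v2,v3) b)) = 1"
    unfolding znorm_zmul n by simp
  then have n': "b - (w1*x1 + w2*x2 + w3*x3) = 1"
    unfolding w by simp
  then have b: "b = 1 + (w1*x1 + w2*x2 + w3*x3)" by (simp add: diff_eq_eq)
  have "N (zmul (Zorn 1 (0,0,0) (x1,x2,x3) 1) (Zorn 1 (w1,w2,w3) (0,0,0) 1))"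
    by (intro N_mult N_upper N_lower r)
  also have "zmul (Zorn 1 (0,0,0) (x1,x2,x3) 1) (Zorn 1 (w1,w2,w3) (0,0,0) 1) =
    Zorn 1 (w1,w2,w3) (x1,x2,x3) b"
    unfolding b by (simp add: algebra_simps)
  finally show "N (zmul ?x (Zorn a (u1,u2,u3) (v1,v2,v3) b))" unfolding w .
qed

lemma N_of_diagonal_unit:
  assumes r: all_roots and n: "znorm (Zorn a (u1,u2,u3) (v1,v2,v3) b) = 1" and i: "a * i = 1"
  shows "N (Zorn a (u1,u2,u3) (v1,v2,v3) b)"
proof (rule N_mult_cancel[OF _ N_lower[OF r, of "(1-v1)*i" 0 0] n])
  let ?x = "Zorn 1 (0,0,0) ((1-v1)*i,0,0) (1::'b)"
  have p: "(1 - v1) * i * a = 1 - v1" using i by (simp add: mult.assoc mult.commute[of i])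
  then have "zmul ?x (Zorn a (u1,u2,u3) (v1,v2,v3) b) = 
    Zorn a (u1, u2 + (1 - v1) * i * v3, u3 - (1-v1)*i*v2) (1, v2, v3) (b + (1-v1)*i*u1)"
    by (simp add: algebra_simps)
  moreover have "znorm (zmul ?x (Zorn a (u1,u2,u3) (v1,v2,v3) b)) = 1"
    unfolding znorm_zmul n by simp
  ultimately show "N (zmul ?x (Zorn a (u1,u2,u3) (v1,v2,v3) b))"
    using N_of_lower_unit[OF r, of _ _ _ _ 1 _ _ _ 1] by simp
qed

lemma N_of_lower_units:
  assumes r: all_roots and n: "znorm (Zorn a (u1,u2,u3) (v1,v2,v3) b) = 1"
    and i: "v1 * i = 1 \<or> v2 * i = 1 \<or> v3 * i = 1"
  shows "N (Zorn a (u1,u2,u3) (v1,v2,v3) b)"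
proof -
  interpret s: zorn_congruence "\<lambda>x y. E (zrot x) (zrot y)" by (rule zrot)
  interpret ss: zorn_congruence "\<lambda>x y. E (zrot (zrot x)) (zrot (zrot y))" by (rule s.zrot)
  have r': "s.all_roots" "ss.all_roots"
    using r unfolding all_roots_def s.all_roots_def ss.all_roots_def s.N_zrot N_zrot zrot.simps by simp_all
  have "znorm (Zorn a (u3,u1,u2) (v3,v1,v2) b) = 1" "znorm (Zorn a (u2,u3,u1) (v2,v3,v1) b) = 1"
    using n by (simp_all add: algebra_simps)
  then show ?thesis
    using i s.N_of_lower_unit[OF r'(1), of a u3 u1 u2 v3 v1 v2 b i]
      ss.N_of_lower_unit[OF r'(2), of a u2 u3 u1 v2 v3 v1 b i] N_of_lower_unit[OF r n, of i]
    unfolding s.N_zrot N_zrot zrot.simps by blast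
qed
end

section \<open>Lifting commutative rings to a type-class ring\<close>

text \<open>The product of all commutative rings with elements in \<open>'a\<close>. The additional factor of
integers ensures \<open>0 \<noteq> 1\<close> also for a type with one element.\<close>

typedef 'a all_crings =
  "{(k::int, f::'a ring \<Rightarrow> 'a). (\<forall>R. cring R \<longrightarrow> f R \<in> carrier R) \<and> (\<forall>R. \<not> cring R \<longrightarrow> f R = undefined)}"
  morphisms components of_components
  by (rule exI[of _ "(0, \<lambda>R. if cring R then \<zero>\<^bsub>R\<^esub> else undefined)"])
     (auto simp: cring.cring_simprules)

setup_lifting type_definition_all_crings

instantiation all_crings :: (type) comm_ring_1
begin

lift_definition zero_all_crings :: "'a all_crings" is
  "(0, \<lambda>R. if cring R then \<zero>\<^bsub>R\<^esub> else undefined)"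
  by (auto simp: cring.cring_simprules)

lift_definition one_all_crings :: "'a all_crings" is
  "(1, \<lambda>R. if cring R then \<one>\<^bsub>R\<^esub> else undefined)"
  by (auto simp: cring.cring_simprules)

lift_definition plus_all_crings :: "'a all_crings \<Rightarrow> 'a all_crings \<Rightarrow> 'a all_crings" is
  "\<lambda>(k, f) (l, g). (k + l, \<lambda>R. if cring R then f R \<oplus>\<^bsub>R\<^esub> g R else undefined)"
  by (auto simp: cring.cring_simprules split: if_splits)

lift_definition times_all_crings :: "'a all_crings \<Rightarrow> 'a all_crings \<Rightarrow> 'a all_crings" is
  "\<lambda>(k, f) (l, g). (k * l, \<lambda>R. if cring R then f R \<otimes>\<^bsub>R\<^esub> g R else undefined)"
  by (auto simp: cring.cring_simprules split: if_splits)

lift_definition uminus_all_crings :: "'a all_crings \<Rightarrow> 'a all_crings" is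
  "\<lambda>(k, f). (- k, \<lambda>R. if cring R then \<ominus>\<^bsub>R\<^esub> f R else undefined)"
  by (auto simp: cring.cring_simprules split: if_splits)

lift_definition minus_all_crings :: "'a all_crings \<Rightarrow> 'a all_crings \<Rightarrow> 'a all_crings" is
  "\<lambda>(k, f) (l, g). (k - l, \<lambda>R. if cring R then f R \<ominus>\<^bsub>R\<^esub> g R else undefined)"
  by (auto simp: cring.cring_simprules split: if_splits)

instance
proof
  fix a b c :: "'a all_crings"
  show "a * b * c = a * (b * c)"
    by transfer (auto simp: fun_eq_iff cring.cring_simprules(11))
  show "a * b = b * a"
    by transfer (auto simp: fun_eq_iff cring.cring_simprules(14))
  show "1 * a = a"
    by transfer (auto simp: fun_eq_iff cring.cring_simprules(12))
  show "a + b + c = a + (b + c)"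
    by transfer (auto simp: fun_eq_iff cring.cring_simprules(7))
  show "a + b = b + a"
    by transfer (auto simp: fun_eq_iff cring.cring_simprules(10))
  show "0 + a = a"
    by transfer (auto simp: fun_eq_iff cring.cring_simprules(8))
  show "- a + a = 0"
    by transfer (auto simp: fun_eq_iff cring.cring_simprules(9))
  show "a - b = a + - b"
    by transfer (auto simp: fun_eq_iff a_minus_def)
  show "(a + b) * c = a * c + b * c"
    by transfer (auto simp: fun_eq_iff cring.cring_simprules(13) algebra_simps)
  show "(0::'a all_crings) \<noteq> 1"
    by transfer auto
qed

end

definition component :: "'a ring \<Rightarrow> 'a all_crings \<Rightarrow> 'a" where
  "component R t = snd (components t) R"

context
  fixes R :: "'a ring"
  assumes R: "cring R"
begin

lemma component_closed: "component R t \<in> carrier R"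
  unfolding component_def using R by transfer auto

lemma component_hom:
  "component R 0 = \<zero>\<^bsub>R\<^esub>" "component R 1 = \<one>\<^bsub>R\<^esub>"
  "component R (s + t) = component R s \<oplus>\<^bsub>R\<^esub> component R t"
  "component R (s * t) = component R s \<otimes>\<^bsub>R\<^esub> component R t"
  "component R (- t) = \<ominus>\<^bsub>R\<^esub> component R t"
  "component R (s - t) = component R s \<ominus>\<^bsub>R\<^esub> component R t"
  unfolding component_def using R by (transfer; auto)+

end

text \<open>The components of a lift at the other rings can be prescribed
by a default \<open>t\<close>, so that an equation that holds for the default and for the element of \<open>R\<close>
also holds for the lift.\<close>

lift_definition put :: "'a ring \<Rightarrow> 'a all_crings \<Rightarrow> 'a \<Rightarrow> 'a all_crings" is
  "\<lambda>R (k, f) a. (k, if cring R \<and> a \<in> carrier R then f(R := a) else f)"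
  by auto

context
  fixes R :: "'a ring"
  assumes R: "cring R"
begin

lemma component_put: "a \<in> carrier R \<Longrightarrow> component R (put R t a) = a"
  unfolding component_def using R by transfer auto

lemma put_hom:
  assumes "a \<in> carrier R" "b \<in> carrier R"
  shows "put R s a + put R t b = put R (s + t) (a \<oplus>\<^bsub>R\<^esub> b)"
    and "put R s a * put R t b = put R (s * t) (a \<otimes>\<^bsub>R\<^esub> b)"
    and "put R s a - put R t b = put R (s - t) (a \<ominus>\<^bsub>R\<^esub> b)"
proof -
  note cl = cring.cring_simprules(1-6)[OF R]
  show "put R s a + put R t b = put R (s + t) (a \<oplus>\<^bsub>R\<^esub> b)"
    using R assms cl by transfer (auto simp: fun_eq_iff split: prod.splits)
  show "put R s a * put R t b = put R (s * t) (a \<otimes>\<^bsub>R\<^esub> b)"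
    using R assms cl by transfer (auto simp: fun_eq_iff split: prod.splits)
  show "put R s a - put R t b = put R (s - t) (a \<ominus>\<^bsub>R\<^esub> b)"
    using R assms cl by transfer (auto simp: fun_eq_iff split: prod.splits)
qed

lemma put_one: "put R 1 \<one>\<^bsub>R\<^esub> = 1"
  using R cring.cring_simprules(6)[OF R] by transfer (auto simp: fun_eq_iff)

end

fun zcomponent :: "'a ring \<Rightarrow> 'a all_crings zorn \<Rightarrow> 'a zorn" where
  "zcomponent R (Zorn a (u1,u2,u3) (v1,v2,v3) b) =
     Zorn (component R a) (component R u1, component R u2, component R u3)
       (component R v1, component R v2, component R v3) (component R b)"

fun zput :: "'a ring \<Rightarrow> 'a all_crings zorn \<Rightarrow> 'a zorn \<Rightarrow> 'a all_crings zorn" where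
  "zput R (Zorn s (t1,t2,t3) (w1,w2,w3) r) (Zorn a (u1,u2,u3) (v1,v2,v3) b) =
     Zorn (put R s a) (put R t1 u1, put R t2 u2, put R t3 u3)
       (put R w1 v1, put R w2 v2, put R w3 v3) (put R r b)"

lemma zorn_set_iff [simp]: "Zorn a (u1,u2,u3) (v1,v2,v3) b \<in> zorn_set R \<longleftrightarrow>
  {a,u1,u2,u3,v1,v2,v3,b} \<subseteq> carrier R"
  unfolding zorn_set_def vec3_set_def by auto

context
  fixes R :: "'a ring"
  assumes R: "cring R"
begin

lemma zcomponent_mem: "zcomponent R x \<in> zorn_set R"
  by (cases x rule: zorn_coordinates) (simp add: component_closed[OF R])

lemma zcomponent_zmul: "zcomponent R (zmul x y) = zorn_mult R (zcomponent R x) (zcomponent R y)"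
  by (cases x rule: zorn_coordinates, cases y rule: zorn_coordinates) (simp add: component_hom[OF R])

lemma zcomponent_znorm: "zorn_norm R (zcomponent R x) = component R (znorm x)"
  by (cases x rule: zorn_coordinates) (simp add: component_hom[OF R])

lemma zcomponent_zsc: "zcomponent R (zsc c) = zorn_scalar R (component R c)"
  by (simp add: zsc_def zorn_scalar_def component_hom[OF R])

lemma zcomponent_zput: "x \<in> zorn_set R \<Longrightarrow> zcomponent R (zput R s x) = x"
  by (cases x rule: zorn_coordinates, cases s rule: zorn_coordinates) (simp add: component_put[OF R])

lemma znorm_zput: "x \<in> zorn_set R \<Longrightarrow> znorm (zput R s x) = put R (znorm s) (zorn_norm R x)"
  by (cases x rule: zorn_coordinates, cases s rule: zorn_coordinates)
     (simp add: put_hom[OF R] cring.cring_simprules(1-6)[OF R])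

lemma carrier_unit_zorn_loop:
  "x \<in> carrier (unit_zorn_loop R) \<longleftrightarrow> x \<in> zorn_set R \<and> zorn_norm R x = \<one>\<^bsub>R\<^esub>"
  by (simp add: unit_zorn_loop_def)

lemma znorm_zput_1:
  "x \<in> carrier (unit_zorn_loop R) \<Longrightarrow> znorm s = 1 \<Longrightarrow> znorm (zput R s x) = 1"
  by (simp add: carrier_unit_zorn_loop znorm_zput put_one[OF R])

text \<open>Since identities on vector matrices are preserved by \<open>zcomponent\<close>, the two lifting lemmas
transport them to every commutative ring.\<close>

lemma lift_zorn:
  assumes "x \<in> zorn_set R" obtains t where "x = zcomponent R t"
  using zcomponent_zput[OF assms] by metis

lemma lift_unit_zorn:
  assumes "x \<in> carrier (unit_zorn_loop R)" obtains t where "x = zcomponent R t" "znorm t = 1"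
proof (rule that)
  show "x = zcomponent R (zput R (zsc 1) x)"
    using assms by (simp add: carrier_unit_zorn_loop zcomponent_zput)
  show "znorm (zput R (zsc 1) x) = 1"
    using znorm_zput_1[OF assms] by simp
qed

lemma zcomponent_unit: "znorm t = 1 \<Longrightarrow> zcomponent R t \<in> carrier (unit_zorn_loop R)"
  by (simp add: carrier_unit_zorn_loop zcomponent_mem zcomponent_znorm component_hom[OF R])

end

abbreviation neg_one :: "('a, 'm) ring_scheme \<Rightarrow> 'a zorn" where
  "neg_one R \<equiv> zorn_scalar R (\<ominus>\<^bsub>R\<^esub> \<one>\<^bsub>R\<^esub>)"

definition zneg :: "'a ring \<Rightarrow> 'a zorn \<Rightarrow> 'a zorn" where
  "zneg R x = zorn_mult R (neg_one R) x"

context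
  fixes R :: "'a ring"
  assumes R: "cring R"
begin

lemma zmul_minus_one_twice: "zmul (zsc (-1)) (zmul (zsc (-1)) x) = x"
  by (cases x rule: zorn_coordinates) (simp add: zsc_def)

lemma zcomponent_zneg: "zneg R (zcomponent R x) = zcomponent R (zmul (zsc (-1)) x)"
  by (simp add: zneg_def zcomponent_zmul[OF R] zcomponent_zsc[OF R] component_hom[OF R])

lemma unit_zorn_mult_closed:
  assumes "x \<in> carrier (unit_zorn_loop R)" "y \<in> carrier (unit_zorn_loop R)"
  shows "zorn_mult R x y \<in> carrier (unit_zorn_loop R)"
proof -
  obtain s t where st: "x = zcomponent R s" "znorm s = 1" "y = zcomponent R t" "znorm t = 1"
    using lift_unit_zorn[OF R] assms by metis
  have "zcomponent R (zmul s t) \<in> carrier (unit_zorn_loop R)"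
    by (rule zcomponent_unit[OF R]) (simp add: znorm_zmul st)
  then show ?thesis by (simp add: zcomponent_zmul[OF R] st)
qed

lemma unit_zorn_one:
  "zorn_scalar R \<one>\<^bsub>R\<^esub> \<in> carrier (unit_zorn_loop R)" "neg_one R \<in> carrier (unit_zorn_loop R)"
  using zcomponent_unit[OF R, of "zsc 1"] zcomponent_unit[OF R, of "zsc (-1)"]
  by (simp_all add: zcomponent_zsc[OF R] component_hom[OF R])

lemma zorn_mult_one:
  assumes "x \<in> zorn_set R"
  shows "zorn_mult R (zorn_scalar R \<one>\<^bsub>R\<^esub>) x = x" "zorn_mult R x (zorn_scalar R \<one>\<^bsub>R\<^esub>) = x"
proof -
  obtain t where t: "x = zcomponent R t" using lift_zorn[OF R assms] .
  show "zorn_mult R (zorn_scalar R \<one>\<^bsub>R\<^esub>) x = x" "zorn_mult R x (zorn_scalar R \<one>\<^bsub>R\<^esub>) = x"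
    using zcomponent_zmul[OF R, of "zsc 1" t] zcomponent_zmul[OF R, of t "zsc 1"]
    by (simp_all add: t zcomponent_zsc[OF R] component_hom[OF R])
qed

lemma zneg_zneg: "x \<in> zorn_set R \<Longrightarrow> zneg R (zneg R x) = x"
  by (erule lift_zorn[OF R]) (simp add: zcomponent_zneg zmul_minus_one_twice)

lemma zorn_mult_zneg:
  assumes "x \<in> zorn_set R" "y \<in> zorn_set R"
  shows "zorn_mult R (zneg R x) y = zneg R (zorn_mult R x y)"
    "zorn_mult R x (zneg R y) = zneg R (zorn_mult R x y)"
proof -
  obtain s t where "x = zcomponent R s" "y = zcomponent R t"
    using lift_zorn[OF R] assms by metis
  then show "zorn_mult R (zneg R x) y = zneg R (zorn_mult R x y)"
    "zorn_mult R x (zneg R y) = zneg R (zorn_mult R x y)"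
    by (simp_all add: zcomponent_zneg zmul_minus_one flip: zcomponent_zmul[OF R])
qed

lemma zneg_mem: "x \<in> zorn_set R \<Longrightarrow> zneg R x \<in> zorn_set R"
  by (erule lift_zorn[OF R]) (simp add: zcomponent_zneg zcomponent_mem[OF R])

lemma zneg_eq:
  assumes "{a,u1,u2,u3,v1,v2,v3,b} \<subseteq> carrier R"
  shows "zneg R (Zorn a (u1,u2,u3) (v1,v2,v3) b) =
    Zorn (\<ominus>\<^bsub>R\<^esub> a) (\<ominus>\<^bsub>R\<^esub> u1,\<ominus>\<^bsub>R\<^esub> u2,\<ominus>\<^bsub>R\<^esub> u3) (\<ominus>\<^bsub>R\<^esub> v1,\<ominus>\<^bsub>R\<^esub> v2,\<ominus>\<^bsub>R\<^esub> v3) (\<ominus>\<^bsub>R\<^esub> b)"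
proof -
  have "Zorn a (u1,u2,u3) (v1,v2,v3) b \<in> zorn_set R" using assms by simp
  then obtain t where t: "Zorn a (u1,u2,u3) (v1,v2,v3) b = zcomponent R t"
    by (rule lift_zorn[OF R])
  obtain a' u1' u2' u3' v1' v2' v3' b' where t': "t = Zorn a' (u1',u2',u3') (v1',v2',v3') b'"
    by (rule zorn_coordinates)
  show ?thesis
    unfolding t zcomponent_zneg using t unfolding t' by (simp add: zsc_def component_hom[OF R])
qed

lemma unit_zorn_inverse:
  assumes "x \<in> carrier (unit_zorn_loop R)"
  obtains x' where "x' \<in> carrier (unit_zorn_loop R)"
    "\<And>y. y \<in> zorn_set R \<Longrightarrow> zorn_mult R x' (zorn_mult R x y) = y"
    "\<And>y. y \<in> zorn_set R \<Longrightarrow> zorn_mult R x (zorn_mult R x' y) = y"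
    "\<And>y. y \<in> zorn_set R \<Longrightarrow> zorn_mult R (zorn_mult R y x) x' = y"
    "\<And>y. y \<in> zorn_set R \<Longrightarrow> zorn_mult R (zorn_mult R y x') x = y"
proof -
  obtain t where t: "x = zcomponent R t" "znorm t = 1" using assms by (rule lift_unit_zorn[OF R])
  have 1: "zmul (zconj t) (zmul t y) = y" "zmul t (zmul (zconj t) y) = y"
    "zmul (zmul y t) (zconj t) = y" "zmul (zmul y (zconj t)) t = y" for y
    using zmul_zconj_left[of t y] zmul_zconj_left[of "zconj t" y]
      zmul_zconj_right[of y t] zmul_zconj_right[of y "zconj t"] t(2) by simp_all
  have 2: "zorn_mult R (zcomponent R (zconj t)) (zorn_mult R x y) = y"
    "zorn_mult R x (zorn_mult R (zcomponent R (zconj t)) y) = y"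
    "zorn_mult R (zorn_mult R y x) (zcomponent R (zconj t)) = y"
    "zorn_mult R (zorn_mult R y (zcomponent R (zconj t))) x = y" if y: "y \<in> zorn_set R" for y
  proof -
    obtain s where "y = zcomponent R s" using y by (rule lift_zorn[OF R])
    then show "zorn_mult R (zcomponent R (zconj t)) (zorn_mult R x y) = y"
      "zorn_mult R x (zorn_mult R (zcomponent R (zconj t)) y) = y"
      "zorn_mult R (zorn_mult R y x) (zcomponent R (zconj t)) = y"
      "zorn_mult R (zorn_mult R y (zcomponent R (zconj t))) x = y"
      using 1 by (simp_all add: t flip: zcomponent_zmul[OF R])
  qed
  show ?thesis
    by (rule that[of "zcomponent R (zconj t)"]) (use 2 zcomponent_unit[OF R] t in auto)
qed

lemma zorn_mult_moufang:
  assumes "x \<in> zorn_set R" "y \<in> zorn_set R" "z \<in> zorn_set R"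
  shows "zorn_mult R x (zorn_mult R y (zorn_mult R x z)) = zorn_mult R (zorn_mult R (zorn_mult R x y) x) z"
proof -
  obtain r s t where "x = zcomponent R r" "y = zcomponent R s" "z = zcomponent R t"
    using lift_zorn[OF R] assms by metis
  then show ?thesis by (simp add: zmul_moufang flip: zcomponent_zmul[OF R])
qed

end

section \<open>Paige loops over fields are nonassociative simple Moufang loops\<close>

text \<open>The elements of the Paige loop; \<open>zneg R x\<close> is \<open>- x\<close>.\<close>

definition sign_class :: "'a ring \<Rightarrow> 'a zorn \<Rightarrow> 'a zorn set" where
  "sign_class R x = {x, zneg R x}"

lemma unit_zorn_loop_simps [simp]:
  "\<one>\<^bsub>unit_zorn_loop R\<^esub> = zorn_scalar R \<one>\<^bsub>R\<^esub>" "monoid.mult (unit_zorn_loop R) = zorn_mult R"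
  by (simp_all add: unit_zorn_loop_def)

lemma unit_zorn_mem:
  fixes R :: "'a ring"
  shows "cring R \<Longrightarrow> x \<in> carrier (unit_zorn_loop R) \<Longrightarrow> x \<in> zorn_set R"
  by (simp add: carrier_unit_zorn_loop)

context
  fixes R :: "'a ring"
  assumes R: "cring R"
begin

lemma r_coset_signs:
  assumes "x \<in> zorn_set R"
  shows "{zorn_scalar R \<one>\<^bsub>R\<^esub>, neg_one R} #>\<^bsub>unit_zorn_loop R\<^esub> x = sign_class R x"
  unfolding r_coset_def sign_class_def zneg_def using zorn_mult_one[OF R assms] by auto

lemma carrier_paige_loop: "carrier (paige_loop R) = sign_class R ` carrier (unit_zorn_loop R)"
  unfolding paige_loop_def carrier_FactGroup
  using r_coset_signs unit_zorn_mem[OF R] by (intro image_cong) auto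

lemma sign_class_eq_iff:
  assumes "x \<in> zorn_set R" "y \<in> zorn_set R"
  shows "sign_class R x = sign_class R y \<longleftrightarrow> x = y \<or> x = zneg R y"
  unfolding sign_class_def using zneg_zneg[OF R] assms by (metis doubleton_eq_iff insertCI)

lemma sign_class_mult:
  assumes "x \<in> zorn_set R" "y \<in> zorn_set R"
  shows "sign_class R x \<otimes>\<^bsub>paige_loop R\<^esub> sign_class R y = sign_class R (zorn_mult R x y)"
proof -
  have m: "zorn_mult R x y \<in> zorn_set R"
    using assms lift_zorn[OF R] zcomponent_mem[OF R] zcomponent_zmul[OF R] by metis
  have "zorn_mult R (zneg R x) (zneg R y) = zorn_mult R x y"
    using assms m by (simp add: zorn_mult_zneg[OF R] zneg_mem[OF R] zneg_zneg[OF R])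
  then show ?thesis
    unfolding paige_loop_def mult_FactGroup set_mult_def sign_class_def
    using assms by (auto simp: zorn_mult_zneg[OF R])
qed

lemma one_paige_loop: "\<one>\<^bsub>paige_loop R\<^esub> = sign_class R (zorn_scalar R \<one>\<^bsub>R\<^esub>)"
proof -
  have "neg_one R \<in> zorn_set R" using unit_zorn_one[OF R] unit_zorn_mem[OF R] by blast
  from zorn_mult_one(2)[OF R this] show ?thesis
    unfolding paige_loop_def one_FactGroup sign_class_def zneg_def by simp
qed

lemma sign_class_mem: "x \<in> carrier (unit_zorn_loop R) \<Longrightarrow> sign_class R x \<in> carrier (paige_loop R)"
  by (simp add: carrier_paige_loop)

lemma paige_carrierE:
  assumes "c \<in> carrier (paige_loop R)"
  obtains x where "c = sign_class R x" "x \<in> carrier (unit_zorn_loop R)" "x \<in> zorn_set R"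
  using assms unfolding carrier_paige_loop using unit_zorn_mem[OF R] by blast

theorem moufang_loop_paige_loop: "moufang_loop (paige_loop R)"
proof
  let ?M = "paige_loop R"
  note mem = unit_zorn_mem[OF R] and cl = unit_zorn_mult_closed[OF R]
  note memm = mem[OF cl]
  show "\<one>\<^bsub>?M\<^esub> \<in> carrier ?M"
    unfolding one_paige_loop by (intro sign_class_mem unit_zorn_one[OF R])
  show "c \<otimes>\<^bsub>?M\<^esub> d \<in> carrier ?M" if "c \<in> carrier ?M" "d \<in> carrier ?M" for c d
    using that by (auto elim!: paige_carrierE simp: sign_class_mult intro!: sign_class_mem cl)
  show "\<one>\<^bsub>?M\<^esub> \<otimes>\<^bsub>?M\<^esub> c = c" "c \<otimes>\<^bsub>?M\<^esub> \<one>\<^bsub>?M\<^esub> = c" if "c \<in> carrier ?M" for c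
    using that mem[OF unit_zorn_one(1)[OF R]]
    by (auto elim!: paige_carrierE simp: one_paige_loop sign_class_mult zorn_mult_one[OF R])
  show "\<exists>!x. x \<in> carrier ?M \<and> a \<otimes>\<^bsub>?M\<^esub> x = b" if ab: "a \<in> carrier ?M" "b \<in> carrier ?M" for a b
  proof -
    obtain x y where x: "a = sign_class R x" "x \<in> carrier (unit_zorn_loop R)" "x \<in> zorn_set R"
      and y: "b = sign_class R y" "y \<in> carrier (unit_zorn_loop R)" "y \<in> zorn_set R"
      using ab by (metis paige_carrierE)
    obtain x' where x': "x' \<in> carrier (unit_zorn_loop R)"
      "\<And>y. y \<in> zorn_set R \<Longrightarrow> zorn_mult R x' (zorn_mult R x y) = y"
      "\<And>y. y \<in> zorn_set R \<Longrightarrow> zorn_mult R x (zorn_mult R x' y) = y"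
      using unit_zorn_inverse[OF R x(2)] by metis
    show ?thesis
    proof (rule ex1I[of _ "sign_class R (zorn_mult R x' y)"])
      show "sign_class R (zorn_mult R x' y) \<in> carrier ?M \<and> a \<otimes>\<^bsub>?M\<^esub> sign_class R (zorn_mult R x' y) = b"
        using x x' y mem cl by (simp add: sign_class_mult sign_class_mem)
      fix c assume c: "c \<in> carrier ?M \<and> a \<otimes>\<^bsub>?M\<^esub> c = b"
      then obtain z where z: "c = sign_class R z" "z \<in> carrier (unit_zorn_loop R)" "z \<in> zorn_set R"
        by (metis paige_carrierE)
      have "sign_class R (zorn_mult R x z) = sign_class R y"
        using c x y z by (simp add: sign_class_mult)
      moreover have "sign_class R (zorn_mult R x' (zorn_mult R x z)) = sign_class R x' \<otimes>\<^bsub>?M\<^esub> sign_class R (zorn_mult R x z)"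
        using x z x' memm mem by (simp add: sign_class_mult)
      moreover have "sign_class R x' \<otimes>\<^bsub>?M\<^esub> sign_class R y = sign_class R (zorn_mult R x' y)"
        using mem[OF x'(1)] y by (simp add: sign_class_mult)
      ultimately show "c = sign_class R (zorn_mult R x' y)" using z x' by simp
    qed
  qed
  show "\<exists>!x. x \<in> carrier ?M \<and> x \<otimes>\<^bsub>?M\<^esub> a = b" if ab: "a \<in> carrier ?M" "b \<in> carrier ?M" for a b
  proof -
    obtain x y where x: "a = sign_class R x" "x \<in> carrier (unit_zorn_loop R)" "x \<in> zorn_set R"
      and y: "b = sign_class R y" "y \<in> carrier (unit_zorn_loop R)" "y \<in> zorn_set R"
      using ab by (metis paige_carrierE)
    obtain x' where x': "x' \<in> carrier (unit_zorn_loop R)"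
      "\<And>y. y \<in> zorn_set R \<Longrightarrow> zorn_mult R (zorn_mult R y x) x' = y"
      "\<And>y. y \<in> zorn_set R \<Longrightarrow> zorn_mult R (zorn_mult R y x') x = y"
      using unit_zorn_inverse[OF R x(2)] by metis
    show ?thesis
    proof (rule ex1I[of _ "sign_class R (zorn_mult R y x')"])
      show "sign_class R (zorn_mult R y x') \<in> carrier ?M \<and> sign_class R (zorn_mult R y x') \<otimes>\<^bsub>?M\<^esub> a = b"
        using x x' y mem cl by (simp add: sign_class_mult sign_class_mem)
      fix c assume c: "c \<in> carrier ?M \<and> c \<otimes>\<^bsub>?M\<^esub> a = b"
      then obtain z where z: "c = sign_class R z" "z \<in> carrier (unit_zorn_loop R)" "z \<in> zorn_set R"
        by (metis paige_carrierE)
      have "sign_class R (zorn_mult R z x) = sign_class R y"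
        using c x y z by (simp add: sign_class_mult)
      moreover have "sign_class R (zorn_mult R (zorn_mult R z x) x') = sign_class R (zorn_mult R z x) \<otimes>\<^bsub>?M\<^esub> sign_class R x'"
        using x z x' memm mem by (simp add: sign_class_mult)
      moreover have "sign_class R y \<otimes>\<^bsub>?M\<^esub> sign_class R x' = sign_class R (zorn_mult R y x')"
        using mem[OF x'(1)] y by (simp add: sign_class_mult)
      ultimately show "c = sign_class R (zorn_mult R y x')" using z x' by simp
    qed
  qed
  show "x \<otimes>\<^bsub>?M\<^esub> (y \<otimes>\<^bsub>?M\<^esub> (x \<otimes>\<^bsub>?M\<^esub> z)) = x \<otimes>\<^bsub>?M\<^esub> y \<otimes>\<^bsub>?M\<^esub> x \<otimes>\<^bsub>?M\<^esub> z"
    if "x \<in> carrier ?M" "y \<in> carrier ?M" "z \<in> carrier ?M" for x y z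
    using that by (auto elim!: paige_carrierE simp: sign_class_mult cl memm zorn_mult_moufang[OF R])
qed

end

context
  fixes R :: "'a ring"
  assumes field: "field R"
begin

lemma field_is_cring: "cring R"
  using field unfolding field_def domain_def by blast

text \<open>Three upper root elements in different directions do not associate, not even up to sign: the
two products differ by an exchange of the diagonal entries \<open>1\<close> and \<open>2\<close>.\<close>

theorem nonassociative_paige_loop: "nonassociative (paige_loop R)"
proof -
  let ?c = "zcomponent R"
  define x y z :: "'a all_crings zorn" where
    "x = Zorn 1 (1,0,0) (0,0,0) 1" and "y = Zorn 1 (0,1,0) (0,0,0) 1" and "z = Zorn 1 (0,0,1) (0,0,0) 1"
  have n: "znorm x = 1" "znorm y = 1" "znorm z = 1" by (simp_all add: x_def y_def z_def)
  have l: "zmul (zmul x y) z = Zorn 1 (1,1,1) (1,-1,1) (1 + 1)"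
    and r: "zmul x (zmul y z) = Zorn (1 + 1) (1,1,1) (1,-1,1) 1"
    by (simp_all add: x_def y_def z_def)
  note u = zcomponent_unit[OF field_is_cring]
  interpret field R by (rule field)
  have "?c (zmul (zmul x y) z) \<noteq> ?c (zmul x (zmul y z))"
  proof
    assume "?c (zmul (zmul x y) z) = ?c (zmul x (zmul y z))"
    then have "component R (1 + 1) = component R 1" unfolding l r zcomponent.simps by blast
    then have "\<one>\<^bsub>R\<^esub> \<oplus>\<^bsub>R\<^esub> \<one>\<^bsub>R\<^esub> = \<one>\<^bsub>R\<^esub>"
      by (simp only: component_hom[OF field_is_cring])
    then have "\<one>\<^bsub>R\<^esub> = \<zero>\<^bsub>R\<^esub>" by (simp only: add.r_cancel_one[OF one_closed one_closed])
    then show False using one_not_zero by blast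
  qed
  moreover have "?c (zmul (zmul x y) z) \<noteq> zneg R (?c (zmul x (zmul y z)))"
  proof
    assume eq: "?c (zmul (zmul x y) z) = zneg R (?c (zmul x (zmul y z)))"
    have l': "?c (zmul (zmul x y) z) =
        Zorn \<one>\<^bsub>R\<^esub> (\<one>\<^bsub>R\<^esub>,\<one>\<^bsub>R\<^esub>,\<one>\<^bsub>R\<^esub>) (\<one>\<^bsub>R\<^esub>,\<ominus>\<^bsub>R\<^esub> \<one>\<^bsub>R\<^esub>,\<one>\<^bsub>R\<^esub>) (\<one>\<^bsub>R\<^esub> \<oplus>\<^bsub>R\<^esub> \<one>\<^bsub>R\<^esub>)"
      and r': "?c (zmul x (zmul y z)) =
        Zorn (\<one>\<^bsub>R\<^esub> \<oplus>\<^bsub>R\<^esub> \<one>\<^bsub>R\<^esub>) (\<one>\<^bsub>R\<^esub>,\<one>\<^bsub>R\<^esub>,\<one>\<^bsub>R\<^esub>) (\<one>\<^bsub>R\<^esub>,\<ominus>\<^bsub>R\<^esub> \<one>\<^bsub>R\<^esub>,\<one>\<^bsub>R\<^esub>) \<one>\<^bsub>R\<^esub>"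
      unfolding l r by (simp_all only: zcomponent.simps component_hom[OF field_is_cring])
    have "\<one>\<^bsub>R\<^esub> = \<ominus>\<^bsub>R\<^esub> (\<one>\<^bsub>R\<^esub> \<oplus>\<^bsub>R\<^esub> \<one>\<^bsub>R\<^esub>)" and neg: "\<one>\<^bsub>R\<^esub> = \<ominus>\<^bsub>R\<^esub> \<one>\<^bsub>R\<^esub>"
      using eq[unfolded l' r'] zneg_eq[OF field_is_cring, of "\<one>\<^bsub>R\<^esub> \<oplus>\<^bsub>R\<^esub> \<one>\<^bsub>R\<^esub>" "\<one>\<^bsub>R\<^esub>" "\<one>\<^bsub>R\<^esub>" "\<one>\<^bsub>R\<^esub>" "\<one>\<^bsub>R\<^esub>" "\<ominus>\<^bsub>R\<^esub> \<one>\<^bsub>R\<^esub>" "\<one>\<^bsub>R\<^esub>" "\<one>\<^bsub>R\<^esub>"]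
      unfolding zorn.inject prod.inject by (auto dest: zorn.inject[THEN iffD1])
    moreover have "\<one>\<^bsub>R\<^esub> \<oplus>\<^bsub>R\<^esub> \<one>\<^bsub>R\<^esub> = \<zero>\<^bsub>R\<^esub>"
      using r_neg[OF one_closed] arg_cong[OF neg, of "\<lambda>t. \<one>\<^bsub>R\<^esub> \<oplus>\<^bsub>R\<^esub> t"] by argo
    ultimately show False using one_not_zero minus_zero by argo
  qed
  ultimately have "sign_class R (?c (zmul (zmul x y) z)) \<noteq> sign_class R (?c (zmul x (zmul y z)))"
    by (simp add: sign_class_eq_iff[OF field_is_cring] zcomponent_mem[OF field_is_cring])
  then show ?thesis
    unfolding nonassociative_def
    by (intro bexI[of _ "sign_class R (?c x)"] bexI[of _ "sign_class R (?c y)"] bexI[of _ "sign_class R (?c z)"])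
       (simp_all add: sign_class_mult[OF field_is_cring] zcomponent_mem[OF field_is_cring] sign_class_mem[OF field_is_cring] u n
          flip: zcomponent_zmul[OF field_is_cring])
qed

text \<open>The relation lives on the lifts of the elements of norm one, which makes the results on
congruences over type-class rings applicable.\<close>

definition coset_congruence :: "'a zorn set set \<Rightarrow> 'a all_crings zorn \<Rightarrow> 'a all_crings zorn \<Rightarrow> bool" where
  "coset_congruence N x y \<longleftrightarrow>
     sign_class R (zcomponent R x) <#\<^bsub>paige_loop R\<^esub> N = sign_class R (zcomponent R y) <#\<^bsub>paige_loop R\<^esub> N"

lemma zorn_congruence_coset_congruence:
  assumes "normal_subloop N (paige_loop R)"
  shows "zorn_congruence (coset_congruence N)"
proof
  let ?M = "paige_loop R" and ?c = "\<lambda>x. sign_class R (zcomponent R x)"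
  note R = field_is_cring
  have mem: "?c x \<in> carrier ?M" if "znorm x = 1" for x
    by (rule sign_class_mem[OF R zcomponent_unit[OF R that]])
  have mult: "?c (zmul x y) = ?c x \<otimes>\<^bsub>?M\<^esub> ?c y" for x y
    by (simp add: sign_class_mult[OF R] zcomponent_mem[OF R] zcomponent_zmul[OF R])
  have l: "x <#\<^bsub>?M\<^esub> (y <#\<^bsub>?M\<^esub> N) = (x \<otimes>\<^bsub>?M\<^esub> y) <#\<^bsub>?M\<^esub> N"
    and r: "(N #>\<^bsub>?M\<^esub> x) #>\<^bsub>?M\<^esub> y = N #>\<^bsub>?M\<^esub> (x \<otimes>\<^bsub>?M\<^esub> y)"
    and lr: "x <#\<^bsub>?M\<^esub> N = N #>\<^bsub>?M\<^esub> x"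
    if "x \<in> carrier ?M" "y \<in> carrier ?M" for x y
    using assms that unfolding normal_subloop_def by blast+
  show "coset_congruence N (zmul x y) (zmul x' y')"
    if n: "znorm x = 1" "znorm x' = 1" "znorm y = 1" "znorm y' = 1"
      and E: "coset_congruence N x x'" "coset_congruence N y y'" for x x' y y'
  proof -
    have xy: "?c x \<otimes>\<^bsub>?M\<^esub> ?c y \<in> carrier ?M" "?c x' \<otimes>\<^bsub>?M\<^esub> ?c y \<in> carrier ?M"
      using mem[of "zmul x y"] mem[of "zmul x' y"] n by (simp_all add: mult znorm_zmul)
    have "?c (zmul x y) <#\<^bsub>?M\<^esub> N = (N #>\<^bsub>?M\<^esub> ?c x) #>\<^bsub>?M\<^esub> ?c y"
      unfolding mult lr[OF xy(1) xy(1)] using r[OF mem[OF n(1)] mem[OF n(3)]] by simp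
    also have "N #>\<^bsub>?M\<^esub> ?c x = N #>\<^bsub>?M\<^esub> ?c x'"
      using E(1) lr[OF mem[OF n(1)] mem[OF n(1)]] lr[OF mem[OF n(2)] mem[OF n(2)]]
      unfolding coset_congruence_def by simp
    also have "(N #>\<^bsub>?M\<^esub> ?c x') #>\<^bsub>?M\<^esub> ?c y = (?c x' \<otimes>\<^bsub>?M\<^esub> ?c y) <#\<^bsub>?M\<^esub> N"
      unfolding lr[OF xy(2) xy(2)] using r[OF mem[OF n(2)] mem[OF n(3)]] by simp
    also have "\<dots> = ?c x' <#\<^bsub>?M\<^esub> (?c y' <#\<^bsub>?M\<^esub> N)"
      using l[OF mem[OF n(2)] mem[OF n(3)]] E(2) unfolding coset_congruence_def by simp
    also have "\<dots> = ?c (zmul x' y') <#\<^bsub>?M\<^esub> N"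
      unfolding mult using l[OF mem[OF n(2)] mem[OF n(4)]] by simp
    finally show ?thesis unfolding coset_congruence_def .
  qed
  have "?c (zsc (-1)) = ?c (zsc 1)"
    using zcomponent_zneg[OF R, of "zsc 1"]
    by (simp add: sign_class_eq_iff[OF R] zcomponent_mem[OF R])
  then show "coset_congruence N (zsc (-1)) (zsc 1)" by (simp add: coset_congruence_def)
qed (simp_all add: coset_congruence_def)

lemma nonzero_inverse:
  assumes "a \<in> carrier R" "a \<noteq> \<zero>\<^bsub>R\<^esub>"
  obtains i where "put R 1 a * i = 1"
proof -
  interpret field R by (rule field)
  have "a \<otimes>\<^bsub>R\<^esub> inv\<^bsub>R\<^esub> a = \<one>\<^bsub>R\<^esub>" "inv\<^bsub>R\<^esub> a \<in> carrier R" using assms field_Units by auto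
  then have "put R 1 a * put R 1 (inv\<^bsub>R\<^esub> a) = 1"
    using assms by (simp add: put_hom[OF field_is_cring] put_one[OF field_is_cring])
  then show ?thesis using that by blast
qed

text \<open>Over a field every element other than \<open>1\<close> and \<open>-1\<close> has a nonzero off-diagonal entry or
is diagonal with different entries. The default of the lift is a matrix of norm one whose entry at this
place is \<open>1\<close>, so that the entry of the lift is a unit.\<close>

lemma all_roots_of_nonscalar:
  assumes E: "zorn_congruence E"
    and z: "z \<in> carrier (unit_zorn_loop R)" "z \<noteq> zorn_scalar R \<one>\<^bsub>R\<^esub>" "z \<noteq> neg_one R"
    and N: "\<And>t. znorm t = 1 \<Longrightarrow> zcomponent R t = z \<Longrightarrow> zorn_congruence.N E t"
  shows "zorn_congruence.all_roots E"
proof -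
  interpret zorn_congruence E by (rule E)
  interpret field R by (rule field)
  obtain a u1 u2 u3 v1 v2 v3 b where eq: "z = Zorn a (u1,u2,u3) (v1,v2,v3) b"
    by (rule zorn_coordinates)
  have zs: "z \<in> zorn_set R" and nz: "zorn_norm R z = \<one>\<^bsub>R\<^esub>"
    using z(1) by (auto simp: carrier_unit_zorn_loop[OF field_is_cring])
  have cl: "a \<in> carrier R" "b \<in> carrier R" "u1 \<in> carrier R" "u2 \<in> carrier R" "u3 \<in> carrier R"
    "v1 \<in> carrier R" "v2 \<in> carrier R" "v3 \<in> carrier R"
    using zs unfolding eq by simp_all
  have lift: "N (zput R s z)" if "znorm s = 1" for s
    using N[OF znorm_zput_1[OF field_is_cring z(1) that] zcomponent_zput[OF field_is_cring zs]] .
  show ?thesis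
  proof (cases "u1 = \<zero>\<^bsub>R\<^esub> \<and> u2 = \<zero>\<^bsub>R\<^esub> \<and> u3 = \<zero>\<^bsub>R\<^esub> \<and> v1 = \<zero>\<^bsub>R\<^esub> \<and> v2 = \<zero>\<^bsub>R\<^esub> \<and> v3 = \<zero>\<^bsub>R\<^esub>")
    case False
    then consider "u1 \<noteq> \<zero>\<^bsub>R\<^esub>" | "u2 \<noteq> \<zero>\<^bsub>R\<^esub>" | "u3 \<noteq> \<zero>\<^bsub>R\<^esub>" | "v1 \<noteq> \<zero>\<^bsub>R\<^esub>" | "v2 \<noteq> \<zero>\<^bsub>R\<^esub>" | "v3 \<noteq> \<zero>\<^bsub>R\<^esub>"
      by blast
    then show ?thesis
    proof cases
      case 1
      obtain i where "put R 1 u1 * i = 1" using nonzero_inverse[OF cl(3) 1] .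
      then show ?thesis
        using all_roots_of_upper[OF lift[of "Zorn 1 (1,0,0) (0,0,0) 1", unfolded eq zput.simps], of i] by simp
    next
      case 2
      obtain i where "put R 1 u2 * i = 1" using nonzero_inverse[OF cl(4) 2] .
      then show ?thesis
        using all_roots_of_upper[OF lift[of "Zorn 1 (0,1,0) (0,0,0) 1", unfolded eq zput.simps], of i] by simp
    next
      case 3
      obtain i where "put R 1 u3 * i = 1" using nonzero_inverse[OF cl(5) 3] .
      then show ?thesis
        using all_roots_of_upper[OF lift[of "Zorn 1 (0,0,1) (0,0,0) 1", unfolded eq zput.simps], of i] by simp
    next
      case 4
      obtain i where "put R 1 v1 * i = 1" using nonzero_inverse[OF cl(6) 4] .
      then show ?thesis
        using all_roots_of_lower[OF lift[of "Zorn 1 (0,0,0) (1,0,0) 1", unfolded eq zput.simps], of i] by simp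
    next
      case 5
      obtain i where "put R 1 v2 * i = 1" using nonzero_inverse[OF cl(7) 5] .
      then show ?thesis
        using all_roots_of_lower[OF lift[of "Zorn 1 (0,0,0) (0,1,0) 1", unfolded eq zput.simps], of i] by simp
    next
      case 6
      obtain i where "put R 1 v3 * i = 1" using nonzero_inverse[OF cl(8) 6] .
      then show ?thesis
        using all_roots_of_lower[OF lift[of "Zorn 1 (0,0,0) (0,0,1) 1", unfolded eq zput.simps], of i] by simp
    qed
  next
    case True
    then have diag: "z = Zorn a (\<zero>\<^bsub>R\<^esub>,\<zero>\<^bsub>R\<^esub>,\<zero>\<^bsub>R\<^esub>) (\<zero>\<^bsub>R\<^esub>,\<zero>\<^bsub>R\<^esub>,\<zero>\<^bsub>R\<^esub>) b" by (simp add: eq)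
    have ab: "a \<otimes>\<^bsub>R\<^esub> b = \<one>\<^bsub>R\<^esub>" using nz cl unfolding diag by (simp add: a_minus_def)
    have "a \<noteq> b"
    proof
      assume "a = b"
      then have "a \<otimes>\<^bsub>R\<^esub> a = \<one>\<^bsub>R\<^esub>" using ab by simp
      then have "a = \<one>\<^bsub>R\<^esub> \<or> a = \<ominus>\<^bsub>R\<^esub> \<one>\<^bsub>R\<^esub>" using cl(1) square_eq_one by blast
      then show False using z(2,3) \<open>a = b\<close> unfolding diag zorn_scalar_def by auto
    qed
    then have ne: "\<zero>\<^bsub>R\<^esub> \<oplus>\<^bsub>R\<^esub> b \<ominus>\<^bsub>R\<^esub> a \<ominus>\<^bsub>R\<^esub> \<zero>\<^bsub>R\<^esub> \<noteq> \<zero>\<^bsub>R\<^esub>" 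
      using cl r_right_minus_eq[of b a] by (auto simp: minus_eq)
    \<comment> \<open>a matrix with \<open>a - b = 1\<close> and \<open>a b = 1\<close> need not exist in every ring; this one has
      norm one and \<open>u1 + b - a - v1 = 1\<close>\<close>
    let ?s = "Zorn 1 (1,0,0) (-1,0,0) (0::'a all_crings)"
    obtain i where i: "put R 1 (\<zero>\<^bsub>R\<^esub> \<oplus>\<^bsub>R\<^esub> b \<ominus>\<^bsub>R\<^esub> a \<ominus>\<^bsub>R\<^esub> \<zero>\<^bsub>R\<^esub>) * i = 1"
      by (rule nonzero_inverse[OF _ ne]) (use cl in auto)
    have "put R 1 \<zero>\<^bsub>R\<^esub> + put R 0 b - put R 1 a - put R (-1) \<zero>\<^bsub>R\<^esub> = put R 1 (\<zero>\<^bsub>R\<^esub> \<oplus>\<^bsub>R\<^esub> b \<ominus>\<^bsub>R\<^esub> a \<ominus>\<^bsub>R\<^esub> \<zero>\<^bsub>R\<^esub>)"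
      using cl by (simp add: put_hom[OF field_is_cring])
    then show ?thesis
      using lift[of ?s] i unfolding diag by (simp add: all_roots_of_diagonal)
  qed
qed

theorem simple_loop_paige_loop: "simple_loop (paige_loop R)"
proof -
  let ?M = "paige_loop R" and ?c = "\<lambda>x. sign_class R (zcomponent R x)"
  note R = field_is_cring
  interpret M: moufang_loop ?M by (rule moufang_loop_paige_loop[OF R])
  interpret F: field R by (rule field)
  have one: "\<one>\<^bsub>?M\<^esub> = ?c (zsc 1)"
    by (simp add: one_paige_loop[OF R] zcomponent_zsc[OF R] component_hom[OF R])
  have "carrier ?M \<noteq> {\<one>\<^bsub>?M\<^esub>}"
  proof
    assume "carrier ?M = {\<one>\<^bsub>?M\<^esub>}"
    then have "\<not> nonassociative ?M" unfolding nonassociative_def using M.l_one M.one_closed by simp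
    then show False using nonassociative_paige_loop by blast
  qed
  moreover have "N = carrier ?M" if N: "normal_subloop N ?M" "N \<noteq> {\<one>\<^bsub>?M\<^esub>}" for N
  proof -
    interpret zorn_congruence "coset_congruence N" by (rule zorn_congruence_coset_congruence[OF N(1)])
    have sub: "N \<subseteq> carrier ?M" and "loop (?M\<lparr>carrier := N\<rparr>)"
      using N(1) by (auto simp: normal_subloop_def subloop_def)
    then interpret N: loop "?M\<lparr>carrier := N\<rparr>" by blast
    have oneN: "\<one>\<^bsub>?M\<^esub> \<in> N" using N.one_closed by simp
    then obtain d where d: "d \<in> N" "d \<noteq> \<one>\<^bsub>?M\<^esub>" using N(2) by blast
    have coset: "x <#\<^bsub>?M\<^esub> N = N" if x: "x \<in> N" for x
    proof
      show "x <#\<^bsub>?M\<^esub> N \<subseteq> N" using N.m_closed x by (auto simp: l_coset_def)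
      show "N \<subseteq> x <#\<^bsub>?M\<^esub> N"
      proof
        fix y assume "y \<in> N"
        then obtain w where "w \<in> N" "x \<otimes>\<^bsub>?M\<^esub> w = y" using N.l_div[of x y] x by auto
        then show "y \<in> x <#\<^bsub>?M\<^esub> N" by (auto simp: l_coset_def)
      qed
    qed
    obtain z where z: "d = sign_class R z" "z \<in> carrier (unit_zorn_loop R)"
      using d sub paige_carrierE[OF R] by blast
    have all_roots
    proof (rule all_roots_of_nonscalar[OF zorn_congruence_axioms z(2)])
      show "z \<noteq> zorn_scalar R \<one>\<^bsub>R\<^esub>"
        using d(2) z unfolding one_paige_loop[OF R] by blast
      have "neg_one R = zneg R (zorn_scalar R \<one>\<^bsub>R\<^esub>)"
        unfolding zneg_def using zorn_mult_one(2)[OF R unit_zorn_mem[OF R unit_zorn_one(2)[OF R]]] by simp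
      then have "sign_class R (neg_one R) = sign_class R (zorn_scalar R \<one>\<^bsub>R\<^esub>)"
        using sign_class_eq_iff[OF R unit_zorn_mem[OF R unit_zorn_one(2)[OF R]] unit_zorn_mem[OF R unit_zorn_one(1)[OF R]]]
        by blast
      then show "z \<noteq> neg_one R"
        using d(2) z unfolding one_paige_loop[OF R] by blast
      show "local.N t" if "znorm t = 1" "zcomponent R t = z" for t
        using that d z(1) coset oneN unfolding N_def coset_congruence_def one[symmetric] by simp
    qed
    have all: "local.N t" if "znorm t = 1"
       "(\<exists>a u1 u2 u3 v1 v2 v3 b i. t = Zorn a (u1,u2,u3) (v1,v2,v3) b \<and> (a * i = 1 \<or> v1 * i = 1 \<or> v2 * i = 1 \<or> v3 * i = 1))" for t
      using that N_of_diagonal_unit[OF \<open>all_roots\<close>] N_of_lower_units[OF \<open>all_roots\<close>] by blast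
    have "c \<in> N" if c: "c \<in> carrier ?M" for c
    proof -
      obtain w where w: "c = sign_class R w" "w \<in> carrier (unit_zorn_loop R)" "w \<in> zorn_set R"
        using paige_carrierE[OF R c] .
      obtain a u1 u2 u3 v1 v2 v3 b where eq: "w = Zorn a (u1,u2,u3) (v1,v2,v3) b"
        by (rule zorn_coordinates)
      have cl: "a \<in> carrier R" "b \<in> carrier R" "u1 \<in> carrier R" "u2 \<in> carrier R" "u3 \<in> carrier R"
        "v1 \<in> carrier R" "v2 \<in> carrier R" "v3 \<in> carrier R"
        using w(3) unfolding eq by simp_all
      have nw: "zorn_norm R w = \<one>\<^bsub>R\<^esub>" using w(2) by (auto simp: carrier_unit_zorn_loop[OF R])
      have "a \<noteq> \<zero>\<^bsub>R\<^esub> \<or> v1 \<noteq> \<zero>\<^bsub>R\<^esub> \<or> v2 \<noteq> \<zero>\<^bsub>R\<^esub> \<or> v3 \<noteq> \<zero>\<^bsub>R\<^esub>"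
      proof (rule ccontr)
        assume "\<not> ?thesis"
        then have "zorn_norm R w = \<zero>\<^bsub>R\<^esub>" using cl unfolding eq by (simp add: F.minus_eq)
        then show False using nw F.one_not_zero by simp
      qed
      moreover have N_unit: "local.N (zput R s w)"
        if n: "znorm s = 1" and x: "x \<in> carrier R" "x \<noteq> \<zero>\<^bsub>R\<^esub>"
          and w': "\<And>i. put R 1 x * i = 1 \<Longrightarrow> (\<exists>a u1 u2 u3 v1 v2 v3 b. zput R s w = Zorn a (u1,u2,u3) (v1,v2,v3) b \<and>
            (a * i = 1 \<or> v1 * i = 1 \<or> v2 * i = 1 \<or> v3 * i = 1))" for s x
      proof -
        obtain i where "put R 1 x * i = 1" using nonzero_inverse[OF x] .
        then show ?thesis using all[OF znorm_zput_1[OF R w(2) n]] w' by blast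
      qed
      ultimately consider "a \<noteq> \<zero>\<^bsub>R\<^esub>" | "v1 \<noteq> \<zero>\<^bsub>R\<^esub>" | "v2 \<noteq> \<zero>\<^bsub>R\<^esub>" | "v3 \<noteq> \<zero>\<^bsub>R\<^esub>"
        by blast
      then have "\<exists>s. local.N (zput R s w)"
      proof cases
        case 1
        show ?thesis
          by (intro exI, rule N_unit[OF _ cl(1) 1, of "Zorn 1 (0,0,0) (0,0,0) 1"]) (simp_all add: eq)
      next
        case 2
        show ?thesis
          by (intro exI, rule N_unit[OF _ cl(6) 2, of "Zorn 1 (0,0,0) (1,0,0) 1"]) (simp_all add: eq)
      next
        case 3
        show ?thesis
          by (intro exI, rule N_unit[OF _ cl(7) 3, of "Zorn 1 (0,0,0) (0,1,0) 1"]) (simp_all add: eq)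
      next
        case 4
        show ?thesis
          by (intro exI, rule N_unit[OF _ cl(8) 4, of "Zorn 1 (0,0,0) (0,0,1) 1"]) (simp_all add: eq)
      qed
      then obtain s where "local.N (zput R s w)" by blast
      then have "c <#\<^bsub>?M\<^esub> N = \<one>\<^bsub>?M\<^esub> <#\<^bsub>?M\<^esub> N"
        unfolding N_def coset_congruence_def one[symmetric] zcomponent_zput[OF R w(3)] w(1) by blast
      then have "c <#\<^bsub>?M\<^esub> N = N" using coset[OF oneN] by simp
      moreover have "c \<otimes>\<^bsub>?M\<^esub> \<one>\<^bsub>?M\<^esub> \<in> c <#\<^bsub>?M\<^esub> N" using oneN by (auto simp: l_coset_def)
      ultimately show ?thesis using M.r_one[OF c] by simp
    qed
    then show ?thesis using sub by blast
  qed
  ultimately show ?thesis unfolding simple_loop_def using M.loop_axioms by blast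
qed

end

section \<open>Inclusions between Paige loops\<close>

lemma add_pow_carrier_update: "add_pow (R\<lparr>carrier := F\<rparr>) (n::nat) x = add_pow R n x"
  by (simp add: add_pow_def nat_pow_def)

lemma a_inv_subfield:
  assumes "field R" "subfield F R" "x \<in> F"
  shows "\<ominus>\<^bsub>R\<lparr>carrier := F\<rparr>\<^esub> x = \<ominus>\<^bsub>R\<^esub> x"
proof -
  interpret R: field R by fact
  interpret S: field "R\<lparr>carrier := F\<rparr>" using R.subfield_iff(2)[OF assms(2)] .
  have "x \<in> carrier R" using subfieldE(3)[OF assms(2)] assms(3) by blast
  moreover have "\<ominus>\<^bsub>R\<lparr>carrier := F\<rparr>\<^esub> x \<in> F" using S.a_inv_closed[of x] assms(3) by simp
  moreover have "x \<oplus>\<^bsub>R\<^esub> \<ominus>\<^bsub>R\<lparr>carrier := F\<rparr>\<^esub> x = \<zero>\<^bsub>R\<^esub>" using S.r_neg[of x] assms(3) by simp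
  ultimately show ?thesis
    using subfieldE(3)[OF assms(2)] R.add.inv_equality[of "\<ominus>\<^bsub>R\<lparr>carrier := F\<rparr>\<^esub> x" x] R.a_comm
    unfolding a_inv_def by force
qed

context
  fixes R :: "'a ring" and F :: "'a set"
  assumes field: "field R" and sub: "subfield F R"
begin

lemma field_subfield: "field (R\<lparr>carrier := F\<rparr>)"
proof -
  interpret field R by (rule field)
  show ?thesis using subfield_iff(2)[OF sub] .
qed

lemma subfield_subset: "F \<subseteq> carrier R" using subfieldE(3)[OF sub] .

lemma zorn_set_subfield: "x \<in> zorn_set (R\<lparr>carrier := F\<rparr>) \<Longrightarrow> x \<in> zorn_set R"
  using subfield_subset by (cases x rule: zorn_coordinates) auto

lemma zneg_subfield:
  assumes "x \<in> zorn_set (R\<lparr>carrier := F\<rparr>)"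
  shows "zneg (R\<lparr>carrier := F\<rparr>) x = zneg R x"
proof (cases x rule: zorn_coordinates)
  case (1 a u1 u2 u3 v1 v2 v3 b)
  then have "{a,u1,u2,u3,v1,v2,v3,b} \<subseteq> F" using assms by simp
  moreover from this have "{a,u1,u2,u3,v1,v2,v3,b} \<subseteq> carrier R" using subfield_subset by blast
  ultimately show ?thesis
    unfolding 1 using zneg_eq[OF field_is_cring[OF field_subfield], of a u1 u2 u3 v1 v2 v3 b]
      zneg_eq[OF field_is_cring[OF field], of a u1 u2 u3 v1 v2 v3 b]
    by (simp add: a_inv_subfield[OF field sub])
qed

lemma zorn_mult_subfield:
  assumes "x \<in> zorn_set (R\<lparr>carrier := F\<rparr>)" "y \<in> zorn_set (R\<lparr>carrier := F\<rparr>)"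
  shows "zorn_mult (R\<lparr>carrier := F\<rparr>) x y = zorn_mult R x y"
proof -
  interpret S: field "R\<lparr>carrier := F\<rparr>" by (rule field_subfield)
  have "\<And>x y. x \<in> F \<Longrightarrow> y \<in> F \<Longrightarrow> x \<otimes>\<^bsub>R\<^esub> y \<in> F" "\<And>x y. x \<in> F \<Longrightarrow> y \<in> F \<Longrightarrow> x \<oplus>\<^bsub>R\<^esub> y \<in> F"
    using S.m_closed S.a_closed by simp_all
  moreover have "\<And>x. x \<in> F \<Longrightarrow> \<ominus>\<^bsub>R\<^esub> x \<in> F"
    using S.a_inv_closed a_inv_subfield[OF field sub] by simp
  ultimately show ?thesis
    using assms by (cases x rule: zorn_coordinates, cases y rule: zorn_coordinates)
      (simp add: a_minus_def a_inv_subfield[OF field sub])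
qed

lemma zorn_norm_subfield:
  assumes "x \<in> zorn_set (R\<lparr>carrier := F\<rparr>)"
  shows "zorn_norm (R\<lparr>carrier := F\<rparr>) x = zorn_norm R x"
proof -
  interpret S: field "R\<lparr>carrier := F\<rparr>" by (rule field_subfield)
  have "\<And>x y. x \<in> F \<Longrightarrow> y \<in> F \<Longrightarrow> x \<otimes>\<^bsub>R\<^esub> y \<in> F" "\<And>x y. x \<in> F \<Longrightarrow> y \<in> F \<Longrightarrow> x \<oplus>\<^bsub>R\<^esub> y \<in> F"
    using S.m_closed S.a_closed by simp_all
  then show ?thesis
    using assms by (cases x rule: zorn_coordinates) (simp add: a_minus_def a_inv_subfield[OF field sub])
qed

lemma unit_zorn_loop_subfield:
  "x \<in> carrier (unit_zorn_loop (R\<lparr>carrier := F\<rparr>)) \<longleftrightarrow>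
    x \<in> zorn_set (R\<lparr>carrier := F\<rparr>) \<and> zorn_norm R x = \<one>\<^bsub>R\<^esub>"
  unfolding carrier_unit_zorn_loop[OF field_is_cring[OF field_subfield]]
  by (rule conj_cong[OF HOL.refl]) (simp add: zorn_norm_subfield)

lemma sign_class_subfield:
  "x \<in> zorn_set (R\<lparr>carrier := F\<rparr>) \<Longrightarrow> sign_class (R\<lparr>carrier := F\<rparr>) x = sign_class R x"
  by (simp add: sign_class_def zneg_subfield)

lemma carrier_paige_subfield:
  "carrier (paige_over R F) =
    sign_class R ` {x \<in> zorn_set (R\<lparr>carrier := F\<rparr>). zorn_norm R x = \<one>\<^bsub>R\<^esub>}"
  unfolding carrier_paige_loop[OF field_is_cring[OF field_subfield]]
proof (rule image_cong)
  show "carrier (unit_zorn_loop (R\<lparr>carrier := F\<rparr>)) =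
      {x \<in> zorn_set (R\<lparr>carrier := F\<rparr>). zorn_norm R x = \<one>\<^bsub>R\<^esub>}"
    using unit_zorn_loop_subfield by blast
qed (simp add: sign_class_subfield)

lemma paige_mult_subfield:
  assumes "c \<in> carrier (paige_over R F)" "d \<in> carrier (paige_over R F)"
  shows "c \<otimes>\<^bsub>paige_over R F\<^esub> d = c \<otimes>\<^bsub>paige_loop R\<^esub> d"
proof -
  note S = field_is_cring[OF field_subfield]
  obtain x y where x: "c = sign_class (R\<lparr>carrier := F\<rparr>) x" "x \<in> zorn_set (R\<lparr>carrier := F\<rparr>)"
      "x \<in> carrier (unit_zorn_loop (R\<lparr>carrier := F\<rparr>))"
    and y: "d = sign_class (R\<lparr>carrier := F\<rparr>) y" "y \<in> zorn_set (R\<lparr>carrier := F\<rparr>)"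
      "y \<in> carrier (unit_zorn_loop (R\<lparr>carrier := F\<rparr>))"
    using paige_carrierE[OF S] assms by metis
  have "zorn_mult (R\<lparr>carrier := F\<rparr>) x y \<in> zorn_set (R\<lparr>carrier := F\<rparr>)"
    using unit_zorn_mem[OF S unit_zorn_mult_closed[OF S x(3) y(3)]] .
  then show ?thesis
    unfolding x(1) y(1) sign_class_mult[OF S x(2) y(2)]
    using x(2) y(2) by (simp add: sign_class_subfield sign_class_mult[OF field_is_cring[OF field]]
      zorn_set_subfield zorn_mult_subfield)
qed

lemma paige_one_subfield: "\<one>\<^bsub>paige_over R F\<^esub> = \<one>\<^bsub>paige_loop R\<^esub>"
proof -
  note S = field_is_cring[OF field_subfield]
  have "zorn_scalar R \<one>\<^bsub>R\<^esub> = zorn_scalar (R\<lparr>carrier := F\<rparr>) \<one>\<^bsub>R\<lparr>carrier := F\<rparr>\<^esub>"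
    by (simp add: zorn_scalar_def)
  then show ?thesis
    unfolding one_paige_loop[OF S] one_paige_loop[OF field_is_cring[OF field]]
    using sign_class_subfield unit_zorn_mem[OF S unit_zorn_one(1)[OF S]] by metis
qed

end

lemma loop_carrier_cong:
  assumes "loop K" and "carrier L = carrier K" and "\<one>\<^bsub>L\<^esub> = \<one>\<^bsub>K\<^esub>"
    and "\<And>x y. x \<in> carrier K \<Longrightarrow> y \<in> carrier K \<Longrightarrow> x \<otimes>\<^bsub>L\<^esub> y = x \<otimes>\<^bsub>K\<^esub> y"
  shows "loop L"
proof -
  interpret K: loop K by fact
  note [simp] = assms(2-4)
  show ?thesis
  proof
    show "\<exists>!x. x \<in> carrier L \<and> a \<otimes>\<^bsub>L\<^esub> x = b" if "a \<in> carrier L" "b \<in> carrier L" for a b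
      using K.l_div[of a b] that by (simp cong: conj_cong)
    show "\<exists>!y. y \<in> carrier L \<and> y \<otimes>\<^bsub>L\<^esub> a = b" if "a \<in> carrier L" "b \<in> carrier L" for a b
      using K.r_div[of a b] that by (simp cong: conj_cong)
  qed (simp_all add: K.one_closed K.m_closed K.l_one K.r_one)
qed

text \<open>The operations of a subfield are those of the field, so both loops have the same operations on the
smaller set.\<close>

theorem loop_le_paige_subfields:
  fixes R :: "'a ring"
  assumes R: "field R" and F: "subfield F R" and F': "subfield F' R" and "F \<subseteq> F'"
  shows "loop_le (paige_over R F) (paige_over R F')"
proof -
  have sub: "carrier (paige_over R F) \<subseteq> carrier (paige_over R F')"
    unfolding carrier_paige_subfield[OF R F] carrier_paige_subfield[OF R F']
    using \<open>F \<subseteq> F'\<close> by (intro image_mono) (auto simp: zorn_set_def vec3_set_def)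
  have mult: "c \<otimes>\<^bsub>paige_over R F\<^esub> d = c \<otimes>\<^bsub>paige_over R F'\<^esub> d"
    if "c \<in> carrier (paige_over R F)" "d \<in> carrier (paige_over R F)" for c d
    using paige_mult_subfield[OF R F that]
      paige_mult_subfield[OF R F' subsetD[OF sub that(1)] subsetD[OF sub that(2)]] by simp
  have "loop (paige_over R F)"
    using moufang_loop_paige_loop[OF field_is_cring[OF field_subfield[OF R F]]] by (simp add: moufang_loop_def)
  then have "loop ((paige_over R F')\<lparr>carrier := carrier (paige_over R F)\<rparr>)"
    by (rule loop_carrier_cong) (simp_all add: mult paige_one_subfield[OF R F] paige_one_subfield[OF R F'])
  then show ?thesis unfolding loop_le_def subloop_def using sub mult by blast
qed

lemma loop_le_one:
  assumes "loop K" "loop L" "loop_le K L" shows "\<one>\<^bsub>K\<^esub> = \<one>\<^bsub>L\<^esub>"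
proof -
  interpret K: loop K by fact
  interpret L: loop L by fact
  have "\<one>\<^bsub>K\<^esub> \<in> carrier L" "\<one>\<^bsub>K\<^esub> \<otimes>\<^bsub>L\<^esub> \<one>\<^bsub>K\<^esub> = \<one>\<^bsub>K\<^esub>"
    using assms(3) K.one_closed K.l_one[OF K.one_closed] unfolding loop_le_def subloop_def by auto
  then show ?thesis using L.l_div[of "\<one>\<^bsub>K\<^esub>" "\<one>\<^bsub>K\<^esub>"] L.r_one[of "\<one>\<^bsub>K\<^esub>"] L.one_closed by blast
qed

context
  fixes S T :: "'a ring"
  assumes S: "field S" and T: "field T" and le: "loop_le (paige_loop S) (paige_loop T)"
begin

text \<open>Conversely, a literal inclusion between two Paige loops, over fields that are not assumed to
be related, already determines zero, one up to sign, and the addition.\<close>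

lemma sign_class_transfer:
  assumes "x \<in> carrier (unit_zorn_loop S)"
  shows "x \<in> zorn_set T" "sign_class S x = sign_class T x"
proof -
  have "sign_class S x \<in> carrier (paige_loop T)"
    using le sign_class_mem[OF field_is_cring[OF S] assms] by (auto simp: loop_le_def subloop_def)
  then obtain y where y: "sign_class S x = sign_class T y" "y \<in> zorn_set T"
    by (rule paige_carrierE[OF field_is_cring[OF T]])
  then have x: "x = y \<or> x = zneg T y" by (auto simp: sign_class_def)
  then show xs: "x \<in> zorn_set T" using zneg_mem[OF field_is_cring[OF T]] y(2) by auto
  then show "sign_class S x = sign_class T x"
    unfolding y(1) using sign_class_eq_iff[OF field_is_cring[OF T] xs y(2)] x by blast
qed

lemma loop_le_paige_carrier: "carrier S \<subseteq> carrier T"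
proof
  interpret S: field S by (rule S)
  fix a assume "a \<in> carrier S"
  then have "Zorn \<one>\<^bsub>S\<^esub> (a,\<zero>\<^bsub>S\<^esub>,\<zero>\<^bsub>S\<^esub>) (\<zero>\<^bsub>S\<^esub>,\<zero>\<^bsub>S\<^esub>,\<zero>\<^bsub>S\<^esub>) \<one>\<^bsub>S\<^esub> \<in> carrier (unit_zorn_loop S)"
    by (simp add: carrier_unit_zorn_loop[OF field_is_cring[OF S]] S.minus_eq)
  from sign_class_transfer(1)[OF this] show "a \<in> carrier T" by simp
qed

lemma loop_le_paige_units:
  "\<zero>\<^bsub>S\<^esub> = \<zero>\<^bsub>T\<^esub>" "\<one>\<^bsub>S\<^esub> = \<one>\<^bsub>T\<^esub> \<or> \<one>\<^bsub>S\<^esub> = \<ominus>\<^bsub>T\<^esub> \<one>\<^bsub>T\<^esub>"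
proof -
  interpret T: field T by (rule T)
  have "\<one>\<^bsub>paige_loop S\<^esub> = \<one>\<^bsub>paige_loop T\<^esub>"
    using loop_le_one[OF _ _ le] moufang_loop_paige_loop[OF field_is_cring[OF S]] moufang_loop_paige_loop[OF field_is_cring[OF T]]
    by (simp add: moufang_loop_def)
  then have "zorn_scalar S \<one>\<^bsub>S\<^esub> \<in> sign_class T (zorn_scalar T \<one>\<^bsub>T\<^esub>)"
    unfolding one_paige_loop[OF field_is_cring[OF S]] one_paige_loop[OF field_is_cring[OF T]] by (auto simp: sign_class_def)
  then have "zorn_scalar S \<one>\<^bsub>S\<^esub> = zorn_scalar T \<one>\<^bsub>T\<^esub> \<or> zorn_scalar S \<one>\<^bsub>S\<^esub> = zorn_scalar T (\<ominus>\<^bsub>T\<^esub> \<one>\<^bsub>T\<^esub>)"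
    unfolding sign_class_def zorn_scalar_def by (simp add: zneg_eq[OF field_is_cring[OF T]])
  then show "\<zero>\<^bsub>S\<^esub> = \<zero>\<^bsub>T\<^esub>" "\<one>\<^bsub>S\<^esub> = \<one>\<^bsub>T\<^esub> \<or> \<one>\<^bsub>S\<^esub> = \<ominus>\<^bsub>T\<^esub> \<one>\<^bsub>T\<^esub>"
    by (auto simp: zorn_scalar_def)
qed

text \<open>Addition is recovered from the multiplication of upper root elements. The sign of \<open>e\<close> cancels
against the sign in the classes.\<close>

lemma loop_le_paige_add:
  assumes a: "a \<in> carrier S" and b: "b \<in> carrier S" shows "a \<oplus>\<^bsub>S\<^esub> b = a \<oplus>\<^bsub>T\<^esub> b"
proof -
  interpret S: field S by (rule S)
  interpret T: field T by (rule T)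
  define x y z where "x = Zorn \<one>\<^bsub>S\<^esub> (a,\<zero>\<^bsub>S\<^esub>,\<zero>\<^bsub>S\<^esub>) (\<zero>\<^bsub>S\<^esub>,\<zero>\<^bsub>S\<^esub>,\<zero>\<^bsub>S\<^esub>) \<one>\<^bsub>S\<^esub>"
    and "y = Zorn \<one>\<^bsub>S\<^esub> (b,\<zero>\<^bsub>S\<^esub>,\<zero>\<^bsub>S\<^esub>) (\<zero>\<^bsub>S\<^esub>,\<zero>\<^bsub>S\<^esub>,\<zero>\<^bsub>S\<^esub>) \<one>\<^bsub>S\<^esub>"
    and "z = Zorn \<one>\<^bsub>S\<^esub> (a \<oplus>\<^bsub>S\<^esub> b,\<zero>\<^bsub>S\<^esub>,\<zero>\<^bsub>S\<^esub>) (\<zero>\<^bsub>S\<^esub>,\<zero>\<^bsub>S\<^esub>,\<zero>\<^bsub>S\<^esub>) \<one>\<^bsub>S\<^esub>"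
  have xyz: "x \<in> carrier (unit_zorn_loop S)" "y \<in> carrier (unit_zorn_loop S)" "z \<in> carrier (unit_zorn_loop S)"
    using a b by (simp_all add: carrier_unit_zorn_loop[OF field_is_cring[OF S]] S.minus_eq x_def y_def z_def)
  note xyzS = xyz[THEN unit_zorn_mem[OF field_is_cring[OF S]]]
  note tr = xyz[THEN sign_class_transfer(2)] and xyzT = xyz[THEN sign_class_transfer(1)]
  have "zorn_mult S x y = z"
    using a b by (simp add: x_def y_def z_def S.minus_eq S.a_comm)
  then have "sign_class S x \<otimes>\<^bsub>paige_loop S\<^esub> sign_class S y = sign_class S z"
    using sign_class_mult[OF field_is_cring[OF S] xyzS(1,2)] by simp
  then have "sign_class S z = sign_class S x \<otimes>\<^bsub>paige_loop T\<^esub> sign_class S y"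
    using le sign_class_mem[OF field_is_cring[OF S]] xyz by (simp add: loop_le_def)
  then have "sign_class T z = sign_class T (zorn_mult T x y)"
    unfolding tr using sign_class_mult[OF field_is_cring[OF T] xyzT(1,2)] by simp
  then have z: "zorn_mult T x y = z \<or> zorn_mult T x y = zneg T z"
    by (auto simp: sign_class_def)
  have aT: "a \<in> carrier T" "b \<in> carrier T" "a \<oplus>\<^bsub>S\<^esub> b \<in> carrier T"
    using a b loop_le_paige_carrier by auto
  define e where "e = \<one>\<^bsub>S\<^esub>"
  have e: "e = \<one>\<^bsub>T\<^esub> \<or> e = \<ominus>\<^bsub>T\<^esub> \<one>\<^bsub>T\<^esub>" "e \<in> carrier T" "e \<otimes>\<^bsub>T\<^esub> e = \<one>\<^bsub>T\<^esub>"
    using loop_le_paige_units(2) by (auto simp: e_def T.l_minus T.r_minus)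
  have xy: "zorn_mult T x y = Zorn \<one>\<^bsub>T\<^esub> (e \<otimes>\<^bsub>T\<^esub> (a \<oplus>\<^bsub>T\<^esub> b),\<zero>\<^bsub>T\<^esub>,\<zero>\<^bsub>T\<^esub>) (\<zero>\<^bsub>T\<^esub>,\<zero>\<^bsub>T\<^esub>,\<zero>\<^bsub>T\<^esub>) \<one>\<^bsub>T\<^esub>"
    using aT e(2,3) by (simp add: x_def y_def loop_le_paige_units(1) T.minus_eq e_def[symmetric] T.r_distr T.a_comm)
  have nz: "zneg T z = Zorn (\<ominus>\<^bsub>T\<^esub> e) (\<ominus>\<^bsub>T\<^esub> (a \<oplus>\<^bsub>S\<^esub> b),\<zero>\<^bsub>T\<^esub>,\<zero>\<^bsub>T\<^esub>) (\<zero>\<^bsub>T\<^esub>,\<zero>\<^bsub>T\<^esub>,\<zero>\<^bsub>T\<^esub>) (\<ominus>\<^bsub>T\<^esub> e)"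
    unfolding z_def loop_le_paige_units(1) e_def[symmetric] using aT e(2) by (simp add: zneg_eq[OF field_is_cring[OF T]])
  consider "e = \<one>\<^bsub>T\<^esub>" "e \<otimes>\<^bsub>T\<^esub> (a \<oplus>\<^bsub>T\<^esub> b) = a \<oplus>\<^bsub>S\<^esub> b"
    | "\<ominus>\<^bsub>T\<^esub> e = \<one>\<^bsub>T\<^esub>" "e \<otimes>\<^bsub>T\<^esub> (a \<oplus>\<^bsub>T\<^esub> b) = \<ominus>\<^bsub>T\<^esub> (a \<oplus>\<^bsub>S\<^esub> b)"
    using z unfolding xy nz unfolding z_def e_def[symmetric] zorn.inject prod.inject by argo
  then show ?thesis
  proof cases
    case 1 then show ?thesis using aT by simp
  next
    case 2
    then have "e = \<ominus>\<^bsub>T\<^esub> \<one>\<^bsub>T\<^esub>" using e(2) T.minus_minus by metis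
    then have "\<ominus>\<^bsub>T\<^esub> (a \<oplus>\<^bsub>T\<^esub> b) = \<ominus>\<^bsub>T\<^esub> (a \<oplus>\<^bsub>S\<^esub> b)" using 2(2) aT by (simp add: T.l_minus)
    then show ?thesis using aT by (metis T.a_closed T.minus_minus)
  qed
qed

lemma loop_le_paige_characteristic:
  "add_pow S (n::nat) \<one>\<^bsub>S\<^esub> = \<zero>\<^bsub>S\<^esub> \<longleftrightarrow> add_pow T n \<one>\<^bsub>T\<^esub> = \<zero>\<^bsub>T\<^esub>"
proof -
  interpret S: field S by (rule S)
  interpret T: field T by (rule T)
  have "add_pow S n \<one>\<^bsub>S\<^esub> = add_pow T n \<one>\<^bsub>S\<^esub>"
  proof (induction n)
    case (Suc n)
    have "add_pow S n \<one>\<^bsub>S\<^esub> \<oplus>\<^bsub>S\<^esub> \<one>\<^bsub>S\<^esub> = add_pow S n \<one>\<^bsub>S\<^esub> \<oplus>\<^bsub>T\<^esub> \<one>\<^bsub>S\<^esub>"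
      by (rule loop_le_paige_add) auto
    then show ?case by (simp add: Suc)
  qed (simp add: loop_le_paige_units(1))
  moreover have "add_pow T n (\<ominus>\<^bsub>T\<^esub> \<one>\<^bsub>T\<^esub>) = \<ominus>\<^bsub>T\<^esub> (add_pow T n \<one>\<^bsub>T\<^esub>)"
    by (induction n) (simp_all add: T.minus_add)
  ultimately show ?thesis
    using loop_le_paige_units by auto
qed

end

definition has_characteristic :: "('a, 'm) ring_scheme \<Rightarrow> nat \<Rightarrow> bool" where
  "has_characteristic R c \<longleftrightarrow> (\<forall>n::nat. add_pow R n \<one>\<^bsub>R\<^esub> = \<zero>\<^bsub>R\<^esub> \<longleftrightarrow> c dvd n)"

lemma has_characteristic_subfield: "has_characteristic (R\<lparr>carrier := F\<rparr>) c \<longleftrightarrow> has_characteristic R c"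
  by (simp add: has_characteristic_def add_pow_carrier_update)

lemma loop_le_paige_same_characteristic:
  fixes S T :: "'a ring"
  assumes "field S" "field T" "loop_le (paige_loop S) (paige_loop T)"
    and "has_characteristic S c" "has_characteristic T d"
  shows "c = d"
proof -
  have "c dvd n \<longleftrightarrow> d dvd n" for n
    using assms(4,5) loop_le_paige_characteristic[OF assms(1-3), of n] unfolding has_characteristic_def by simp
  from this[of c] this[of d] have "c dvd d" "d dvd c" by simp_all
  then show ?thesis by (rule dvd_antisym)
qed

lemma ring_iso_add_pow:
  assumes "ring R" "ring S" "h \<in> ring_iso R S"
  shows "h (add_pow R (n::nat) \<one>\<^bsub>R\<^esub>) = add_pow S n \<one>\<^bsub>S\<^esub>"
proof -
  interpret R: ring R by fact
  interpret S: ring S by fact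
  interpret ring_hom_ring R S h
    by (rule ring_hom_ringI2) (use assms in \<open>auto simp: ring_iso_def\<close>)
  show ?thesis by (induction n) simp_all
qed

lemma has_characteristic_prime_field:
  assumes "prime_field_of_char c K" shows "has_characteristic K c"
proof -
  interpret K: field K using assms by (simp add: prime_field_of_char_def)
  show ?thesis
  proof (cases "c = 0")
    case True
    let ?Q = "ring_of_type_algebra :: rat ring"
    obtain h where h: "h \<in> ring_iso K ?Q"
      using assms True by (auto simp: prime_field_of_char_def is_ring_iso_def)
    have pow: "add_pow ?Q (n::nat) 1 = of_nat n" for n
      by (induction n) (simp_all add: add_pow_def nat_pow_def ring_of_type_algebra_def)
    interpret Q: ring ?Q by (rule ring_from_type_algebra)
    have "h (add_pow K n \<one>\<^bsub>K\<^esub>) = of_nat n" for n :: nat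
      using ring_iso_add_pow[OF K.ring_axioms Q.ring_axioms h, of n] pow[of n] by (simp add: ring_of_type_algebra_def)
    moreover have "h \<zero>\<^bsub>K\<^esub> = 0"
      using ring_iso_add_pow[OF K.ring_axioms Q.ring_axioms h, of 0] pow[of 0] by (simp add: ring_of_type_algebra_def)
    moreover have "inj_on h (carrier K)" using h by (auto simp: ring_iso_def bij_betw_def)
    ultimately have "add_pow K n \<one>\<^bsub>K\<^esub> = \<zero>\<^bsub>K\<^esub> \<longleftrightarrow> n = 0" for n :: nat
      using inj_on_eq_iff[of h "carrier K" "add_pow K n \<one>\<^bsub>K\<^esub>" "\<zero>\<^bsub>K\<^esub>"] by simp
    then show ?thesis using True by (simp add: has_characteristic_def)
  next
    case False
    then obtain h where h: "h \<in> ring_iso K (residue_ring (int c))" and c: "prime c"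
      using assms by (auto simp: prime_field_of_char_def is_ring_iso_def)
    interpret Q: residues "int c" "residue_ring (int c)"
      using prime_gt_1_nat[OF c] by unfold_locales auto
    have ringZ: "ring (residue_ring (int c))"
      using Q.cring by (simp add: cring_def)
    have pow: "add_pow (residue_ring (int c)) (n::nat) 1 = int n mod int c" for n
    proof (induction n)
      case (Suc n)
      have "add_pow (residue_ring (int c)) (Suc n) 1 = (add_pow (residue_ring (int c)) n 1 + 1) mod int c"
        by (simp add: add_pow_def nat_pow_def residue_ring_def)
      then show ?case unfolding Suc by (simp add: mod_add_right_eq add.commute)
    qed (simp add: add_pow_def nat_pow_def residue_ring_def)
    have "h (add_pow K n \<one>\<^bsub>K\<^esub>) = int n mod int c" for n :: nat
      using ring_iso_add_pow[OF K.ring_axioms ringZ h, of n] pow[of n] by (simp add: residue_ring_def)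
    moreover have "h \<zero>\<^bsub>K\<^esub> = 0"
      using ring_iso_add_pow[OF K.ring_axioms ringZ h, of 0] pow[of 0] by (simp add: residue_ring_def)
    moreover have "inj_on h (carrier K)" using h by (auto simp: ring_iso_def bij_betw_def)
    ultimately have "add_pow K n \<one>\<^bsub>K\<^esub> = \<zero>\<^bsub>K\<^esub> \<longleftrightarrow> int n mod int c = 0" for n :: nat
      using inj_on_eq_iff[of h "carrier K" "add_pow K n \<one>\<^bsub>K\<^esub>" "\<zero>\<^bsub>K\<^esub>"] by simp
    then show ?thesis
      unfolding has_characteristic_def by (simp only: dvd_eq_mod_eq_0[symmetric] int_dvd_int_iff simp_thms)
  qed
qed

section \<open>Torsion elements without roots\<close>

fun zpow :: "'b::comm_ring_1 zorn \<Rightarrow> nat \<Rightarrow> 'b zorn" where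
  "zpow x 0 = zsc 1"
| "zpow x (Suc n) = zmul (zpow x n) x"

fun zlin :: "'b::comm_ring_1 \<Rightarrow> 'b \<Rightarrow> 'b zorn \<Rightarrow> 'b zorn" where
  "zlin c d (Zorn a (u1,u2,u3) (v1,v2,v3) b) =
     Zorn (c + d*a) (d*u1, d*u2, d*u3) (d*v1, d*v2, d*v3) (c + d*b)"

lemma zlin_0: "zlin c 0 x = zsc c" "zlin 0 1 x = x"
  by (cases x rule: zorn_coordinates; simp add: zsc_def)+

lemma zmul_zlin:
  "zmul (zlin c d x) (zlin c' d' x) =
    zlin (c*c' - d*d'*znorm x) (c*d' + d*c' + d*d'*ztr x) x"
  by (cases x rule: zorn_coordinates) (simp add: algebra_simps)

lemma znorm_zlin: "znorm (zlin c d x) = c*c + c*d*ztr x + d*d*znorm x"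
  by (cases x rule: zorn_coordinates) (simp add: algebra_simps)

text \<open>Powers stay in the span of \<open>1\<close> and \<open>x\<close>, and are computed by evaluation at the eigenvalues
of \<open>x\<close>, the roots of \<open>l l = tr(x) l - 1\<close>.\<close>

lemma zpow_zlin:
  assumes "znorm x = 1"
  shows "\<exists>c d. zpow (zlin a b x) n = zlin c d x \<and>
    (\<forall>l. l*l = ztr x * l - 1 \<longrightarrow> c + d*l = (a + b*l)^n)"
proof (induction n)
  case 0
  show ?case by (rule exI[of _ 1], rule exI[of _ 0]) (simp add: zlin_0)
next
  case (Suc n)
  then obtain c d where cd: "zpow (zlin a b x) n = zlin c d x"
    "\<And>l. l*l = ztr x * l - 1 \<Longrightarrow> c + d*l = (a + b*l)^n"
    by blast
  have "(c*a - d*b) + (c*b + d*a + d*b*ztr x)*l = (a + b*l)^(Suc n)" if l: "l*l = ztr x * l - 1" for l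
  proof -
    have "(c*a - d*b) + (c*b + d*a + d*b*ztr x)*l = c*a + (c*b + d*a)*l + d*b*(ztr x * l - 1)"
      by (simp add: algebra_simps)
    also have "\<dots> = (c + d*l)*(a + b*l)"
      unfolding l[symmetric] by (simp add: algebra_simps)
    finally show ?thesis unfolding cd(2)[OF l] by (simp add: mult.commute)
  qed
  moreover have "zpow (zlin a b x) (Suc n) = zlin (c*a - d*b) (c*b + d*a + d*b*ztr x) x"
    by (simp add: cd zmul_zlin assms)
  ultimately show ?case by blast
qed

text \<open>The case of the double eigenvalue \<open>e\<close>, where evaluation does not determine the coefficients.\<close>

lemma zpow_parabolic:
  assumes "znorm x = 1" and e: "e * e = 1" and t: "ztr x = e + e"
  shows "\<exists>c d. zpow x n = zlin c d x \<and> d = of_nat n * (e^n * e) \<and> c + d*e = e^n"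
proof (induction n)
  case 0
  show ?case by (rule exI[of _ 1], rule exI[of _ 0]) (simp add: zlin_0)
next
  case (Suc n)
  then obtain c d where cd: "zpow x n = zlin c d x" "d = of_nat n * (e^n * e)" "c + d*e = e^n"
    by blast
  have step: "zpow x (Suc n) = zlin (-d) (c + d*(e+e)) x"
    using zmul_zlin[of c d x 0 1] by (simp add: cd(1) zlin_0 assms(1) t)
  have c: "c = e^n - d*e" using cd(3) by (simp add: algebra_simps)
  have 1: "e^n = e^(Suc n) * e" by (simp only: power_Suc2 mult.assoc e mult_1_right)
  have "c + d*(e+e) = e^n + d*e" unfolding c by (simp add: algebra_simps)
  also have "d*e = of_nat n * e^n" by (simp only: cd(2) mult.assoc e mult_1_right)
  finally have d': "c + d*(e+e) = of_nat (Suc n) * (e^(Suc n) * e)"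
    unfolding 1[symmetric] by (simp add: algebra_simps)
  have "-d + (c + d*(e+e))*e = -d + (e^n * e + d*(e*e))" unfolding c by (simp add: algebra_simps)
  then have "-d + (c + d*(e+e))*e = e^(Suc n)" using e by (simp add: mult.commute)
  then show ?case using step d' by blast
qed

lemma zpow_unipotent:
  assumes "a * a = 1"
  shows "\<exists>c. zpow (Zorn a (u,0,0) (0,0,0) a) n = Zorn (a^n) (c,0,0) (0,0,0) (a^n) \<and> c * a = of_nat n * (a^n * u)"
proof (induction n)
  case (Suc n)
  then obtain c where c: "zpow (Zorn a (u,0,0) (0,0,0) a) n = Zorn (a^n) (c,0,0) (0,0,0) (a^n)"
    "c * a = of_nat n * (a^n * u)" by blast
  have "(a^n*u + a*c)*a = a^n*u*a + a*(c*a)" by (simp add: algebra_simps)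
  also have "\<dots> = of_nat (Suc n) * (a^(Suc n) * u)" unfolding c(2) by (simp add: algebra_simps)
  finally show ?case
    by (intro exI[of _ "a^n*u + a*c"]) (simp add: c(1) mult.commute)
qed (simp add: zsc_def)

text \<open>An isomorphism invariant of loops that detects the characteristic of an algebraically closed field in
its Paige loop.\<close>

definition has_rootless_torsion :: "nat \<Rightarrow> ('a, 'm) monoid_scheme \<Rightarrow> bool" where
  "has_rootless_torsion p L \<longleftrightarrow> (\<exists>x\<in>carrier L. x \<noteq> \<one>\<^bsub>L\<^esub> \<and> x [^]\<^bsub>L\<^esub> p = \<one>\<^bsub>L\<^esub> \<and>
     (\<forall>y\<in>carrier L. y [^]\<^bsub>L\<^esub> p \<noteq> x))"

lemma loop_iso_rootless_torsion:
  assumes "loop K" "loop L" and h: "h \<in> iso K L"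
  shows "has_rootless_torsion p K \<longleftrightarrow> has_rootless_torsion p L"
proof -
  interpret K: loop K by fact
  interpret L: loop L by fact
  have mult: "h (x \<otimes>\<^bsub>K\<^esub> y) = h x \<otimes>\<^bsub>L\<^esub> h y" and hc: "h x \<in> carrier L"
    if "x \<in> carrier K" "y \<in> carrier K" for x y
    using h that by (auto simp: iso_def hom_def)
  have bij: "bij_betw h (carrier K) (carrier L)" using h by (simp add: iso_def)
  have inj: "h x = h y \<longleftrightarrow> x = y" if "x \<in> carrier K" "y \<in> carrier K" for x y
    using inj_on_eq_iff[of h "carrier K" x y] bij that by (simp add: bij_betw_def)
  have img: "carrier L = h ` carrier K" using bij by (simp add: bij_betw_def)
  have one: "h \<one>\<^bsub>K\<^esub> = \<one>\<^bsub>L\<^esub>"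
  proof -
    let ?e = "h \<one>\<^bsub>K\<^esub>"
    have "?e \<in> carrier L" "?e \<otimes>\<^bsub>L\<^esub> ?e = ?e"
      using hc mult K.one_closed K.l_one by (simp_all flip: mult)
    then show ?thesis using L.l_div[of ?e ?e] L.r_one[of ?e] L.one_closed by blast
  qed
  have cl: "x [^]\<^bsub>K\<^esub> n \<in> carrier K" if "x \<in> carrier K" for x and n :: nat
    by (induction n) (use that K.one_closed K.m_closed in \<open>simp_all add: nat_pow_def\<close>)
  have pow: "h (x [^]\<^bsub>K\<^esub> n) = h x [^]\<^bsub>L\<^esub> n" if "x \<in> carrier K" for x and n :: nat
  proof (induction n)
    case (Suc n)
    have "h (x [^]\<^bsub>K\<^esub> Suc n) = h (x [^]\<^bsub>K\<^esub> n) \<otimes>\<^bsub>L\<^esub> h x"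
      using mult[OF cl[OF that] that] by (simp add: nat_pow_def)
    then show ?case unfolding Suc by (simp add: nat_pow_def)
  qed (simp add: nat_pow_def one)
  have 1: "h x \<noteq> \<one>\<^bsub>L\<^esub> \<longleftrightarrow> x \<noteq> \<one>\<^bsub>K\<^esub>" if "x \<in> carrier K" for x
    using inj[OF that K.one_closed] one by simp
  have 2: "h x [^]\<^bsub>L\<^esub> p = \<one>\<^bsub>L\<^esub> \<longleftrightarrow> x [^]\<^bsub>K\<^esub> p = \<one>\<^bsub>K\<^esub>" if "x \<in> carrier K" for x
    using inj[OF cl[OF that] K.one_closed] one pow[OF that] by simp
  have 3: "h y [^]\<^bsub>L\<^esub> p \<noteq> h x \<longleftrightarrow> y [^]\<^bsub>K\<^esub> p \<noteq> x" if "x \<in> carrier K" "y \<in> carrier K" for x y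
    using inj[OF cl[OF that(2)] that(1)] pow[OF that(2)] by simp
  show ?thesis
    unfolding has_rootless_torsion_def img bex_simps ball_simps
    by (intro bex_cong[OF HOL.refl] conj_cong[OF 1] conj_cong[OF 2] ball_cong[OF HOL.refl]) (auto simp: 1 2 3)
qed

context
  fixes R :: "'a ring"
  assumes field: "field R"
begin

lemma component_pow: "component R (t ^ n) = component R t [^]\<^bsub>R\<^esub> n"
proof -
  interpret field R by (rule field)
  show ?thesis
    by (induction n) (simp_all add: component_hom[OF field_is_cring[OF field]] component_closed[OF field_is_cring[OF field]] m_comm)
qed

lemma component_of_nat: "component R (of_nat n) = add_pow R n \<one>\<^bsub>R\<^esub>"
proof -
  interpret field R by (rule field)
  show ?thesis
    by (induction n) (simp_all add: component_hom[OF field_is_cring[OF field]] a_comm)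
qed

lemma put_pow: "a \<in> carrier R \<Longrightarrow> put R 1 a ^ n = put R 1 (a [^]\<^bsub>R\<^esub> n)"
proof -
  interpret field R by (rule field)
  assume "a \<in> carrier R"
  then show ?thesis
    by (induction n) (simp_all add: put_one[OF field_is_cring[OF field]] put_hom[OF field_is_cring[OF field]] m_comm)
qed

lemma sign_class_pow:
  assumes "znorm t = 1"
  shows "sign_class R (zcomponent R t) [^]\<^bsub>paige_loop R\<^esub> n = sign_class R (zcomponent R (zpow t n))"
proof (induction n)
  case 0
  then show ?case
    by (simp add: nat_pow_def one_paige_loop[OF field_is_cring[OF field]] zcomponent_zsc[OF field_is_cring[OF field]]
      component_hom[OF field_is_cring[OF field]])
next
  case (Suc n)
  then show ?case
    by (simp add: nat_pow_def sign_class_mult[OF field_is_cring[OF field]] zcomponent_mem[OF field_is_cring[OF field]]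
      zcomponent_zmul[OF field_is_cring[OF field]])
qed

lemma one_paige_component: "\<one>\<^bsub>paige_loop R\<^esub> = sign_class R (zcomponent R (zsc 1))"
  by (simp add: one_paige_loop[OF field_is_cring[OF field]] zcomponent_zsc[OF field_is_cring[OF field]]
      component_hom[OF field_is_cring[OF field]])

text \<open>The upper root element \<open>x\<close> with entry \<open>1\<close> has this property. If \<open>y\<close> is a root, then
\<open>x\<close> lies in the span of \<open>1\<close> and \<open>y\<close>, and so \<open>y\<close> is a unitriangular matrix up to sign, whose
\<open>p\<close>-th power is a sign.\<close>

theorem has_rootless_torsion_char:
  assumes p: "add_pow R p \<one>\<^bsub>R\<^esub> = \<zero>\<^bsub>R\<^esub>"
  shows "has_rootless_torsion p (paige_loop R)"
proof -
  interpret field R by (rule field)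
  note R = field_is_cring[OF field]
  note comp = component_hom[OF R]
  let ?c = "zcomponent R"
  define x :: "'a all_crings zorn" where "x = Zorn 1 (1,0,0) (0,0,0) 1"
  have nx: "znorm x = 1" by (simp add: x_def)
  have cx: "?c x = Zorn \<one>\<^bsub>R\<^esub> (\<one>\<^bsub>R\<^esub>,\<zero>\<^bsub>R\<^esub>,\<zero>\<^bsub>R\<^esub>) (\<zero>\<^bsub>R\<^esub>,\<zero>\<^bsub>R\<^esub>,\<zero>\<^bsub>R\<^esub>) \<one>\<^bsub>R\<^esub>" by (simp add: x_def comp)
  have "?c (zpow x p) = ?c (zsc 1)"
  proof -
    obtain c where c: "zpow x p = Zorn (1^p) (c,0,0) (0,0,0) (1^p)" "c * 1 = of_nat p * (1^p * 1)"
      using zpow_unipotent[of 1 1 p] unfolding x_def by auto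
    have "component R c = \<zero>\<^bsub>R\<^esub>" using c(2) p by (simp add: component_of_nat)
    then show ?thesis unfolding c(1) by (simp add: comp zsc_def)
  qed
  then have "sign_class R (?c x) [^]\<^bsub>paige_loop R\<^esub> p = \<one>\<^bsub>paige_loop R\<^esub>"
    by (simp add: sign_class_pow[OF nx] one_paige_component)
  moreover have "sign_class R (?c x) \<noteq> \<one>\<^bsub>paige_loop R\<^esub>"
  proof
    assume "sign_class R (?c x) = \<one>\<^bsub>paige_loop R\<^esub>"
    then have "?c x = ?c (zsc 1) \<or> ?c x = ?c (zmul (zsc (-1)) (zsc 1))"
      unfolding one_paige_component zcomponent_zneg[OF R, symmetric]
      by (simp add: sign_class_eq_iff[OF R] zcomponent_mem[OF R])
    then show False unfolding cx by (auto simp: zsc_def comp)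
  qed
  moreover have "y [^]\<^bsub>paige_loop R\<^esub> p \<noteq> sign_class R (?c x)" if y: "y \<in> carrier (paige_loop R)" for y
  proof
    assume yp: "y [^]\<^bsub>paige_loop R\<^esub> p = sign_class R (?c x)"
    obtain w where w: "y = sign_class R w" "w \<in> carrier (unit_zorn_loop R)" "w \<in> zorn_set R"
      using paige_carrierE[OF R y] .
    have pow_w: "?c (zpow t p) = ?c x \<or> ?c (zpow t p) = zneg R (?c x)" if "znorm t = 1" "?c t = w" for t
    proof -
      have "sign_class R (?c (zpow t p)) = sign_class R (?c x)"
        using yp unfolding w(1) that(2)[symmetric] sign_class_pow[OF that(1)] .
      then show ?thesis by (simp only: sign_class_eq_iff[OF R zcomponent_mem[OF R] zcomponent_mem[OF R]])
    qed
    obtain t where t: "w = ?c t" "znorm t = 1" using lift_unit_zorn[OF R w(2)] .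
    obtain a u1 u2 u3 v1 v2 v3 b where eq: "t = Zorn a (u1,u2,u3) (v1,v2,v3) b" by (rule zorn_coordinates)
    obtain c d where cd: "zpow t p = zlin c d t"
      using zpow_zlin[OF t(2), of 0 1 p] unfolding zlin_0 by blast
    define e where "e = (if ?c (zpow t p) = ?c x then \<one>\<^bsub>R\<^esub> else \<ominus>\<^bsub>R\<^esub> \<one>\<^bsub>R\<^esub>)"
    have e: "e \<in> carrier R" "e \<noteq> \<zero>\<^bsub>R\<^esub>" by (auto simp: e_def)
    have "?c (zpow t p) = Zorn e (e,\<zero>\<^bsub>R\<^esub>,\<zero>\<^bsub>R\<^esub>) (\<zero>\<^bsub>R\<^esub>,\<zero>\<^bsub>R\<^esub>,\<zero>\<^bsub>R\<^esub>) e"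
      using pow_w[OF t(2) t(1)[symmetric]] zneg_eq[OF R, of "\<one>\<^bsub>R\<^esub>" "\<one>\<^bsub>R\<^esub>" "\<zero>\<^bsub>R\<^esub>" "\<zero>\<^bsub>R\<^esub>" "\<zero>\<^bsub>R\<^esub>" "\<zero>\<^bsub>R\<^esub>" "\<zero>\<^bsub>R\<^esub>" "\<one>\<^bsub>R\<^esub>"]
      unfolding e_def cx by auto
    note eqs = this[unfolded cd, unfolded eq zlin.simps zcomponent.simps comp zorn.inject prod.inject]
    let ?k = "component R"
    note [simp] = component_closed[OF R]
    have kd: "?k d \<noteq> \<zero>\<^bsub>R\<^esub>" using eqs e by auto
    have zero: "?k u2 = \<zero>\<^bsub>R\<^esub>" "?k u3 = \<zero>\<^bsub>R\<^esub>" "?k v1 = \<zero>\<^bsub>R\<^esub>" "?k v2 = \<zero>\<^bsub>R\<^esub>" "?k v3 = \<zero>\<^bsub>R\<^esub>"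
      using eqs kd by (simp_all add: integral_iff)
    have "?k c \<oplus>\<^bsub>R\<^esub> ?k d \<otimes>\<^bsub>R\<^esub> ?k a = ?k c \<oplus>\<^bsub>R\<^esub> ?k d \<otimes>\<^bsub>R\<^esub> ?k b" using eqs by simp
    then have "?k d \<otimes>\<^bsub>R\<^esub> ?k a = ?k d \<otimes>\<^bsub>R\<^esub> ?k b" by (simp only: add.l_cancel component_closed[OF R] m_closed)
    then have ab: "?k b = ?k a" using kd m_lcancel[OF kd] by simp
    have w_eq: "w = Zorn (?k a) (?k u1,\<zero>\<^bsub>R\<^esub>,\<zero>\<^bsub>R\<^esub>) (\<zero>\<^bsub>R\<^esub>,\<zero>\<^bsub>R\<^esub>,\<zero>\<^bsub>R\<^esub>) (?k a)"
      unfolding t(1) eq by (simp add: zero ab)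
    have aa: "?k a \<otimes>\<^bsub>R\<^esub> ?k a = \<one>\<^bsub>R\<^esub>"
      using w(2) unfolding w_eq by (simp add: carrier_unit_zorn_loop[OF R] minus_eq)
    \<comment> \<open>a lift of \<open>w\<close> whose diagonal entries agree and have square \<open>1\<close> in all components\<close>
    define A where "A = put R 1 (?k a)"
    have A: "A * A = 1" "?k A = ?k a"
      unfolding A_def by (simp_all add: put_hom[OF R] aa put_one[OF R] component_put[OF R])
    let ?s = "Zorn A (u1,0,0) (0,0,0) A"
    have s: "znorm ?s = 1" "?c ?s = w" using A by (simp_all add: w_eq comp)
    obtain C where C: "zpow ?s p = Zorn (A^p) (C,0,0) (0,0,0) (A^p)" "C * A = of_nat p * (A^p * u1)"
      using zpow_unipotent[OF A(1), of u1 p] by blast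
    have "?k C \<otimes>\<^bsub>R\<^esub> ?k a = \<zero>\<^bsub>R\<^esub>"
      using arg_cong[OF C(2), of ?k] by (simp add: comp component_of_nat p A(2))
    moreover have "?k a \<noteq> \<zero>\<^bsub>R\<^esub>" using aa by auto
    ultimately have "?k C = \<zero>\<^bsub>R\<^esub>" by (simp add: integral_iff)
    moreover have "\<zero>\<^bsub>R\<^esub> \<noteq> \<ominus>\<^bsub>R\<^esub> \<one>\<^bsub>R\<^esub>" 
      using r_neg[OF one_closed] r_zero[OF one_closed] one_not_zero by metis
    ultimately show False
      using pow_w[OF s] zneg_eq[OF R, of "\<one>\<^bsub>R\<^esub>" "\<one>\<^bsub>R\<^esub>" "\<zero>\<^bsub>R\<^esub>" "\<zero>\<^bsub>R\<^esub>" "\<zero>\<^bsub>R\<^esub>" "\<zero>\<^bsub>R\<^esub>" "\<zero>\<^bsub>R\<^esub>" "\<one>\<^bsub>R\<^esub>"]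
      unfolding C(1) cx by (auto simp: comp)
  qed
  ultimately show ?thesis
    unfolding has_rootless_torsion_def
    by (intro bexI[of _ "sign_class R (?c x)"] conjI ballI sign_class_mem[OF R] zcomponent_unit[OF R nx])
qed

text \<open>An element of exponent \<open>p\<close> with a double eigenvalue is trivial, because it occurs
in its \<open>p\<close>-th power with a coefficient that is \<open>p\<close> times a unit, and that power is a scalar. If the eigenvalues \<open>l\<close> and \<open>m\<close>
are different, a root is obtained by interpolation: it is the combination of \<open>1\<close> and the
element whose eigenvalues are \<open>p\<close>-th roots of \<open>l\<close> and \<open>m\<close>.\<close>

theorem not_has_rootless_torsion:
  assumes roots: "\<And>q. q \<in> carrier (poly_ring R) \<Longrightarrow> ring.splitted R q"
    and p: "add_pow R p \<one>\<^bsub>R\<^esub> \<noteq> \<zero>\<^bsub>R\<^esub>"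
  shows "\<not> has_rootless_torsion p (paige_loop R)"
proof
  interpret field R by (rule field)
  note R = field_is_cring[OF field]
  note comp = component_hom[OF R]
  note [simp] = component_closed[OF R]
  let ?c = "zcomponent R" and ?k = "component R"
  have root: "\<exists>x\<in>carrier R. eval q x = \<zero>\<^bsub>R\<^esub>" if q: "set q \<subseteq> carrier R" "hd q = \<one>\<^bsub>R\<^esub>" "length q > 1" for q
  proof -
    have qc: "q \<in> carrier (poly_ring R)"
      using q unfolding univ_poly_carrier[symmetric] polynomial_def by simp
    have "size (roots q) > 0" using roots[OF qc] q(3) by (simp add: splitted_def)
    then obtain x where "x \<in># roots q" by (metis multiset_nonemptyE size_empty less_irrefl)
    then show ?thesis using roots_mem_iff_is_root[OF qc] by (auto simp: is_root_def)
  qed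
  have p0: "p > 0" using p by (intro gr0I) simp
  assume "has_rootless_torsion p (paige_loop R)"
  then obtain x where x: "x \<in> carrier (paige_loop R)" "x \<noteq> \<one>\<^bsub>paige_loop R\<^esub>" "x [^]\<^bsub>paige_loop R\<^esub> p = \<one>\<^bsub>paige_loop R\<^esub>"
    and no_root: "\<And>y. y \<in> carrier (paige_loop R) \<Longrightarrow> y [^]\<^bsub>paige_loop R\<^esub> p \<noteq> x"
    by (auto simp: has_rootless_torsion_def)
  obtain w where w: "x = sign_class R w" "w \<in> carrier (unit_zorn_loop R)" "w \<in> zorn_set R"
    using paige_carrierE[OF R x(1)] .
  define t where "t = zput R (zsc 1) w"
  have t: "znorm t = 1" "?c t = w"
    using znorm_zput_1[OF R w(2), of "zsc 1"] zcomponent_zput[OF R w(3)] by (simp_all add: t_def)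
  obtain a u1 u2 u3 v1 v2 v3 b where eq: "w = Zorn a (u1,u2,u3) (v1,v2,v3) b" by (rule zorn_coordinates)
  have cl: "a \<in> carrier R" "b \<in> carrier R" "u1 \<in> carrier R" "u2 \<in> carrier R" "u3 \<in> carrier R"
    "v1 \<in> carrier R" "v2 \<in> carrier R" "v3 \<in> carrier R"
    using w(3) unfolding eq by simp_all
  define s where "s = a \<oplus>\<^bsub>R\<^esub> b"
  have s: "s \<in> carrier R" using cl by (simp add: s_def)
  have tr: "ztr t = put R (1 + 1) s"
    unfolding t_def eq s_def zsc_def using cl by (simp add: put_hom[OF R])
  \<comment> \<open>the eigenvalues \<open>l\<close> and \<open>m\<close>\<close>
  obtain l where l: "l \<in> carrier R" "eval [\<one>\<^bsub>R\<^esub>, \<ominus>\<^bsub>R\<^esub> s, \<one>\<^bsub>R\<^esub>] l = \<zero>\<^bsub>R\<^esub>"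
    using root[of "[\<one>\<^bsub>R\<^esub>, \<ominus>\<^bsub>R\<^esub> s, \<one>\<^bsub>R\<^esub>]"] s by auto
  define m where "m = \<ominus>\<^bsub>R\<^esub> l \<oplus>\<^bsub>R\<^esub> s"
  have m: "m \<in> carrier R" "l \<oplus>\<^bsub>R\<^esub> m = s"
    using l s by (simp_all add: m_def r_neg2)
  have "l \<otimes>\<^bsub>R\<^esub> l \<oplus>\<^bsub>R\<^esub> (\<ominus>\<^bsub>R\<^esub> s \<otimes>\<^bsub>R\<^esub> l \<oplus>\<^bsub>R\<^esub> \<one>\<^bsub>R\<^esub>) = \<zero>\<^bsub>R\<^esub>"
    using l s by (simp add: numeral_2_eq_2)
  then have lm: "l \<otimes>\<^bsub>R\<^esub> m = \<one>\<^bsub>R\<^esub>"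
  proof -
    assume eq0: "l \<otimes>\<^bsub>R\<^esub> l \<oplus>\<^bsub>R\<^esub> (\<ominus>\<^bsub>R\<^esub> s \<otimes>\<^bsub>R\<^esub> l \<oplus>\<^bsub>R\<^esub> \<one>\<^bsub>R\<^esub>) = \<zero>\<^bsub>R\<^esub>"
    have "\<ominus>\<^bsub>R\<^esub> s \<otimes>\<^bsub>R\<^esub> l = \<ominus>\<^bsub>R\<^esub> (l \<otimes>\<^bsub>R\<^esub> l) \<oplus>\<^bsub>R\<^esub> \<ominus>\<^bsub>R\<^esub> (l \<otimes>\<^bsub>R\<^esub> m)"
      unfolding m(2)[symmetric] using l m(1) by (simp add: l_minus l_distr minus_add m_comm[of m l])
    then have "\<ominus>\<^bsub>R\<^esub> (l \<otimes>\<^bsub>R\<^esub> m) \<oplus>\<^bsub>R\<^esub> \<one>\<^bsub>R\<^esub> = \<zero>\<^bsub>R\<^esub>"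
      using eq0 l m(1) by (simp add: a_assoc r_neg2)
    then have "\<one>\<^bsub>R\<^esub> \<ominus>\<^bsub>R\<^esub> l \<otimes>\<^bsub>R\<^esub> m = \<zero>\<^bsub>R\<^esub>"
      using a_comm[of "\<ominus>\<^bsub>R\<^esub> (l \<otimes>\<^bsub>R\<^esub> m)" "\<one>\<^bsub>R\<^esub>"] l m(1) by (simp add: minus_eq)
    then show ?thesis using l m(1) by (simp add: r_right_minus_eq)
  qed
  show False
  proof (cases "l = m")
    case True
    define e where "e = put R 1 l"
    have e: "e * e = 1" "ztr t = e + e" "?k e = l"
      using lm l m True by (simp_all add: e_def put_hom[OF R] put_one[OF R] tr component_put[OF R])
    obtain c d where cd: "zpow t p = zlin c d t" "d = of_nat p * (e^p * e)"
      using zpow_parabolic[OF t(1) e(1,2), of p] by blast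
    have "l \<noteq> \<zero>\<^bsub>R\<^esub>" using lm m by auto
    then have "l [^]\<^bsub>R\<^esub> p \<noteq> \<zero>\<^bsub>R\<^esub>" using l(1) by (induction p) (auto simp: integral_iff)
    then have kd: "?k d \<noteq> \<zero>\<^bsub>R\<^esub>"
      unfolding cd(2) comp component_of_nat component_pow e(3)
      using p \<open>l \<noteq> \<zero>\<^bsub>R\<^esub>\<close> l(1) by (simp add: integral_iff)
    have "sign_class R (?c (zpow t p)) = sign_class R (?c (zsc 1))"
      using x(3) unfolding w(1) t(2)[symmetric] sign_class_pow[OF t(1)] one_paige_component .
    then have "?c (zpow t p) = ?c (zsc 1) \<or> ?c (zpow t p) = ?c (zmul (zsc (-1)) (zsc 1))"
      unfolding zcomponent_zneg[OF R, symmetric]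
      by (simp only: sign_class_eq_iff[OF R zcomponent_mem[OF R] zcomponent_mem[OF R]])
    then obtain r where "?c (zpow t p) = ?c (zsc r)" by (auto simp: zsc_def)
    moreover obtain a' u1' u2' u3' v1' v2' v3' b' where t': "t = Zorn a' (u1',u2',u3') (v1',v2',v3') b'"
      by (rule zorn_coordinates)
    ultimately have eqs: "?c (zlin c d (Zorn a' (u1',u2',u3') (v1',v2',v3') b')) = ?c (zsc r)"
      unfolding cd(1) by simp
    note eqs = eqs[unfolded zlin.simps zsc_def zcomponent.simps comp zorn.inject prod.inject]
    have w': "a = ?k a'" "b = ?k b'" "u1 = ?k u1'" "u2 = ?k u2'" "u3 = ?k u3'" "v1 = ?k v1'" "v2 = ?k v2'" "v3 = ?k v3'"
      using t(2) unfolding t' eq by simp_all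
    have zero: "u1 = \<zero>\<^bsub>R\<^esub>" "u2 = \<zero>\<^bsub>R\<^esub>" "u3 = \<zero>\<^bsub>R\<^esub>" "v1 = \<zero>\<^bsub>R\<^esub>" "v2 = \<zero>\<^bsub>R\<^esub>" "v3 = \<zero>\<^bsub>R\<^esub>"
      unfolding w' using eqs kd by (simp_all add: integral_iff)
    have "?k c \<oplus>\<^bsub>R\<^esub> ?k d \<otimes>\<^bsub>R\<^esub> a = ?k c \<oplus>\<^bsub>R\<^esub> ?k d \<otimes>\<^bsub>R\<^esub> b" unfolding w' using eqs by simp
    then have "?k d \<otimes>\<^bsub>R\<^esub> a = ?k d \<otimes>\<^bsub>R\<^esub> b" using cl by (simp only: add.l_cancel component_closed[OF R] m_closed)
    then have ab: "b = a" using kd m_lcancel[OF kd] cl by simp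
    have "a \<otimes>\<^bsub>R\<^esub> a = \<one>\<^bsub>R\<^esub>"
      using w(2) cl unfolding eq zero ab by (simp add: carrier_unit_zorn_loop[OF R] minus_eq)
    then have "a = \<one>\<^bsub>R\<^esub> \<or> a = \<ominus>\<^bsub>R\<^esub> \<one>\<^bsub>R\<^esub>" using square_eq_one cl by blast
    then have "w = ?c (zsc 1) \<or> w = zneg R (?c (zsc 1))"
      unfolding eq zero ab zcomponent_zneg[OF R] by (auto simp: zsc_def comp)
    then have "x = \<one>\<^bsub>paige_loop R\<^esub>"
      unfolding w(1) one_paige_component
      by (simp only: sign_class_eq_iff[OF R w(3) zcomponent_mem[OF R]])
    then show False using x(2) by blast
  next
    case False
    have "set ((monom \<one>\<^bsub>R\<^esub> (p - 1)) @ [\<ominus>\<^bsub>R\<^esub> l]) \<subseteq> carrier R" "hd ((monom \<one>\<^bsub>R\<^esub> (p - 1)) @ [\<ominus>\<^bsub>R\<^esub> l]) = \<one>\<^bsub>R\<^esub>"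
      "length ((monom \<one>\<^bsub>R\<^esub> (p - 1)) @ [\<ominus>\<^bsub>R\<^esub> l]) > 1"
      using l by (auto simp: monom_def)
    then obtain n where n: "n \<in> carrier R" "eval ((monom \<one>\<^bsub>R\<^esub> (p - 1)) @ [\<ominus>\<^bsub>R\<^esub> l]) n = \<zero>\<^bsub>R\<^esub>"
      using root by blast
    have mc: "set (monom \<one>\<^bsub>R\<^esub> (p - 1)) \<subseteq> carrier R" by (simp add: monom_in_carrier)
    have "n [^]\<^bsub>R\<^esub> (p - 1) \<otimes>\<^bsub>R\<^esub> n \<oplus>\<^bsub>R\<^esub> \<ominus>\<^bsub>R\<^esub> l = \<zero>\<^bsub>R\<^esub>"
      using n(2) eval_append_aux[OF mc, of "\<ominus>\<^bsub>R\<^esub> l" n] eval_monom[of "\<one>\<^bsub>R\<^esub>" n "p - 1"] l(1) n(1) by simp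
    then have np1: "n [^]\<^bsub>R\<^esub> (p - 1) \<otimes>\<^bsub>R\<^esub> n = l"
      using r_right_minus_eq[of "n [^]\<^bsub>R\<^esub> (p - 1) \<otimes>\<^bsub>R\<^esub> n" l] l n by (simp add: minus_eq)
    have "p = Suc (p - 1)" using p0 by simp
    then have np: "n [^]\<^bsub>R\<^esub> p = l" using np1 nat_pow_Suc by metis
    have l0: "l \<noteq> \<zero>\<^bsub>R\<^esub>" using lm m by auto
    have "n \<noteq> \<zero>\<^bsub>R\<^esub>" using np1 l0 n(1) by auto
    define n' where "n' = inv\<^bsub>R\<^esub> n"
    have n': "n' \<in> carrier R" "n \<otimes>\<^bsub>R\<^esub> n' = \<one>\<^bsub>R\<^esub>"
      using n(1) \<open>n \<noteq> \<zero>\<^bsub>R\<^esub>\<close> field_Units unfolding n'_def by auto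
    have "l \<otimes>\<^bsub>R\<^esub> (n' [^]\<^bsub>R\<^esub> p) = \<one>\<^bsub>R\<^esub>"
      unfolding np[symmetric] using n n' by (simp flip: nat_pow_distrib)
    then have n'p: "n' [^]\<^bsub>R\<^esub> p = m"
      using lm m_lcancel[OF l0 l(1), of "n' [^]\<^bsub>R\<^esub> p" m] m(1) n'(1) by simp
    define d where "d = (n \<ominus>\<^bsub>R\<^esub> n') \<otimes>\<^bsub>R\<^esub> inv\<^bsub>R\<^esub> (l \<ominus>\<^bsub>R\<^esub> m)"
    have dlm: "d \<in> carrier R" "d \<otimes>\<^bsub>R\<^esub> (l \<ominus>\<^bsub>R\<^esub> m) = n \<ominus>\<^bsub>R\<^esub> n'"
    proof -
      have "l \<ominus>\<^bsub>R\<^esub> m \<in> Units R" using False l m by (simp add: field_Units)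
      then show "d \<in> carrier R" "d \<otimes>\<^bsub>R\<^esub> (l \<ominus>\<^bsub>R\<^esub> m) = n \<ominus>\<^bsub>R\<^esub> n'"
        using n(1) n'(1) l m(1) by (simp_all add: d_def m_assoc)
    qed
    \<comment> \<open>the defaults in the other components are those of \<open>l = m = 1\<close> and the root \<open>1\<close>\<close>
    define B L M V W A where "B = put R 0 d" and "L = put R 1 l" and "M = put R 1 m"
      and "V = put R 1 n" and "W = put R 1 n'" and "A = V - B * L"
    have LM: "L + M = ztr t" "L * M = 1" "V * W = 1" "V^p = L" "W^p = M" "B * (L - M) = V - W"
      using l m n n' lm dlm by (simp_all add: L_def M_def V_def W_def B_def put_hom[OF R] put_one[OF R] put_pow np n'p tr)
    have AL: "A + B * L = V" by (simp add: A_def)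
    have "A + B * M = V - B * (L - M)" by (simp add: A_def algebra_simps)
    then have AM: "A + B * M = W" unfolding LM(6) by simp
    have L2: "L * L = ztr t * L - 1" and M2: "M * M = ztr t * M - 1"
      unfolding LM(1,2)[symmetric] by (simp_all add: algebra_simps)
    define y where "y = zlin A B t"
    have "znorm y = (A + B*L) * (A + B*M)"
      unfolding y_def znorm_zlin t(1) LM(1)[symmetric] LM(2)[symmetric] by (simp add: algebra_simps)
    then have ny: "znorm y = 1" unfolding AL AM LM(3) .
    obtain c' d' where cd1: "zpow y p = zlin c' d' t"
      and ev: "\<And>l. l*l = ztr t * l - 1 \<Longrightarrow> c' + d'*l = (A + B*l)^p"
      using zpow_zlin[OF t(1), of A B p] unfolding y_def by blast
    note cd = cd1 ev[OF L2, unfolded AL LM(4)] ev[OF M2, unfolded AM LM(5)]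
    have d'_eq: "d' * (L - M) = L - M"
    proof -
      have "d' * (L - M) = (c' + d'*L) - (c' + d'*M)" by (simp add: algebra_simps)
      then show ?thesis unfolding cd(2,3) .
    qed
    have "?k d' \<otimes>\<^bsub>R\<^esub> (l \<ominus>\<^bsub>R\<^esub> m) = l \<ominus>\<^bsub>R\<^esub> m"
      using arg_cong[OF d'_eq, of ?k] l m unfolding comp L_def M_def by (simp add: component_put[OF R])
    then have kd': "?k d' = \<one>\<^bsub>R\<^esub>"
      using m_rcancel[of "l \<ominus>\<^bsub>R\<^esub> m" "?k d'" "\<one>\<^bsub>R\<^esub>"] False l m(1) by simp
    have "?k c' \<oplus>\<^bsub>R\<^esub> l = l"
      using arg_cong[OF cd(2), of ?k] l by (simp add: comp L_def component_put[OF R] kd')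
    then have kc': "?k c' = \<zero>\<^bsub>R\<^esub>" using l by (simp add: add.r_cancel_one)
    have "?c (zpow y p) = ?c t"
      unfolding cd(1) by (cases t rule: zorn_coordinates) (simp add: comp kd' kc')
    then have "sign_class R (?c y) [^]\<^bsub>paige_loop R\<^esub> p = x"
      unfolding sign_class_pow[OF ny] w(1) by (simp add: t(2))
    then show False using no_root[OF sign_class_mem[OF R zcomponent_unit[OF R ny]]] by blast
  qed
qed

end

section \<open>Separability over prime fields\<close>

text \<open>The value of the formal derivative at a point. Coefficient lists start with the leading coefficient.\<close>

fun (in ring) deriv_at :: "'a list \<Rightarrow> 'a \<Rightarrow> 'a" where
  "deriv_at [] a = \<zero>"
| "deriv_at (c # p) a = [length p] \<cdot> (c \<otimes> a [^] (length p - 1)) \<oplus> deriv_at p a"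

context ring
begin

lemma deriv_at_closed: "set p \<subseteq> carrier R \<Longrightarrow> a \<in> carrier R \<Longrightarrow> deriv_at p a \<in> carrier R"
  by (induction p) auto

lemma deriv_at_replicate:
  "set p \<subseteq> carrier R \<Longrightarrow> a \<in> carrier R \<Longrightarrow> deriv_at (replicate n \<zero> @ p) a = deriv_at p a"
  by (induction n) (simp_all add: deriv_at_closed)

lemma deriv_at_normalize:
  "set p \<subseteq> carrier R \<Longrightarrow> a \<in> carrier R \<Longrightarrow> deriv_at (normalize p) a = deriv_at p a"
  by (induction p) (simp_all add: deriv_at_closed)

end

context cring
begin

lemma deriv_at_map2:
  assumes "set p \<subseteq> carrier R" "set q \<subseteq> carrier R" "length p = length q" "a \<in> carrier R"
  shows "deriv_at (map2 (\<oplus>) p q) a = deriv_at p a \<oplus> deriv_at q a"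
  using assms(3,1,2)
proof (induction p q rule: list_induct2)
  case (Cons b p c q)
  then have bc: "b \<in> carrier R" "c \<in> carrier R" "deriv_at p a \<in> carrier R" "deriv_at q a \<in> carrier R"
    using deriv_at_closed \<open>a \<in> carrier R\<close> by auto
  have "[length q] \<cdot> ((b \<oplus> c) \<otimes> a [^] (length q - 1)) =
      [length q] \<cdot> (b \<otimes> a [^] (length q - 1)) \<oplus> [length q] \<cdot> (c \<otimes> a [^] (length q - 1))"
    using bc \<open>a \<in> carrier R\<close> by (simp add: l_distr add.nat_pow_distrib)
  then show ?case
    using Cons bc \<open>a \<in> carrier R\<close> by (simp add: a_ac)
qed simp

lemma deriv_at_poly_add_aux:
  assumes "set p \<subseteq> carrier R" "set q \<subseteq> carrier R" "length p \<ge> length q" "a \<in> carrier R"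
  shows "deriv_at (poly_add p q) a = deriv_at p a \<oplus> deriv_at q a"
proof -
  let ?q = "replicate (length p - length q) \<zero> @ q"
  have q: "set ?q \<subseteq> carrier R" "length p = length ?q" using assms by auto
  have "set (map2 (\<oplus>) p ?q) \<subseteq> carrier R"
  proof
    fix x assume "x \<in> set (map2 (\<oplus>) p ?q)"
    then obtain b c where "x = b \<oplus> c" "(b, c) \<in> set (zip p ?q)" by auto
    then show "x \<in> carrier R"
      using set_zip_leftD[of b c p ?q] set_zip_rightD[of b c p ?q] assms(1) q(1) by blast
  qed
  then show ?thesis
    using assms deriv_at_map2[OF assms(1) q assms(4)] deriv_at_replicate[OF assms(2,4)]
    by (simp add: deriv_at_normalize)
qed

lemma deriv_at_poly_add:
  assumes "set p \<subseteq> carrier R" "set q \<subseteq> carrier R" "a \<in> carrier R"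
  shows "deriv_at (poly_add p q) a = deriv_at p a \<oplus> deriv_at q a"
proof (cases "length p \<ge> length q")
  case True then show ?thesis by (rule deriv_at_poly_add_aux[OF assms(1,2) _ assms(3)])
next
  case False
  then show ?thesis
    unfolding poly_add_comm[OF assms(1,2)]
    using deriv_at_poly_add_aux[OF assms(2,1) _ assms(3)] assms
    by (simp add: deriv_at_closed a_comm)
qed

lemma deriv_at_append_zero:
  assumes "set p \<subseteq> carrier R" "a \<in> carrier R"
  shows "deriv_at (p @ [\<zero>]) a = a \<otimes> deriv_at p a \<oplus> eval p a"
  using assms(1)
proof (induction p)
  case (Cons c p)
  then have cl: "c \<in> carrier R" "deriv_at p a \<in> carrier R" "eval p a \<in> carrier R"
    using deriv_at_closed eval_in_carrier assms(2) by auto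
  let ?n = "length p"
  have "a \<otimes> [?n] \<cdot> (c \<otimes> a [^] (?n - 1)) = [?n] \<cdot> (c \<otimes> a [^] ?n)"
  proof (cases ?n)
    case (Suc k)
    then show ?thesis
      using add_pow_rdistr[of a "c \<otimes> a [^] k" "Suc k"] cl assms(2) by (simp add: m_ac del: add.nat_pow_Suc)
  qed (simp add: assms(2))
  then have "a \<otimes> deriv_at (c # p) a = [?n] \<cdot> (c \<otimes> a [^] ?n) \<oplus> a \<otimes> deriv_at p a"
    using cl assms(2) by (simp add: r_distr)
  then show ?case
    using Cons cl assms(2) by (simp add: a_ac)
qed (simp add: assms(2))

lemma deriv_at_map_mult:
  assumes "set p \<subseteq> carrier R" "a \<in> carrier R" "k \<in> carrier R"
  shows "deriv_at (map ((\<otimes>) k) p) a = k \<otimes> deriv_at p a"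
  using assms(1)
proof (induction p)
  case (Cons c p)
  then show ?case
    using assms(2,3) deriv_at_closed[of p a] by (simp add: r_distr add_pow_rdistr m_assoc)
qed (simp add: assms(3))

text \<open>The product rule for a linear factor: for a double root \<open>a\<close> also the value on the right vanishes.\<close>

lemma deriv_at_root_factor:
  assumes "set q \<subseteq> carrier R" "a \<in> carrier R"
  shows "deriv_at (poly_mult [\<one>, \<ominus> a] q) a = eval q a"
proof -
  have sets: "set (q @ [\<zero>]) \<subseteq> carrier R" "set (map ((\<otimes>) (\<ominus> a)) q) \<subseteq> carrier R"
    using assms by auto
  have set2: "set (poly_add (map ((\<otimes>) (\<ominus> a)) q) []) \<subseteq> carrier R"
    using poly_add_in_carrier[OF sets(2), of "[]"] by simp
  have cl: "deriv_at q a \<in> carrier R" "eval q a \<in> carrier R"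
    using deriv_at_closed eval_in_carrier assms by auto
  have id: "map ((\<otimes>) \<one>) q = q" using assms(1) by (induction q) auto
  have lin: "deriv_at (poly_add (map ((\<otimes>) (\<ominus> a)) q) []) a = \<ominus> a \<otimes> deriv_at q a \<oplus> \<zero>"
    using deriv_at_poly_add[OF sets(2), of "[]" a] assms
    by (simp del: poly_add.simps add: deriv_at_map_mult)
  have "deriv_at (poly_mult [\<one>, \<ominus> a] q) a =
      deriv_at (poly_add (q @ [\<zero>]) (poly_add (map ((\<otimes>) (\<ominus> a)) q) [])) a"
    by (simp add: id del: poly_add.simps)
  also have "\<dots> = (a \<otimes> deriv_at q a \<oplus> eval q a) \<oplus> (\<ominus> a \<otimes> deriv_at q a \<oplus> \<zero>)"
    unfolding deriv_at_poly_add[OF sets(1) set2 assms(2)] lin deriv_at_append_zero[OF assms] ..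
  also have "\<dots> = eval q a"
    using cl assms(2) by (simp add: l_minus a_ac r_neg)
  finally show ?thesis .
qed

end

lemma (in domain) deriv_at_double_root:
  assumes f: "f \<in> carrier (poly_ring R)" and a: "a \<in> carrier R"
    and dvd: "([\<one>, \<ominus> a] [^]\<^bsub>poly_ring R\<^esub> (2::nat)) pdivides f"
  shows "deriv_at f a = \<zero>"
proof -
  interpret UP: domain "poly_ring R" using univ_poly_is_domain[OF carrier_is_subring] .
  let ?x = "[\<one>, \<ominus> a]"
  have x: "?x \<in> carrier (poly_ring R)"
    unfolding univ_poly_carrier[symmetric] polynomial_def using a by simp
  obtain q where q: "q \<in> carrier (poly_ring R)" "f = (?x [^]\<^bsub>poly_ring R\<^esub> (2::nat)) \<otimes>\<^bsub>poly_ring R\<^esub> q"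
    using dvd unfolding pdivides_def factor_def by blast
  have "f = ?x \<otimes>\<^bsub>poly_ring R\<^esub> (?x \<otimes>\<^bsub>poly_ring R\<^esub> q)"
    unfolding q(2) using x q(1) by (simp add: numeral_2_eq_2 UP.m_assoc)
  then have f': "f = poly_mult ?x (?x \<otimes>\<^bsub>poly_ring R\<^esub> q)"
    by (simp add: univ_poly_mult)
  have sets: "set (?x \<otimes>\<^bsub>poly_ring R\<^esub> q) \<subseteq> carrier R" "set q \<subseteq> carrier R" "set ?x \<subseteq> carrier R"
    using UP.m_closed[OF x q(1)] q(1) x polynomial_incl unfolding univ_poly_carrier[symmetric] by blast+
  have "deriv_at f a = eval (poly_mult ?x q) a"
    unfolding f' using deriv_at_root_factor[OF sets(1) a] by (simp add: univ_poly_mult)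
  also have "\<dots> = eval ?x a \<otimes> eval q a" by (rule eval_poly_mult[OF sets(3,2) a])
  also have "eval ?x a = \<zero>" using a by (simp add: r_neg)
  finally show ?thesis using eval_in_carrier[OF sets(2) a] by simp
qed

text \<open>A root \<open>a\<close> of the minimal polynomial of \<open>x\<close> has the same minimal polynomial. If the root is
multiple, the square of its linear factor divides every polynomial over \<open>K\<close> that vanishes at \<open>a\<close>.\<close>

lemma (in domain) Irr_double_root:
  assumes K: "subfield K R" and x: "x \<in> carrier R" "(algebraic over K) x"
    and a: "a \<in> carrier R" and double: "alg_mult (Irr K x) a > 1"
  shows "Irr K a = Irr K x" "(algebraic over K) a" "g \<in> carrier (K[X]) \<Longrightarrow> eval g a = \<zero> \<Longrightarrow> deriv_at g a = \<zero>"
proof -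
  let ?f = "Irr K x"
  note f = IrrE[OF K x]
  have KX: "carrier (K[X]) \<subseteq> carrier (poly_ring R)"
    using carrier_polynomial_shell[OF subfieldE(1)[OF K]] by blast
  have fR: "?f \<in> carrier (poly_ring R)" using f(1) KX by blast
  have dvd: "([\<one>, \<ominus> a] [^]\<^bsub>poly_ring R\<^esub> (2::nat)) pdivides ?f"
    by (rule le_alg_mult_imp_pdivides[OF a fR]) (use double in simp)
  have root: "eval ?f a = \<zero>" "?f \<noteq> []"
    using double alg_mult_gt_zero_iff_is_root[OF fR, of a] by (auto simp: is_root_def)
  show alg: "(algebraic over K) a"
    by (rule algebraicI[OF f(1) root(2,1)])
  show eq: "Irr K a = ?f"
    using minimal_polynomial_is_unique[OF K a alg] IrrE[OF K a alg] f root(1) by blast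
  show "deriv_at g a = \<zero>" if g: "g \<in> carrier (K[X])" "eval g a = \<zero>"
  proof -
    interpret UP: domain "poly_ring R" using univ_poly_is_domain[OF carrier_is_subring] .
    have gR: "g \<in> carrier (poly_ring R)" using g(1) KX by blast
    have "?f pdivides g" using Irr_minimal[OF K a alg g] unfolding eq .
    moreover have "[\<one>, \<ominus> a] [^]\<^bsub>poly_ring R\<^esub> (2::nat) \<in> carrier (poly_ring R)"
      using a by (intro UP.nat_pow_closed) (simp add: univ_poly_carrier[symmetric] polynomial_def)
    ultimately have "([\<one>, \<ominus> a] [^]\<^bsub>poly_ring R\<^esub> (2::nat)) pdivides g"
      using dvd UP.divides_trans unfolding pdivides_def by blast
    then show ?thesis by (rule deriv_at_double_root[OF gR a])
  qed
qed

fun (in ring) deriv :: "'a list \<Rightarrow> 'a list" where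
  "deriv [] = []"
| "deriv (c # p) = (if p = [] then [] else ([length p] \<cdot> c) # deriv p)"

lemma (in ring) length_deriv: "length (deriv p) = length p - 1"
  by (induction p) (auto simp: Suc_diff_Suc)

lemma (in cring) eval_deriv:
  assumes "set p \<subseteq> carrier R" "a \<in> carrier R"
  shows "eval (deriv p) a = deriv_at p a"
  using assms(1)
proof (induction p)
  case (Cons c p)
  then show ?case using assms(2) by (simp add: length_deriv add_pow_ldistr)
qed simp

lemma (in ring) deriv_in_subring:
  assumes "subring K R" "set p \<subseteq> K" shows "set (deriv p) \<subseteq> K"
proof -
  interpret K: ring "R\<lparr>carrier := K\<rparr>" using subring_is_ring[OF assms(1)] .
  have "[n] \<cdot> c \<in> K" if "c \<in> K" for n :: nat and c
    using K.add.nat_pow_closed[of c n] that by (simp add: add_pow_carrier_update)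
  then show ?thesis using assms(2) by (induction p) auto
qed

text \<open>In characteristic zero the derivative of the minimal polynomial is a nonzero polynomial of smaller
degree, so it does not vanish at a root.\<close>

lemma (in domain) Irr_separable_char_0:
  assumes K: "subfield K R" and x: "x \<in> carrier R" "(algebraic over K) x"
    and char: "has_characteristic R 0" and a: "a \<in> carrier R"
  shows "alg_mult (Irr K x) a \<le> 1"
proof (rule ccontr)
  assume "\<not> ?thesis"
  then have double: "alg_mult (Irr K x) a > 1" by simp
  note D = Irr_double_root[OF K x a double]
  let ?f = "Irr K a"
  note f = IrrE[OF K a D(2)]
  have sf: "set ?f \<subseteq> K" using f(1) polynomial_incl unfolding univ_poly_carrier[symmetric] by blast
  have KR: "K \<subseteq> carrier R" using subfieldE(3)[OF K] .
  have "?f \<noteq> []" using f(2) pirreducible_degree[OF K f(1,2)] by auto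
  moreover have "length ?f - 1 \<ge> 1" using pirreducible_degree[OF K f(1,2)] by simp
  ultimately obtain p where p: "?f = \<one> # p" "p \<noteq> []" using f(3) by (cases ?f) fastforce+
  have lead: "[length p] \<cdot> \<one> \<noteq> \<zero>" using char p(2) by (auto simp: has_characteristic_def)
  have f': "deriv ?f \<in> carrier (K[X])"
    using deriv_in_subring[OF subfieldE(1)[OF K] sf] lead p(2)
    unfolding univ_poly_carrier[symmetric] polynomial_def p(1) by simp
  have ev: "eval (deriv ?f) a = \<zero>"
    using eval_deriv[of ?f a] sf KR a D(3)[OF f(1,4)] by simp
  have "?f pdivides deriv ?f" by (rule Irr_minimal[OF K a D(2) f' ev])
  moreover have "deriv ?f \<noteq> []" unfolding p(1) using p(2) by simp
  ultimately have "length ?f - 1 \<le> length (deriv ?f) - 1"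
    using pdivides_imp_degree_le[OF subfieldE(1)[OF K] f(1) f'] by blast
  then show False unfolding length_deriv p(1) using p(2) by (cases p) auto
qed

lemma field_card_pow:
  fixes K (structure)
  assumes "field K" "finite (carrier K)" "x \<in> carrier K"
  shows "x [^] card (carrier K) = x" "[card (carrier K)] \<cdot> \<one> = \<zero>"
proof -
  interpret field K by fact
  show "[card (carrier K)] \<cdot> \<one> = \<zero>"
    using add.pow_order_eq_1[of \<one>] by (simp add: Coset.order_def)
  show "x [^] card (carrier K) = x"
  proof (cases "x = \<zero>")
    case True
    have "card (carrier K) > 0" using assms(2) zero_closed by (auto simp: card_gt_0_iff)
    then show ?thesis using True by (simp add: nat_pow_zero)
  next
    case False
    interpret M: group "Multiplicative_Group.mult_of K" by (rule field_mult_group)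
    have "x [^]\<^bsub>Multiplicative_Group.mult_of K\<^esub> Coset.order (Multiplicative_Group.mult_of K) = \<one>\<^bsub>Multiplicative_Group.mult_of K\<^esub>"
      using M.pow_order_eq_1[of x] False assms(3) by simp
    then have "x [^] (card (carrier K) - 1) = \<one>"
      using assms(2) by (simp add: nat_pow_def Coset.order_def)
    then have "x [^] Suc (card (carrier K) - 1) = x" using assms(3) by simp
    moreover have "card (carrier K) > 0" using assms(2) zero_closed by (auto simp: card_gt_0_iff)
    ultimately show ?thesis by simp
  qed
qed

lemma (in domain) finite_simple_extension:
  assumes K: "subfield K R" "finite K" and x: "x \<in> carrier R" "(algebraic over K) x"
  shows "finite (simple_extension K x)"
proof -
  let ?U = "exp_base x (length (Irr K x) - 1)"
  have U: "set ?U \<subseteq> carrier R" using x(1) by (auto simp: exp_base_def)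
  have "Span K ?U = { combine Ks ?U | Ks. length Ks = length ?U \<and> set Ks \<subseteq> K }"
    using Span_eq_combine_set_length_version[OF K(1) U] .
  moreover have "finite {Ks. set Ks \<subseteq> K \<and> length Ks = length ?U}"
    using finite_lists_length_eq[OF K(2)] .
  then have "finite ((\<lambda>Ks. combine Ks ?U) ` {Ks. set Ks \<subseteq> K \<and> length Ks = length ?U})" by simp
  moreover have "{ combine Ks ?U | Ks. length Ks = length ?U \<and> set Ks \<subseteq> K } =
     (\<lambda>Ks. combine Ks ?U) ` {Ks. set Ks \<subseteq> K \<and> length Ks = length ?U}" by auto
  ultimately show ?thesis using Span_exp_base[OF K(1) x] by simp
qed

lemma (in ring) deriv_at_frobenius:
  assumes "a \<in> carrier R" "n \<ge> 2" "[n] \<cdot> \<one> = \<zero>"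
  shows "deriv_at (\<one> # replicate (n - 2) \<zero> @ [\<ominus> \<one>, \<zero>]) a = \<ominus> \<one>"
proof -
  have "[n] \<cdot> (\<one> \<otimes> a [^] (n - 1)) = ([n] \<cdot> \<one>) \<otimes> a [^] (n - 1)"
    using assms(1) by (simp add: add_pow_ldistr)
  then have "[n] \<cdot> (\<one> \<otimes> a [^] (n - 1)) = \<zero>" using assms by simp
  moreover have "length (replicate (n - 2) \<zero> @ [\<ominus> \<one>, \<zero>]) = n" using assms(2) by simp
  ultimately have "deriv_at (\<one> # replicate (n - 2) \<zero> @ [\<ominus> \<one>, \<zero>]) a =
      \<zero> \<oplus> deriv_at (replicate (n - 2) \<zero> @ [\<ominus> \<one>, \<zero>]) a"
    unfolding deriv_at.simps by (simp only:)
  then show ?thesis using assms(1) by (simp add: deriv_at_replicate deriv_at_closed)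
qed

lemma (in ring) eval_frobenius:
  assumes "a \<in> carrier R" "n \<ge> 2"
  shows "eval (\<one> # replicate (n - 2) \<zero> @ [\<ominus> \<one>, \<zero>]) a = a [^] n \<ominus> a"
proof -
  have "length (replicate (n - 2) \<zero> @ [\<ominus> \<one>, \<zero>]) = n" using assms(2) by simp
  then show ?thesis using assms(1) by (simp add: eval_replicate minus_eq l_minus)
qed

text \<open>Over a finite base field \<open>a\<close> lies in a finite field with, say, \<open>q\<close> elements, and is a
root of \<open>X^q - X\<close>, whose derivative is \<open>-1\<close>.\<close>

lemma (in domain) Irr_separable_finite:
  assumes K: "subfield K R" "finite K" and x: "x \<in> carrier R" "(algebraic over K) x"
    and a: "a \<in> carrier R"
  shows "alg_mult (Irr K x) a \<le> 1"
proof (rule ccontr)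
  assume "\<not> ?thesis"
  then have double: "alg_mult (Irr K x) a > 1" by simp
  note D = Irr_double_root[OF K(1) x a double]
  let ?E = "simple_extension K a"
  have E: "subfield ?E R" "finite ?E" "a \<in> ?E"
    using simple_extension_is_subfield[OF K(1) a] D(2) finite_simple_extension[OF K a D(2)]
      simple_extension_mem[OF subfieldE(1)[OF K(1)] a] by auto
  interpret E: field "R\<lparr>carrier := ?E\<rparr>" using subfield_iff(2)[OF E(1)] .
  let ?n = "card ?E"
  have "{\<zero>, \<one>} \<subseteq> ?E" using E.zero_closed E.one_closed by simp
  then have n2: "?n \<ge> 2" using card_mono[OF E(2), of "{\<zero>, \<one>}"] by simp
  have n: "a [^] ?n = a" "[?n] \<cdot> \<one> = \<zero>"
    using field_card_pow[OF E.field_axioms, of a] E(2,3)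
    by (simp_all add: add_pow_carrier_update nat_pow_consistent[symmetric])
  let ?g = "\<one> # replicate (?n - 2) \<zero> @ [\<ominus> \<one>, \<zero>]"
  have "\<zero> \<in> K" "\<one> \<in> K" "\<ominus> \<one> \<in> K"
    using subringE(2,3,5)[OF subfieldE(1)[OF K(1)]] by auto
  then have g: "?g \<in> carrier (K[X])"
    unfolding univ_poly_carrier[symmetric] polynomial_def by auto
  have "eval ?g a = \<zero>" using eval_frobenius[OF a n2] n(1) a by simp
  then have "deriv_at ?g a = \<zero>" by (rule D(3)[OF g])
  then have "\<ominus> \<one> = \<zero>" using deriv_at_frobenius[OF a n2 n(2)] by simp
  then show False using add.inv_eq_1_iff[of \<one>] by simp
qed

section \<open>Finite subfields, cardinalities and Galois extensions\<close>

lemma field_two_le_card: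
  assumes "field K" "finite (carrier K)" shows "2 \<le> card (carrier K)"
proof -
  interpret field K by fact
  show ?thesis using card_mono[OF assms(2), of "{\<zero>\<^bsub>K\<^esub>, \<one>\<^bsub>K\<^esub>}"] by simp
qed

text \<open>The elements of \<open>F\<close> are roots of \<open>X^q - X\<close>, which has at most \<open>q\<close> roots.\<close>

lemma (in field) finite_subfield_eq_roots:
  assumes F: "subfield F R" "finite F"
  shows "x \<in> F \<longleftrightarrow> x \<in> carrier R \<and> x [^] card F = x"
proof
  let ?q = "card F"
  interpret F: field "R\<lparr>carrier := F\<rparr>" using subfield_iff(2)[OF F(1)] .
  have q: "2 \<le> ?q" using field_two_le_card[OF F.field_axioms] F(2) by simp
  have pow: "x \<in> carrier R \<and> x [^] ?q = x" if "x \<in> F" for x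
    using field_card_pow(1)[OF F.field_axioms, of x] F(2) that subfieldE(3)[OF F(1)]
    by (auto simp: nat_pow_consistent[symmetric])
  then show "x \<in> F \<Longrightarrow> x \<in> carrier R \<and> x [^] ?q = x" .
  let ?g = "\<one> # replicate (?q - 2) \<zero> @ [\<ominus> \<one>, \<zero>]"
  have g: "?g \<in> carrier (poly_ring R)"
    unfolding univ_poly_carrier[symmetric] polynomial_def by auto
  have root: "y \<in># roots ?g \<longleftrightarrow> y \<in> carrier R \<and> y [^] ?q = y" for y
    unfolding roots_mem_iff_is_root[OF g] is_root_def
    using eval_frobenius[OF _ q, of y] r_right_minus_eq[of "y [^] ?q" y] by auto
  have "card (set_mset (roots ?g)) = size (mset_set (set_mset (roots ?g)))" by simp
  also have "\<dots> \<le> size (roots ?g)" by (intro size_mset_mono mset_set_set_mset_msubset)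
  also have "\<dots> \<le> length ?g - 1" by (rule size_roots_le_degree[OF g])
  also have "\<dots> = ?q" using q by simp
  finally have "card (set_mset (roots ?g)) \<le> ?q" .
  moreover have "F \<subseteq> set_mset (roots ?g)" using root pow by blast
  ultimately have "F = set_mset (roots ?g)" by (intro card_seteq) auto
  then show "x \<in> carrier R \<and> x [^] ?q = x \<Longrightarrow> x \<in> F" using root by blast
qed

lemma (in field) finite_subfield_mono:
  assumes F: "subfield F R" "card F = p ^ m" and F': "subfield F' R" "card F' = p ^ n"
    and p: "p > 0" and dvd: "m dvd n"
  shows "F \<subseteq> F'"
proof
  fix x assume x: "x \<in> F"
  have fin: "finite F" "finite F'" using F(2) F'(2) p by (auto intro: card_ge_0_finite)
  have x': "x \<in> carrier R" "x [^] (p ^ m) = x"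
    using finite_subfield_eq_roots[OF F(1) fin(1)] x F(2) by auto
  obtain k where "n = m * k" using dvd by blast
  moreover have "x [^] (p ^ (m * k)) = x"
  proof (induction k)
    case (Suc k)
    have "x [^] (p ^ (m * Suc k)) = (x [^] (p ^ m)) [^] (p ^ (m * k))"
      using x'(1) by (simp add: nat_pow_pow power_add)
    then show ?case using Suc x'(2) by simp
  qed (use x'(1) in simp)
  ultimately show "x \<in> F'"
    using finite_subfield_eq_roots[OF F'(1) fin(2)] x'(1) F'(2) by simp
qed

lemma power_minus_one_dvd_imp_dvd:
  fixes p m n :: nat
  assumes p: "p \<ge> 2" and m: "m > 0" and dvd: "p ^ m - 1 dvd p ^ n - 1"
  shows "m dvd n"
proof -
  let ?N = "p ^ m - 1" and ?r = "n mod m"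
  have pos: "p ^ k \<ge> 1" for k using p by simp
  have "[p ^ m = 1] (mod ?N)" using cong_diff_iff_cong_0_nat pos[of m] by (simp add: cong_altdef_nat)
  then have "[(p ^ m) ^ (n div m) * p ^ ?r = 1 ^ (n div m) * p ^ ?r] (mod ?N)"
    by (intro cong_mult cong_pow) auto
  moreover have "(p ^ m) ^ (n div m) * p ^ ?r = p ^ n"
    by (simp flip: power_mult power_add)
  ultimately have "[p ^ n = p ^ ?r] (mod ?N)" by simp
  moreover have "[p ^ n = 1] (mod ?N)" using dvd pos[of n] by (simp add: cong_altdef_nat)
  ultimately have "[p ^ ?r = 1] (mod ?N)" using cong_sym cong_trans by blast
  then have "?N dvd p ^ ?r - 1" using pos[of ?r] by (simp add: cong_altdef_nat)
  moreover have "p ^ ?r - 1 < ?N"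
  proof -
    have "p ^ ?r < p ^ m" using p m by (intro power_strict_increasing) auto
    then show ?thesis using pos[of ?r] by linarith
  qed
  ultimately have "p ^ ?r - 1 = 0" by (meson dvd_imp_le neq0_conv not_less)
  then have "p ^ ?r = 1" using pos[of ?r] by simp
  then have "?r = 0" using p by simp
  then show ?thesis by auto
qed

text \<open>Lagrange's theorem for the multiplicative groups.\<close>

lemma (in field) finite_subfield_dvd:
  assumes F: "subfield F R" "card F = p ^ m" and F': "subfield F' R" "card F' = p ^ n"
    and p: "p \<ge> 2" and m: "m > 0" and sub: "F \<subseteq> F'"
  shows "m dvd n"
proof -
  let ?S = "R\<lparr>carrier := F'\<rparr>"
  have fin: "finite F" "finite F'" using F(2) F'(2) p by (auto intro: card_ge_0_finite)
  interpret S: field ?S using subfield_iff(2)[OF F'(1)] .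
  have "subfield F ?S"
    using S.subfield_iff(1)[of F] subfield_iff(2)[OF F(1)] sub by simp
  then have sg: "subgroup (F - {\<zero>}) (Multiplicative_Group.mult_of ?S)"
    using S.subgroup_mult_of by simp
  interpret G: group "Multiplicative_Group.mult_of ?S" by (rule S.field_mult_group)
  have "card (F - {\<zero>}) dvd Coset.order (Multiplicative_Group.mult_of ?S)"
    using G.lagrange[OF sg] by (metis dvd_triv_right)
  moreover have "Coset.order (Multiplicative_Group.mult_of ?S) = p ^ n - 1"
    using fin F'(2) S.zero_closed by (simp add: Coset.order_def)
  moreover have "card (F - {\<zero>}) = p ^ m - 1"
    using fin F(2) subringE(2)[OF subfieldE(1)[OF F(1)]] by simp
  ultimately show ?thesis using power_minus_one_dvd_imp_dvd[OF p m] by simp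
qed

lemma finite_prime_field:
  assumes "prime_field_of_char c K" "c \<noteq> 0" shows "finite (carrier K)"
proof -
  obtain h where "h \<in> ring_iso K (residue_ring (int c))"
    using assms by (auto simp: prime_field_of_char_def is_ring_iso_def)
  then have "bij_betw h (carrier K) (carrier (residue_ring (int c)))" by (simp add: ring_iso_def)
  then show ?thesis using bij_betw_finite[of h "carrier K"] by (simp add: residue_ring_def)
qed

lemma infinite_char_0:
  assumes "field K" "has_characteristic K 0" shows "infinite (carrier K)"
proof
  interpret field K by fact
  assume fin: "finite (carrier K)"
  have "[card (carrier K)] \<cdot>\<^bsub>K\<^esub> \<one>\<^bsub>K\<^esub> = \<zero>\<^bsub>K\<^esub>" by (rule field_card_pow(2)[OF assms(1) fin one_closed])
  then show False using assms(2) field_two_le_card[OF assms(1) fin] by (simp add: has_characteristic_def)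
qed

text \<open>The field can be read off from the carrier of its Paige loop: its elements are the entries of root elements.\<close>

lemma mem_carrier_iff_paige:
  fixes S :: "'a ring"
  assumes S: "field S"
  shows "a \<in> carrier S \<longleftrightarrow>
    (\<exists>c\<in>carrier (paige_loop S). Zorn \<one>\<^bsub>S\<^esub> (a,\<zero>\<^bsub>S\<^esub>,\<zero>\<^bsub>S\<^esub>) (\<zero>\<^bsub>S\<^esub>,\<zero>\<^bsub>S\<^esub>,\<zero>\<^bsub>S\<^esub>) \<one>\<^bsub>S\<^esub> \<in> c)"
proof
  interpret field S by (rule S)
  let ?z = "Zorn \<one>\<^bsub>S\<^esub> (a,\<zero>\<^bsub>S\<^esub>,\<zero>\<^bsub>S\<^esub>) (\<zero>\<^bsub>S\<^esub>,\<zero>\<^bsub>S\<^esub>,\<zero>\<^bsub>S\<^esub>) \<one>\<^bsub>S\<^esub>"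
  note R = field_is_cring[OF S]
  show "\<exists>c\<in>carrier (paige_loop S). ?z \<in> c" if "a \<in> carrier S"
  proof -
    have "?z \<in> carrier (unit_zorn_loop S)"
      using that by (simp add: carrier_unit_zorn_loop[OF R] minus_eq)
    from sign_class_mem[OF R this] show ?thesis
      by (rule bexI[rotated]) (simp add: sign_class_def)
  qed
  show "a \<in> carrier S" if ex: "\<exists>c\<in>carrier (paige_loop S). ?z \<in> c"
  proof -
    obtain c where c: "c \<in> carrier (paige_loop S)" "?z \<in> c" using ex by blast
    obtain w where w: "c = sign_class S w" "w \<in> zorn_set S" using paige_carrierE[OF R c(1)] .
    have "?z = w \<or> ?z = zneg S w" using c(2) unfolding w(1) sign_class_def by blast
    then have "?z \<in> zorn_set S" using w(2) zneg_mem[OF R w(2)] by (elim disjE) (simp_all only:)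
    then show ?thesis by simp
  qed
qed

lemma finite_zorn_set: "finite (carrier R) \<Longrightarrow> finite (zorn_set R)"
proof -
  assume fin: "finite (carrier R)"
  have "zorn_set R \<subseteq> (\<lambda>(a, u, v, b). Zorn a u v b) `
      (carrier R \<times> vec3_set (carrier R) \<times> vec3_set (carrier R) \<times> carrier R)"
  proof
    fix z assume "z \<in> zorn_set R"
    then obtain a u v b where "z = Zorn a u v b" "a \<in> carrier R" "u \<in> vec3_set (carrier R)"
      "v \<in> vec3_set (carrier R)" "b \<in> carrier R" by (auto simp: zorn_set_def)
    then show "z \<in> (\<lambda>(a, u, v, b). Zorn a u v b) `
      (carrier R \<times> vec3_set (carrier R) \<times> vec3_set (carrier R) \<times> carrier R)"
      by (intro image_eqI[of _ _ "(a, u, v, b)"]) auto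
  qed
  then show ?thesis by (rule finite_subset) (use fin in \<open>simp add: vec3_set_def\<close>)
qed

lemma finite_paige_loop_iff:
  fixes S :: "'a ring"
  assumes S: "field S"
  shows "finite (carrier (paige_loop S)) \<longleftrightarrow> finite (carrier S)"
proof
  note R = field_is_cring[OF S]
  assume "finite (carrier (paige_loop S))"
  moreover have "finite c" if c: "c \<in> carrier (paige_loop S)" for c
  proof -
    obtain w where "c = sign_class S w" using paige_carrierE[OF R c] .
    then show ?thesis by (simp add: sign_class_def)
  qed
  ultimately have "finite (\<Union>(carrier (paige_loop S)))" by blast
  then have "finite ((\<lambda>z. case z of Zorn a u v b \<Rightarrow> fst u) ` \<Union>(carrier (paige_loop S)))" by simp
  moreover have "carrier S \<subseteq> (\<lambda>z. case z of Zorn a u v b \<Rightarrow> fst u) ` \<Union>(carrier (paige_loop S))"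
  proof
    fix a assume "a \<in> carrier S"
    then obtain c where c: "c \<in> carrier (paige_loop S)"
      "Zorn \<one>\<^bsub>S\<^esub> (a,\<zero>\<^bsub>S\<^esub>,\<zero>\<^bsub>S\<^esub>) (\<zero>\<^bsub>S\<^esub>,\<zero>\<^bsub>S\<^esub>,\<zero>\<^bsub>S\<^esub>) \<one>\<^bsub>S\<^esub> \<in> c"
      using mem_carrier_iff_paige[OF S] by blast
    then show "a \<in> (\<lambda>z. case z of Zorn a u v b \<Rightarrow> fst u) ` \<Union>(carrier (paige_loop S))"
      by (intro image_eqI[of _ _ "Zorn \<one>\<^bsub>S\<^esub> (a,\<zero>\<^bsub>S\<^esub>,\<zero>\<^bsub>S\<^esub>) (\<zero>\<^bsub>S\<^esub>,\<zero>\<^bsub>S\<^esub>,\<zero>\<^bsub>S\<^esub>) \<one>\<^bsub>S\<^esub>"]) auto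
  qed
  ultimately show "finite (carrier S)" by (rule finite_subset[rotated])
next
  note R = field_is_cring[OF S]
  assume "finite (carrier S)"
  then have "finite (carrier (unit_zorn_loop S))"
    using finite_zorn_set[of S] carrier_unit_zorn_loop[OF R] by (auto intro: finite_subset[of _ "zorn_set S"])
  then show "finite (carrier (paige_loop S))" unfolding carrier_paige_loop[OF R] by simp
qed

lemma (in field) splitted_of_root_in_base:
  assumes K: "subfield K R" and p: "p \<in> carrier (K[X])" "pirreducible K p" and x: "x \<in> K" "eval p x = \<zero>"
  shows "ring.splitted (R\<lparr>carrier := K\<rparr>) p"
proof -
  let ?S = "R\<lparr>carrier := K\<rparr>"
  interpret S: field ?S using subfield_iff(2)[OF K] .
  note con = univ_poly_consistent[OF subfieldE(1)[OF K]] eval_consistent[OF subfieldE(1)[OF K]]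
  have pS: "p \<in> carrier (poly_ring ?S)" "pirreducible\<^bsub>?S\<^esub> (carrier ?S) p"
    using p by (simp_all add: con)
  have "p \<noteq> []" using pirreducible_degree[OF K p] by auto
  then have "S.is_root p x" using x unfolding S.is_root_def by (simp add: con)
  then have "x \<in># S.roots p" using S.roots_mem_iff_is_root[OF pS(1)] by simp
  then have "length p - 1 = 1" using S.pirreducible_roots[OF pS] by force
  then show ?thesis by (rule S.degree_one_imp_splitted[OF pS(1)])
qed

text \<open>For the prime field itself, a polynomial that is irreducible and has a root in the field is
linear; for the closure everything splits, and separability is the content of the preceding part.\<close>

lemma galois_extension_closure:
  fixes P :: "'a ring"
  assumes cl: "algebraic_closure P K" and K: "prime_field_of_char c (P\<lparr>carrier := K\<rparr>)"
  shows "ring.galois_extension P K K" "ring.galois_extension P K (carrier P)"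
proof -
  interpret algebraic_closure P K by (rule cl)
  have sub: "subfield K P" by (rule subfield_axioms)
  have KP: "K \<subseteq> carrier P" using subfieldE(3)[OF sub] .
  have sep: "alg_mult (Irr K x) a \<le> 1" if "x \<in> carrier P" "a \<in> carrier P" for x a
  proof (cases "c = 0")
    case True
    then have "has_characteristic P 0"
      using has_characteristic_prime_field[OF K] by (simp add: has_characteristic_subfield)
    then show ?thesis
      using Irr_separable_char_0[OF sub that(1) algebraic_extension[OF that(1)]] that(2) by blast
  next
    case False
    then have "finite K" using finite_prime_field[OF K] by simp
    then show ?thesis
      using Irr_separable_finite[OF sub _ that(1) algebraic_extension[OF that(1)] that(2)] by blast
  qed
  have alg: "\<forall>x\<in>K. (algebraic over K) x" using algebraic_extension KP by blast
  have sep_K: "\<forall>x\<in>K. \<forall>a\<in>carrier P. alg_mult (Irr K x) a \<le> 1" using sep KP by blast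
  have split: "\<forall>p\<in>carrier (K[X]\<^bsub>P\<^esub>). pirreducible\<^bsub>P\<^esub> K p \<and> (\<exists>x\<in>K. eval p x = \<zero>\<^bsub>P\<^esub>) \<longrightarrow>
      ring.splitted (P\<lparr>carrier := K\<rparr>) p"
    using splitted_of_root_in_base[OF sub] by blast
  show "galois_extension K K"
    unfolding galois_extension_def using sub alg sep_K split by simp
  show "galois_extension K (carrier P)"
    unfolding galois_extension_def
    using sub carrier_is_subfield sep algebraic_extension KP roots_over_subfield by simp
qed

section \<open>The ordered set of Paige loops\<close>

lemma loop_le_paige_subfields_iff:
  fixes R S :: "'a ring"
  assumes R: "field R" "subfield F R" "has_characteristic R c"
    and S: "field S" "subfield F' S" "has_characteristic S d"
    and same: "c = d \<Longrightarrow> R = S"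
  shows "loop_le (paige_over R F) (paige_over S F') \<longleftrightarrow> c = d \<and> F \<subseteq> F'"
proof
  assume le: "loop_le (paige_over R F) (paige_over S F')"
  note fields = field_subfield[OF R(1,2)] field_subfield[OF S(1,2)]
  have "c = d"
    using loop_le_paige_same_characteristic[OF fields le] R(3) S(3)
    by (simp add: has_characteristic_subfield)
  moreover have "F \<subseteq> F'" using loop_le_paige_carrier[OF fields le] by simp
  ultimately show "c = d \<and> F \<subseteq> F'" by blast
next
  assume "c = d \<and> F \<subseteq> F'"
  then show "loop_le (paige_over R F) (paige_over S F')"
    using same loop_le_paige_subfields[OF R(1,2)] S(2) by simp
qed

lemma paige_over_carrier_inj:
  fixes R :: "'a ring"
  assumes R: "field R" "subfield F R" "subfield F' R"
    and eq: "carrier (paige_over R F) = carrier (paige_over R F')"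
  shows "F = F'"
proof -
  have "a \<in> F \<longleftrightarrow> a \<in> F'" for a
    using mem_carrier_iff_paige[OF field_subfield[OF R(1,2)], of a]
      mem_carrier_iff_paige[OF field_subfield[OF R(1,3)], of a] eq by simp
  then show ?thesis by blast
qed

lemma galois_extensionE:
  fixes P :: "'a ring"
  assumes "field P" "ring.galois_extension P K F"
  shows "subfield F P" "K \<subseteq> F" "F \<subseteq> carrier P"
proof -
  interpret field P by fact
  show "subfield F P" "K \<subseteq> F" "F \<subseteq> carrier P"
    using assms(2) subfieldE(3) unfolding galois_extension_def by blast+
qed

lemma prime_field_chars_iff: "c \<in> prime_field_chars \<longleftrightarrow> c = 0 \<or> prime c"
  by (auto simp: prime_field_chars_def)

text \<open>The numbers \<open>n\<close> for which the loop has rootless torsion of exponent \<open>n\<close> are the multiples of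
the characteristic.\<close>

lemma not_iso_paige_closures:
  fixes R :: "'a ring" and S :: "'b ring"
  assumes R: "algebraically_closed R" "has_characteristic R c"
    and S: "algebraically_closed S" "has_characteristic S d"
    and cd: "c \<in> prime_field_chars" "d \<in> prime_field_chars" "c \<noteq> d"
  shows "\<not> paige_loop R \<cong> paige_loop S"
proof
  interpret R: algebraically_closed R by fact
  interpret S: algebraically_closed S by fact
  assume "paige_loop R \<cong> paige_loop S"
  then obtain h where h: "h \<in> iso (paige_loop R) (paige_loop S)" by (auto simp: is_iso_def)
  have loops: "loop (paige_loop R)" "loop (paige_loop S)"
    using moufang_loop_paige_loop[OF R.is_cring] moufang_loop_paige_loop[OF S.is_cring]
    by (simp_all add: moufang_loop_def)
  note iff = loop_iso_rootless_torsion[OF loops h]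
  have zero: "add_pow R n \<one>\<^bsub>R\<^esub> = \<zero>\<^bsub>R\<^esub> \<longleftrightarrow> c dvd n" "add_pow S n \<one>\<^bsub>S\<^esub> = \<zero>\<^bsub>S\<^esub> \<longleftrightarrow> d dvd n" for n :: nat
    using R(2) S(2) by (auto simp: has_characteristic_def)
  have R_iff: "has_rootless_torsion n (paige_loop R) \<longleftrightarrow> c dvd n" for n
    using has_rootless_torsion_char[OF R.field_axioms, of n]
      not_has_rootless_torsion[OF R.field_axioms R.roots_over_carrier, of n] zero(1)[of n] by blast
  have S_iff: "has_rootless_torsion n (paige_loop S) \<longleftrightarrow> d dvd n" for n
    using has_rootless_torsion_char[OF S.field_axioms, of n]
      not_has_rootless_torsion[OF S.field_axioms S.roots_over_carrier, of n] zero(2)[of n] by blast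
  have dvd: "c dvd n \<longleftrightarrow> d dvd n" for n using iff R_iff S_iff by simp
  have "c dvd d" "d dvd c" using dvd[of c] dvd[of d] by simp_all
  then show False using cd(3) by (simp add: dvd_antisym)
qed

theorem corollary1:
  fixes \<Delta> :: "nat \<Rightarrow> 'a set" and P :: "nat \<Rightarrow> 'a ring"
  assumes prime_fields:
      "\<And>c. c \<in> prime_field_chars \<Longrightarrow> prime_field_of_char c ((P c)\<lparr>carrier := \<Delta> c\<rparr>)"
    and closures:
      "\<And>c. c \<in> prime_field_chars \<Longrightarrow> algebraic_closure (P c) (\<Delta> c)"
  shows
    "{L. minimal_loop_in (simple_paige_loops \<Delta> P) L \<and> finite (carrier L)}
       = {paige_over (P p) (\<Delta> p) | p. prime p}
     \<and> {L. minimal_loop_in (simple_paige_loops \<Delta> P) L \<and> infinite (carrier L)}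
       = {paige_over (P 0) (\<Delta> 0)}
     \<and> {L \<in> simple_paige_loops \<Delta> P.
          \<not> (\<exists>K \<in> simple_paige_loops \<Delta> P. loop_less K L \<and> nonassociative K)}
       = {paige_over (P c) (\<Delta> c) | c. c \<in> prime_field_chars}
     \<and> (\<forall>p q m n F F'.
          prime p \<and> prime q \<and> 0 < m \<and> 0 < n \<and>
          subfield F (P q) \<and> card F = q ^ m \<and> subfield F' (P p) \<and> card F' = p ^ n \<longrightarrow>
          (loop_le (paige_over (P q) F) (paige_over (P p) F') \<longleftrightarrow> q = p \<and> m dvd n))
     \<and> {L. maximal_loop_in (simple_paige_loops \<Delta> P) L}
       = {paige_loop (P c) | c. c \<in> prime_field_chars}
     \<and> (\<forall>c d. c \<in> prime_field_chars \<and> d \<in> prime_field_chars \<and> c \<noteq> d \<longrightarrow>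
          \<not> paige_loop (P c) \<cong> paige_loop (P d))"
proof -
  let ?C = "prime_field_chars" and ?S = "simple_paige_loops \<Delta> P" and ?M = "\<lambda>c F. paige_over (P c) F"
  let ?gal = "\<lambda>c. ring.galois_extension (P c) (\<Delta> c)"
  have closed: "algebraically_closed (P c)" if "c \<in> ?C" for c
  proof -
    interpret algebraic_closure "P c" "\<Delta> c" using closures[OF that] .
    show ?thesis by (rule algebraically_closed_axioms)
  qed
  have fld: "field (P c)" if "c \<in> ?C" for c
    using closed[OF that] by (simp add: algebraically_closed_def)
  have char: "has_characteristic (P c) c" if "c \<in> ?C" for c
    using has_characteristic_prime_field[OF prime_fields[OF that]] by (simp add: has_characteristic_subfield)
  have gal: "?gal c (\<Delta> c)" "?gal c (carrier (P c))" if "c \<in> ?C" for c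
    using galois_extension_closure[OF closures[OF that] prime_fields[OF that]] by blast+
  note galE = galois_extensionE[OF fld]
  have sub: "subfield (\<Delta> c) (P c)" if "c \<in> ?C" for c using galE(1)[OF that gal(1)[OF that]] .
  have S_iff: "L \<in> ?S \<longleftrightarrow> (\<exists>c F. c \<in> ?C \<and> ?gal c F \<and> L = ?M c F)" for L
  proof
    assume "\<exists>c F. c \<in> ?C \<and> ?gal c F \<and> L = ?M c F"
    then obtain c F where cF: "c \<in> ?C" "?gal c F" "L = ?M c F" by blast
    note f = field_subfield[OF fld[OF cF(1)] galE(1)[OF cF(1,2)]]
    show "L \<in> ?S"
      unfolding simple_paige_loops_def
      using cF moufang_loop_paige_loop[OF field_is_cring[OF f]] nonassociative_paige_loop[OF f] simple_loop_paige_loop[OF f]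
      by blast
  qed (auto simp: simple_paige_loops_def)
  have le_iff: "loop_le (?M c F) (?M d F') \<longleftrightarrow> c = d \<and> F \<subseteq> F'"
    if "c \<in> ?C" "subfield F (P c)" "d \<in> ?C" "subfield F' (P d)" for c d F F'
    using loop_le_paige_subfields_iff[OF fld[OF that(1)] that(2) char[OF that(1)] fld[OF that(3)] that(4) char[OF that(3)]]
    by blast
  have less_iff: "loop_less (?M c F) (?M d F') \<longleftrightarrow> c = d \<and> F \<subset> F'"
    if c: "c \<in> ?C" "subfield F (P c)" and d: "d \<in> ?C" "subfield F' (P d)" for c d F F'
  proof -
    have "carrier (?M c F) = carrier (?M c F') \<longleftrightarrow> F = F'" if "c = d"
      using paige_over_carrier_inj[OF fld[OF c(1)] c(2)] d(2) that by blast
    then show ?thesis unfolding loop_less_def le_iff[OF c d] by blast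
  qed
  have nonassoc: "nonassociative K" if "K \<in> ?S" for K using that by (simp add: simple_paige_loops_def)
  \<comment> \<open>all proper inclusions stay within one characteristic, where they are inclusions of fields\<close>
  have least: "(\<exists>K\<in>?S. loop_less K (?M c F)) \<longleftrightarrow> F \<noteq> \<Delta> c" if c: "c \<in> ?C" "?gal c F" for c F
  proof
    assume "\<exists>K\<in>?S. loop_less K (?M c F)"
    then obtain K where K: "K \<in> ?S" "loop_less K (?M c F)" by blast
    then obtain d F' where d: "d \<in> ?C" "?gal d F'" "loop_less (?M d F') (?M c F)"
      using S_iff[of K] by blast
    then have "d = c" "F' \<subset> F" using less_iff[OF d(1) galE(1)[OF d(1,2)] c(1) galE(1)[OF c]] by blast+
    then show "F \<noteq> \<Delta> c" using galE(2)[OF d(1,2)] by blast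
  next
    assume "F \<noteq> \<Delta> c"
    then have "loop_less (?M c (\<Delta> c)) (?M c F)"
      using less_iff[OF c(1) sub[OF c(1)] c(1) galE(1)[OF c]] galE(2)[OF c] by blast
    then show "\<exists>K\<in>?S. loop_less K (?M c F)" using S_iff c(1) gal(1)[OF c(1)] by blast
  qed
  have greatest: "(\<exists>K\<in>?S. loop_less (?M c F) K) \<longleftrightarrow> F \<noteq> carrier (P c)" if c: "c \<in> ?C" "?gal c F" for c F
  proof
    assume "\<exists>K\<in>?S. loop_less (?M c F) K"
    then obtain K where K: "K \<in> ?S" "loop_less (?M c F) K" by blast
    then obtain d F' where d: "d \<in> ?C" "?gal d F'" "loop_less (?M c F) (?M d F')"
      using S_iff[of K] by blast
    then have "c = d" "F \<subset> F'" using less_iff[OF c(1) galE(1)[OF c] d(1) galE(1)[OF d(1,2)]] by blast+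
    then show "F \<noteq> carrier (P c)" using galE(3)[OF d(1,2)] by blast
  next
    assume "F \<noteq> carrier (P c)"
    then have "loop_less (?M c F) (?M c (carrier (P c)))"
      using less_iff[OF c(1) galE(1)[OF c] c(1) galE(1)[OF c(1) gal(2)[OF c(1)]]] galE(3)[OF c] by blast
    then show "\<exists>K\<in>?S. loop_less (?M c F) K" using S_iff c(1) gal(2)[OF c(1)] by blast
  qed
  have min_iff: "minimal_loop_in ?S L \<longleftrightarrow> (\<exists>c\<in>?C. L = ?M c (\<Delta> c))" for L
  proof
    assume "minimal_loop_in ?S L"
    then have L: "L \<in> ?S" "\<not> (\<exists>K\<in>?S. loop_less K L)" by (auto simp: minimal_loop_in_def)
    then obtain c F where "c \<in> ?C" "?gal c F" "L = ?M c F" unfolding S_iff by blast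
    then show "\<exists>c\<in>?C. L = ?M c (\<Delta> c)" using least[of c F] L(2) by blast
  next
    assume "\<exists>c\<in>?C. L = ?M c (\<Delta> c)"
    then obtain c where c: "c \<in> ?C" "L = ?M c (\<Delta> c)" by blast
    then have "L \<in> ?S" using S_iff gal(1)[OF c(1)] by blast
    then show "minimal_loop_in ?S L"
      unfolding minimal_loop_in_def using least[OF c(1) gal(1)[OF c(1)]] c(2) by blast
  qed
  have max_iff: "maximal_loop_in ?S L \<longleftrightarrow> (\<exists>c\<in>?C. L = ?M c (carrier (P c)))" for L
  proof
    assume "maximal_loop_in ?S L"
    then have L: "L \<in> ?S" "\<not> (\<exists>K\<in>?S. loop_less L K)" by (auto simp: maximal_loop_in_def)
    then obtain c F where "c \<in> ?C" "?gal c F" "L = ?M c F" unfolding S_iff by blast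
    then show "\<exists>c\<in>?C. L = ?M c (carrier (P c))" using greatest[of c F] L(2) by blast
  next
    assume "\<exists>c\<in>?C. L = ?M c (carrier (P c))"
    then obtain c where c: "c \<in> ?C" "L = ?M c (carrier (P c))" by blast
    then have "L \<in> ?S" using S_iff gal(2)[OF c(1)] by blast
    then show "maximal_loop_in ?S L"
      unfolding maximal_loop_in_def using greatest[OF c(1) gal(2)[OF c(1)]] c(2) by blast
  qed
  have fin: "finite (carrier (?M c (\<Delta> c))) \<longleftrightarrow> c \<noteq> 0" if c: "c \<in> ?C" for c
  proof -
    have f: "field (P c\<lparr>carrier := \<Delta> c\<rparr>)" by (rule field_subfield[OF fld[OF c] sub[OF c]])
    have "finite (\<Delta> c) \<longleftrightarrow> c \<noteq> 0"
      using finite_prime_field[OF prime_fields[OF c]] infinite_char_0[OF f] char[OF c]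
      by (cases "c = 0") (simp_all add: has_characteristic_subfield)
    then show ?thesis unfolding finite_paige_loop_iff[OF f] by simp
  qed
  have zero: "0 \<in> ?C" and primes: "p \<in> ?C \<and> p \<noteq> 0 \<longleftrightarrow> prime p" for p
    by (auto simp: prime_field_chars_iff prime_gt_0_nat)
  have full: "?M c (carrier (P c)) = paige_loop (P c)" for c by simp
  show ?thesis
  proof (intro conjI)
    show "{L. minimal_loop_in ?S L \<and> finite (carrier L)} = {?M p (\<Delta> p) | p. prime p}"
      unfolding min_iff using fin primes by blast
    show "{L. minimal_loop_in ?S L \<and> infinite (carrier L)} = {?M 0 (\<Delta> 0)}"
    proof -
      have "minimal_loop_in ?S L \<and> infinite (carrier L) \<longleftrightarrow> L = ?M 0 (\<Delta> 0)" for L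
      proof
        assume "minimal_loop_in ?S L \<and> infinite (carrier L)"
        then obtain c where c: "c \<in> ?C" "L = ?M c (\<Delta> c)" "infinite (carrier L)"
          unfolding min_iff by blast
        then have "c = 0" using fin[OF c(1)] by blast
        then show "L = ?M 0 (\<Delta> 0)" using c(2) by simp
      next
        assume "L = ?M 0 (\<Delta> 0)"
        then show "minimal_loop_in ?S L \<and> infinite (carrier L)"
          unfolding min_iff using fin[OF zero] zero by blast
      qed
      then show ?thesis by simp
    qed
    show "{L \<in> ?S. \<not> (\<exists>K\<in>?S. loop_less K L \<and> nonassociative K)} = {?M c (\<Delta> c) | c. c \<in> ?C}"
    proof -
      have "L \<in> ?S \<and> \<not> (\<exists>K\<in>?S. loop_less K L \<and> nonassociative K) \<longleftrightarrow> minimal_loop_in ?S L" for L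
        unfolding minimal_loop_in_def using nonassoc by blast
      then show ?thesis unfolding min_iff by blast
    qed
    show "{L. maximal_loop_in ?S L} = {paige_loop (P c) | c. c \<in> ?C}"
      unfolding max_iff full by blast
    show "\<forall>c d. c \<in> ?C \<and> d \<in> ?C \<and> c \<noteq> d \<longrightarrow> \<not> paige_loop (P c) \<cong> paige_loop (P d)"
      using not_iso_paige_closures closed char by blast
    show "\<forall>p q m n F F'. prime p \<and> prime q \<and> 0 < m \<and> 0 < n \<and>
          subfield F (P q) \<and> card F = q ^ m \<and> subfield F' (P p) \<and> card F' = p ^ n \<longrightarrow>
          (loop_le (?M q F) (?M p F') \<longleftrightarrow> q = p \<and> m dvd n)"
    proof (intro allI impI, elim conjE)
      fix p q m n :: nat and F F'
      assume pq: "prime p" "prime q" and m: "0 < m" and F: "subfield F (P q)" "card F = q ^ m"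
        and F': "subfield F' (P p)" "card F' = p ^ n"
      have C: "p \<in> ?C" "q \<in> ?C" using pq by (simp_all add: prime_field_chars_iff)
      interpret field "P p" by (rule fld[OF C(1)])
      have "F \<subseteq> F' \<longleftrightarrow> m dvd n" if "q = p"
        using finite_subfield_mono[of F p m F' n] finite_subfield_dvd[of F p m F' n] F F' m that
          prime_ge_2_nat[OF pq(1)] prime_gt_0_nat[OF pq(1)] by blast
      then show "loop_le (?M q F) (?M p F') \<longleftrightarrow> q = p \<and> m dvd n"
        unfolding le_iff[OF C(2) F(1) C(1) F'(1)] by blast
    qed
  qed
qed

end
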